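(* For every $n\ge 1$, with $k=\lfloor n/2\rfloor$, the polytope $P_{\mathrm{QTSASM}}\subseteq\mathbb R^{n\times n}$ is the set of all $X=(x_{i,j})\in P_{\mathrm{ASM}}\cap P_{\mathrm{QTS}}$ satisfying $$\frac{\displaystyle\sum_{(i,j)\in\widetilde C}s_{i,j}\sum_{j'=1}^{j}x_{i,j'}}{2}\ \le\ \left\lfloor\frac{|\{(i,j)\in\widetilde C: s_{i,j}=1\}|-|\{i\in[k]: s_{i,n}=-1\}|}{2}\right\rfloor\qquad\text{for all } S=(s_{i,j})\in\mathcal S.$$
   Context: $[n]=\{1,\dots,n\}$. An $n\times n$ alternating sign matrix (ASM) is an $n\times n$ matrix with entries in $\{0,1,-1\}$ such that in each row and each column the non-zero entries alternate in sign and the first and last non-zero entries are $1$ (so every row and column sums to $1$). $P_{\mathrm{ASM}}\subseteq\mathbb R^{n\times n}$ is the convex hull of all $n\times n$ ASMs. $P_{\mathrm{QTS}}=\{X\in\mathbb R^{n\times n}: x_{i,j}=x_{j,n+1-i}\ \forall i,j\in[n]\}$. A QTSASM (quarter-turn symmetric ASM) is an $n\times n$ ASM lying in $P_{\mathrm{QTS}}$, and $P_{\mathrm{QTSASM}}$ is the convex hull of all $n\times n$ QTSASMs (the empty set if there are none). Let $k=\lfloor n/2\rfloor$, $\ell=\lceil n/2\rceil$, and $C=[\ell]\times[k]$. Define $\widetilde C=[k]\times[n]$ if $n$ is even and $\widetilde C=([k]\times[n])\cup\{(k+1,j): j\in[k]\}$ if $n$ is odd. Put $n_i=n$ for $i\in[k]$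 and, when $n$ is odd, $n_{k+1}=k$. Define $$\mathcal S=\Bigl\{S=(s_{i,j})\in\{0,1,-1\}^{\widetilde C}\ :\ \sum_{j'=j}^{n_i}s_{i,j'}+\sum_{i'=n+1-i}^{n}s_{j,i'}\ \text{is even for all }(i,j)\in C\Bigr\}.$$ *)

theory Defs
  imports "HOL-Analysis.Analysis" "HOL-Library.FuncSet"
begin

text \<open>
  \<open>n \<times> n\<close> matrices are elements of \<open>real ^ 'n ^ 'n\<close>, where \<open>'n\<close> is a finite linearly
  ordered type with \<open>n = CARD('n)\<close>. The \<open>i\<close>-th index, for \<open>i\<close> between \<open>1\<close> and \<open>n\<close>, is the
  \<open>i\<close>-th smallest element of \<open>'n\<close>, so that rows are numbered from top to bottom and columns from
  left to right by \<open>1, \<dots>, n\<close>.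
\<close>

definition idx :: "nat \<Rightarrow> 'n::{finite,linorder}" where
  "idx i = sorted_list_of_set UNIV ! (i - 1)"

definition entry :: "real ^ 'n::{finite,linorder} ^ 'n::{finite,linorder} \<Rightarrow> nat \<Rightarrow> nat \<Rightarrow> real" where
  "entry X i j = X $ idx i $ idx j"

text \<open>
  The side condition \<open>xs \<noteq> []\<close> is part of the requirement that the first and the last non-zero
  entry be \<open>1\<close>: such entries have to exist.
\<close>

definition alternating_line :: "real list \<Rightarrow> bool" where
  "alternating_line r \<longleftrightarrow>
     set r \<subseteq> {0, 1, -1} \<and>
     (let xs = filter (\<lambda>x. x \<noteq> 0) r
      in xs \<noteq> [] \<and> hd xs = 1 \<and> last xs = 1 \<and> successively (\<lambda>x y. sgn y = - sgn x) xs)"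

definition ASM :: "(real ^ 'n::{finite,linorder} ^ 'n::{finite,linorder}) set" where
  "ASM = {X. (\<forall>i\<in>{1..CARD('n)}. alternating_line (map (\<lambda>j. entry X i j) [1..<CARD('n) + 1])) \<and>
             (\<forall>j\<in>{1..CARD('n)}. alternating_line (map (\<lambda>i. entry X i j) [1..<CARD('n) + 1]))}"

definition P_ASM :: "(real ^ 'n::{finite,linorder} ^ 'n::{finite,linorder}) set" where
  "P_ASM = convex hull ASM"

definition P_QTS :: "(real ^ 'n::{finite,linorder} ^ 'n::{finite,linorder}) set" where
  "P_QTS = {X. \<forall>i\<in>{1..CARD('n)}. \<forall>j\<in>{1..CARD('n)}. entry X i j = entry X j (CARD('n) + 1 - i)}"

definition P_QTSASM :: "(real ^ 'n::{finite,linorder} ^ 'n::{finite,linorder}) set" where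
  "P_QTSASM = convex hull (ASM \<inter> P_QTS)"

text \<open>Below, \<open>n div 2\<close> is \<open>k\<close> and \<open>(n + 1) div 2\<close> is \<open>\<lceil>n / 2\<rceil>\<close>.\<close>

definition C_set :: "nat \<Rightarrow> (nat \<times> nat) set" where
  "C_set n = {1..(n + 1) div 2} \<times> {1..n div 2}"

definition C_tilde :: "nat \<Rightarrow> (nat \<times> nat) set" where
  "C_tilde n = (if even n then {1..n div 2} \<times> {1..n}
                else ({1..n div 2} \<times> {1..n}) \<union> {(n div 2 + 1, j) |j. j \<in> {1..n div 2}})"

text \<open>
  The number \<open>n\<^sub>i\<close> of cells of \<open>C_tilde n\<close> in row \<open>i\<close>. It is only used for \<open>i\<close> between \<open>1\<close> and
  \<open>(n + 1) div 2\<close>, so the second case arises only for odd \<open>n\<close> and \<open>i = n div 2 + 1\<close>.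
\<close>

definition row_len :: "nat \<Rightarrow> nat \<Rightarrow> nat" where
  "row_len n i = (if i \<le> n div 2 then n else n div 2)"

definition S_set :: "nat \<Rightarrow> (nat \<times> nat \<Rightarrow> int) set" where
  "S_set n = {s \<in> C_tilde n \<rightarrow>\<^sub>E {0, 1, -1}.
     \<forall>(i, j)\<in>C_set n.
       even ((\<Sum>j'=j..row_len n i. s (i, j')) + (\<Sum>i'=n + 1 - i..n. s (j, i')))}"

end

theory Submission
  imports Defs
begin

text \<open>
  In terms of the row prefix sums \<open>y (i, j)\<close> on \<open>C_tilde n\<close>, a rotation-invariant matrix is a solution
  of one linear equation per cell of \<open>C_set n\<close>, and every \<open>y (i, j)\<close> occurs in at most two of these
  equations: the cells are the vertices and the prefix sums the edges of a bidirected graph.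
  The alternating sign matrices among them are the 0/1 solutions, so the theorem is an
  instance of the Edmonds--Johnson theorem: the convex hull of the 0/1 solutions is cut out by the
  equations, the bounds, and the parity inequalities of the vertex sets \<open>U\<close>. The elements of \<open>S_set n\<close>
  are, modulo 2, exactly the edge boundaries of such sets \<open>U\<close>.

  Edmonds--Johnson is shown by induction on the size of the graph. An integral edge is deleted.
  A tight parity cut is contracted from either side; exactly one edge of the cut deviates from the chosen
  set \<open>F\<close> in every solution of either side, so the two decompositions can be glued along that edge.
  If there is neither, \<open>y\<close> is moved in both directions along a solution of the
  homogeneous system until one of these cases arises; if there is no such solution, then all
  values are \<open>1 / 2\<close> and all degrees are at most \<open>2\<close>.
\<close>

section \<open>The Edmonds--Johnson theorem with 0/1 bounds\<close>

text \<open>Deleting an edge or contracting one side of a cut changes the right-hand side, so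
  \<open>b\<close> is arbitrary although the application has \<open>b = 0\<close>. Contraction makes
  progress only if both sides have at least two vertices; cuts with a smaller side never obstruct,
  because the vertex equations already imply their inequalities. The obstacle in the application is
  that some prefix sums do not have two distinct ends: those in the last column, the one at
  \<open>(k + 1, k)\<close> for odd \<open>n\<close>, and the loop at \<open>(k, k)\<close> for even
  \<open>n\<close>. The last column has value 1 and can be deleted; the other two must first be
  brought under control by parity cuts. Validity of the inequalities does not go through the graph.
  Summation by parts turns the left-hand sum into one whose coefficients are the even numbers in the
  definition of \<open>S_set\<close>, so for an integer matrix half of it is an integer and the
  bound may be rounded down. The second cardinality in the bound arises because a full row sum is 1,
  so that an entry -1 of \<open>s\<close> in the last column always contributes -1.\<close>

text \<open>A bidirected graph is given by an integer matrix \<open>a\<close> with rows indexed by vertices and columns by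
  edges. Subsets of the edge set stand for 0/1 vectors, and \<open>mixture\<close> expresses a vector \<open>y\<close> as a convex
  combination of such vectors with weights \<open>w\<close>.\<close>

definition bd :: "'e set \<Rightarrow> ('v \<Rightarrow> 'e \<Rightarrow> int) \<Rightarrow> 'v set \<Rightarrow> 'e set" where
  "bd E a U = {e \<in> E. odd (\<Sum>v\<in>U. a v e)}"

text \<open>For \<open>F \<subseteq> D\<close> and values between 0 and 1 this is the l1 distance on
  \<open>D\<close> between \<open>y\<close> and the indicator of \<open>F\<close>; for a 0/1 vector
  it counts the edges of \<open>D\<close> on which the two differ.\<close>

definition gap :: "'e set \<Rightarrow> 'e set \<Rightarrow> ('e \<Rightarrow> real) \<Rightarrow> real" where
  "gap D F y = (\<Sum>e\<in>F. 1 - y e) + (\<Sum>e\<in>D - F. y e)"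

definition frac_sol :: "'v set \<Rightarrow> 'e set \<Rightarrow> ('v \<Rightarrow> 'e \<Rightarrow> int) \<Rightarrow> ('v \<Rightarrow> int) \<Rightarrow> ('e \<Rightarrow> real) \<Rightarrow> bool" where
  "frac_sol V E a b y \<longleftrightarrow> (\<forall>e\<in>E. 0 \<le> y e \<and> y e \<le> 1) \<and>
     (\<forall>v\<in>V. (\<Sum>e\<in>E. of_int (a v e) * y e) = of_int (b v))"

text \<open>Summing the equations of a 0/1 solution over \<open>U\<close> modulo 2 shows that it
  uses a number of boundary edges of the parity of \<open>sum b U\<close>. A set \<open>F\<close> of
  the other parity therefore differs from it somewhere on the boundary.\<close>

definition parity_cuts :: "'v set \<Rightarrow> 'e set \<Rightarrow> ('v \<Rightarrow> 'e \<Rightarrow> int) \<Rightarrow> ('v \<Rightarrow> int) \<Rightarrow> ('e \<Rightarrow> real) \<Rightarrow> bool" where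
  "parity_cuts V E a b y \<longleftrightarrow>
     (\<forall>U F. U \<subseteq> V \<longrightarrow> F \<subseteq> bd E a U \<longrightarrow> odd (int (card F) + sum b U) \<longrightarrow> 1 \<le> gap (bd E a U) F y)"

definition int_sol :: "'v set \<Rightarrow> 'e set \<Rightarrow> ('v \<Rightarrow> 'e \<Rightarrow> int) \<Rightarrow> ('v \<Rightarrow> int) \<Rightarrow> 'e set \<Rightarrow> bool" where
  "int_sol V E a b p \<longleftrightarrow> p \<subseteq> E \<and> (\<forall>v\<in>V. (\<Sum>e\<in>p. a v e) = b v)"

definition two_ended :: "'v set \<Rightarrow> ('v \<Rightarrow> 'e \<Rightarrow> int) \<Rightarrow> 'e \<Rightarrow> bool" where
  "two_ended V a e \<longleftrightarrow> (\<forall>v\<in>V. \<bar>a v e\<bar> \<le> 1) \<and> (\<Sum>v\<in>V. \<bar>a v e\<bar>) = 2"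

definition mixture :: "'e set \<Rightarrow> ('e set \<Rightarrow> bool) \<Rightarrow> ('e \<Rightarrow> real) \<Rightarrow> ('e set \<Rightarrow> real) \<Rightarrow> bool" where
  "mixture E P y w \<longleftrightarrow> (\<forall>p. 0 \<le> w p) \<and> (\<forall>p. w p \<noteq> 0 \<longrightarrow> p \<subseteq> E \<and> P p) \<and>
     sum w (Pow E) = 1 \<and> (\<forall>e\<in>E. sum w {p \<in> Pow E. e \<in> p} = y e)"

section \<open>Convex combinations of edge sets and their gluing\<close>

lemma mixture_mono:
  assumes "mixture E P y w" "\<And>p. p \<subseteq> E \<Longrightarrow> P p \<Longrightarrow> Q p"
  shows "mixture E Q y w"
  using assms by (simp add: mixture_def)

lemma mixture_convex:
  assumes "mixture E P y1 w1" "mixture E P y2 w2" "0 \<le> s" "0 \<le> t" "s + t = 1"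
    and "\<And>e. e \<in> E \<Longrightarrow> y e = s * y1 e + t * y2 e"
  shows "mixture E P y (\<lambda>p. s * w1 p + t * w2 p)"
proof -
  have "p \<subseteq> E \<and> P p" if "s * w1 p + t * w2 p \<noteq> 0" for p
  proof -
    have "w1 p \<noteq> 0 \<or> w2 p \<noteq> 0" using that by auto
    then show ?thesis using assms(1,2) unfolding mixture_def by blast
  qed
  then show ?thesis
    using assms unfolding mixture_def
    by (simp add: sum.distrib sum_distrib_left[symmetric])
qed

lemma mixture_indicator:
  assumes "finite E" "p \<subseteq> E" "P p"
  shows "mixture E P (\<lambda>e. of_bool (e \<in> p)) (\<lambda>q. of_bool (q = p))"
proof -
  have "(\<Sum>q\<in>A. of_bool (q = p)) = (of_bool (p \<in> A) :: real)" if "A \<subseteq> Pow E" for A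
    using that finite_subset[OF that] assms(1) by (simp add: of_bool_def)
  then show ?thesis
    using assms by (auto simp: mixture_def)
qed

lemma mixture_push:
  assumes "finite E" "finite E'" "mixture E' P' y' w"
    and "\<And>p. p \<subseteq> E' \<Longrightarrow> P' p \<Longrightarrow> f p \<subseteq> E \<and> P (f p)"
    and "\<And>p. p \<subseteq> E' \<Longrightarrow> f p \<subseteq> E"
    and "\<And>e. e \<in> E \<Longrightarrow> sum w {p \<in> Pow E'. e \<in> f p} = y e"
  shows "mixture E P y (\<lambda>q. sum w {p \<in> Pow E'. f p = q})"
proof -
  have fin: "finite (Pow E')" "finite (Pow E)" using assms by auto
  have tot: "(\<Sum>q\<in>{q \<in> Pow E. Q q}. sum w {p \<in> Pow E'. f p = q}) = sum w {p \<in> Pow E'. Q (f p)}" for Q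
  proof -
    have "(\<Sum>q\<in>{q \<in> Pow E. Q q}. sum w {p \<in> {p \<in> Pow E'. Q (f p)}. f p = q}) = sum w {p \<in> Pow E'. Q (f p)}"
      using assms(5) fin by (intro sum.group) auto
    moreover have "{p \<in> {p \<in> Pow E'. Q (f p)}. f p = q} = {p \<in> Pow E'. f p = q}" if "Q q" for q
      using that by auto
    ultimately show ?thesis by (metis (mono_tags, lifting) mem_Collect_eq sum.cong)
  qed
  have "q \<subseteq> E \<and> P q" if nz: "sum w {p \<in> Pow E'. f p = q} \<noteq> 0" for q
  proof -
    obtain p where "p \<in> Pow E'" "f p = q" "w p \<noteq> 0"
      using sum.not_neutral_contains_not_neutral[OF nz] by blast
    then show ?thesis using assms(3,4) unfolding mixture_def by blast
  qed
  moreover have "0 \<le> sum w {p \<in> Pow E'. f p = q}" for q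
    using assms(3) unfolding mixture_def by (intro sum_nonneg) auto
  moreover have "(\<Sum>q\<in>Pow E. sum w {p \<in> Pow E'. f p = q}) = 1"
    using tot[of "\<lambda>_. True"] assms(3) by (simp add: mixture_def Pow_def)
  ultimately show ?thesis
    unfolding mixture_def using tot assms(6) by simp
qed

text \<open>Both distributions induce the same distribution of the trace on
  \<open>E1 \<inter> E2\<close>, so one can draw a trace and then complete it on the two sides
  independently. This is the coupling \<open>w1 * w2 / m1\<close>.\<close>

lemma glue_weights:
  fixes w1 w2 :: "'e set \<Rightarrow> real"
  assumes fin: "finite E1" "finite E2"
    and nn: "\<And>p. 0 \<le> w1 p" "\<And>p. 0 \<le> w2 p"
    and m: "\<And>T. T \<subseteq> E1 \<inter> E2 \<Longrightarrow> sum w1 {p \<in> Pow E1. p \<inter> E2 = T} = sum w2 {p \<in> Pow E2. p \<inter> E1 = T}"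
  obtains w :: "'e set \<Rightarrow> real" where "\<And>p. 0 \<le> w p"
    and "\<And>p. w p \<noteq> 0 \<Longrightarrow> p \<subseteq> E1 \<union> E2 \<and> w1 (p \<inter> E1) \<noteq> 0 \<and> w2 (p \<inter> E2) \<noteq> 0"
    and "\<And>q. q \<subseteq> E1 \<Longrightarrow> sum w {p \<in> Pow (E1 \<union> E2). p \<inter> E1 = q} = w1 q"
    and "\<And>q. q \<subseteq> E2 \<Longrightarrow> sum w {p \<in> Pow (E1 \<union> E2). p \<inter> E2 = q} = w2 q"
proof -
  define m1 where "m1 T = sum w1 {p \<in> Pow E1. p \<inter> E2 = T}" for T
  define w where "w p = (if p \<subseteq> E1 \<union> E2 then w1 (p \<inter> E1) * w2 (p \<inter> E2) / m1 (p \<inter> E1 \<inter> E2) else 0)" for p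
  have m1nn: "0 \<le> m1 T" for T unfolding m1_def by (intro sum_nonneg nn)
  \<comment> \<open>Only sets of weight 0 lie above a trace of weight 0, so the quotient, which is 0
    there by the convention for division, still has the right marginals.\<close>
  have z1: "w1 q = 0" if "q \<subseteq> E1" "m1 (q \<inter> E2) = 0" for q
  proof -
    have "\<forall>p\<in>{p \<in> Pow E1. p \<inter> E2 = q \<inter> E2}. w1 p = 0"
      using that(2) fin nn unfolding m1_def by (subst (asm) sum_nonneg_eq_0_iff) auto
    then show ?thesis using that by auto
  qed
  have m2: "m1 T = sum w2 {p \<in> Pow E2. p \<inter> E1 = T}" if "T \<subseteq> E1 \<inter> E2" for T
    using m[OF that] by (simp add: m1_def)
  have z2: "w2 q = 0" if "q \<subseteq> E2" "m1 (q \<inter> E1) = 0" for q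
  proof -
    have "q \<inter> E1 \<subseteq> E1 \<inter> E2" using that by auto
    then have "\<forall>p\<in>{p \<in> Pow E2. p \<inter> E1 = q \<inter> E1}. w2 p = 0"
      using that(2) fin nn unfolding m2[OF \<open>q \<inter> E1 \<subseteq> E1 \<inter> E2\<close>] by (subst (asm) sum_nonneg_eq_0_iff) auto
    then show ?thesis using that by auto
  qed
  have s1: "sum w {p \<in> Pow (E1 \<union> E2). p \<inter> E1 = q} = w1 q" if q: "q \<subseteq> E1" for q
  proof -
    have "sum w {p \<in> Pow (E1 \<union> E2). p \<inter> E1 = q} =
      (\<Sum>p\<in>{p \<in> Pow (E1 \<union> E2). p \<inter> E1 = q}. w1 q / m1 (q \<inter> E2) * w2 (p \<inter> E2))"
      by (intro sum.cong) (auto simp: w_def)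
    also have "\<dots> = (\<Sum>p\<in>{p \<in> Pow E2. p \<inter> E1 = q \<inter> E2}. w1 q / m1 (q \<inter> E2) * w2 p)"
      using q by (intro sum.reindex_bij_witness[where i = "\<lambda>p. p \<union> q" and j = "\<lambda>p. p \<inter> E2"]) auto
    also have "\<dots> = w1 q / m1 (q \<inter> E2) * m1 (q \<inter> E2)"
      using m2[OF Int_mono[OF q order_refl]] by (simp add: sum_distrib_left)
    also have "\<dots> = w1 q" using z1[OF q] by auto
    finally show ?thesis .
  qed
  have s2: "sum w {p \<in> Pow (E1 \<union> E2). p \<inter> E2 = q} = w2 q" if q: "q \<subseteq> E2" for q
  proof -
    have "sum w {p \<in> Pow (E1 \<union> E2). p \<inter> E2 = q} =
      (\<Sum>p\<in>{p \<in> Pow (E1 \<union> E2). p \<inter> E2 = q}. w2 q / m1 (q \<inter> E1) * w1 (p \<inter> E1))"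
      by (intro sum.cong) (auto simp: w_def Int_ac)
    also have "\<dots> = (\<Sum>p\<in>{p \<in> Pow E1. p \<inter> E2 = q \<inter> E1}. w2 q / m1 (q \<inter> E1) * w1 p)"
      using q by (intro sum.reindex_bij_witness[where i = "\<lambda>p. p \<union> q" and j = "\<lambda>p. p \<inter> E1"]) auto
    also have "\<dots> = w2 q / m1 (q \<inter> E1) * m1 (q \<inter> E1)"
      by (auto simp: sum_distrib_left m1_def)
    also have "\<dots> = w2 q" using z2[OF q] by auto
    finally show ?thesis .
  qed
  show ?thesis
  proof (rule that[of w])
    show "0 \<le> w p" for p by (auto simp: w_def nn m1nn)
    show "w p \<noteq> 0 \<Longrightarrow> p \<subseteq> E1 \<union> E2 \<and> w1 (p \<inter> E1) \<noteq> 0 \<and> w2 (p \<inter> E2) \<noteq> 0" for p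
      by (auto simp: w_def split: if_splits)
  qed (use s1 s2 in auto)
qed

lemma glue_mixtures:
  assumes fin: "finite E1" "finite E2"
    and mx: "mixture E1 P1 y w1" "mixture E2 P2 y w2"
    and m: "\<And>T. T \<subseteq> E1 \<inter> E2 \<Longrightarrow> sum w1 {p \<in> Pow E1. p \<inter> E2 = T} = sum w2 {p \<in> Pow E2. p \<inter> E1 = T}"
  shows "\<exists>w. mixture (E1 \<union> E2) (\<lambda>p. P1 (p \<inter> E1) \<and> P2 (p \<inter> E2)) y w"
proof -
  have nn: "\<And>p. 0 \<le> w1 p" "\<And>p. 0 \<le> w2 p" using mx by (auto simp: mixture_def)
  obtain w where w: "\<And>p. 0 \<le> w p"
    "\<And>p. w p \<noteq> 0 \<Longrightarrow> p \<subseteq> E1 \<union> E2 \<and> w1 (p \<inter> E1) \<noteq> 0 \<and> w2 (p \<inter> E2) \<noteq> 0"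
    "\<And>q. q \<subseteq> E1 \<Longrightarrow> sum w {p \<in> Pow (E1 \<union> E2). p \<inter> E1 = q} = w1 q"
    "\<And>q. q \<subseteq> E2 \<Longrightarrow> sum w {p \<in> Pow (E1 \<union> E2). p \<inter> E2 = q} = w2 q"
    by (rule glue_weights[OF fin nn m]) blast+
  have grp: "sum w {p \<in> Pow (E1 \<union> E2). Q (p \<inter> E')} = sum w' {q \<in> Pow E'. Q q}"
    if "\<And>q. q \<subseteq> E' \<Longrightarrow> sum w {p \<in> Pow (E1 \<union> E2). p \<inter> E' = q} = w' q" "finite E'" for E' w' Q
  proof -
    have "sum w {p \<in> Pow (E1 \<union> E2). Q (p \<inter> E')} =
      (\<Sum>q\<in>{q \<in> Pow E'. Q q}. sum w {p \<in> {p \<in> Pow (E1 \<union> E2). Q (p \<inter> E')}. p \<inter> E' = q})"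
      using fin that(2) by (intro sum.group[symmetric]) auto
    also have "\<dots> = (\<Sum>q\<in>{q \<in> Pow E'. Q q}. sum w {p \<in> Pow (E1 \<union> E2). p \<inter> E' = q})"
      by (intro sum.cong refl arg_cong[where f = "sum w"]) auto
    also have "\<dots> = sum w' {q \<in> Pow E'. Q q}" using that(1) by (intro sum.cong) auto
    finally show ?thesis .
  qed
  have "sum w {p \<in> Pow (E1 \<union> E2). e \<in> p} = y e" if "e \<in> E1 \<union> E2" for e
  proof (cases "e \<in> E1")
    case True
    then have "{p \<in> Pow (E1 \<union> E2). e \<in> p} = {p \<in> Pow (E1 \<union> E2). e \<in> p \<inter> E1}" by auto
    then show ?thesis using grp[OF w(3) fin(1), of "\<lambda>q. e \<in> q"] mx(1) True by (simp add: mixture_def)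
  next
    case False
    then have "e \<in> E2" "{p \<in> Pow (E1 \<union> E2). e \<in> p} = {p \<in> Pow (E1 \<union> E2). e \<in> p \<inter> E2}" using that by auto
    then show ?thesis using grp[OF w(4) fin(2), of "\<lambda>q. e \<in> q"] mx(2) by (simp add: mixture_def)
  qed
  moreover have "sum w (Pow (E1 \<union> E2)) = 1"
    using grp[OF w(3) fin(1), of "\<lambda>_. True"] mx(1) by (simp add: mixture_def Pow_def)
  moreover have "p \<subseteq> E1 \<union> E2 \<and> P1 (p \<inter> E1) \<and> P2 (p \<inter> E2)" if "w p \<noteq> 0" for p
    using w(2)[OF that] mx unfolding mixture_def by blast
  ultimately show ?thesis using w(1) unfolding mixture_def by blast
qed

text \<open>The value of the trace weight depends on \<open>y\<close> only, so the two sides of a tight cut can be glued.\<close>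

lemma trace_marginal:
  assumes fin: "finite E" and mx: "mixture E P y w" and D: "D \<subseteq> E" "F \<subseteq> D" "T \<subseteq> D"
    and one: "\<And>p. p \<subseteq> E \<Longrightarrow> P p \<Longrightarrow> \<exists>e. {x \<in> D. (x \<in> p) \<noteq> (x \<in> F)} = {e}"
  shows "sum w {p \<in> Pow E. p \<inter> D = T} =
    (if \<exists>e. {x \<in> D. (x \<in> T) \<noteq> (x \<in> F)} = {e}
     then let e = the_elem {x \<in> D. (x \<in> T) \<noteq> (x \<in> F)} in (if e \<in> F then 1 - y e else y e) else 0)"
proof (cases "\<exists>e. {x \<in> D. (x \<in> T) \<noteq> (x \<in> F)} = {e}")
  case True
  then obtain e where e: "{x \<in> D. (x \<in> T) \<noteq> (x \<in> F)} = {e}" by blast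
  then have eD: "e \<in> D" by auto
  have w0: "w p = 0" if "p \<subseteq> E" "\<not> P p" for p using mx that unfolding mixture_def by blast
  \<comment> \<open>Every set of positive weight deviates from \<open>F\<close> on \<open>D\<close>
    in exactly one edge, so deviating at \<open>e\<close> already fixes the trace to be
    \<open>T\<close>.\<close>
  have "sum w {p \<in> Pow E. p \<inter> D = T} = sum w {p \<in> Pow E. (e \<in> p) \<noteq> (e \<in> F)}"
  proof (rule sum.mono_neutral_cong_left)
    show "{p \<in> Pow E. p \<inter> D = T} \<subseteq> {p \<in> Pow E. (e \<in> p) \<noteq> (e \<in> F)}" using e D by blast
    show "\<forall>p\<in>{p \<in> Pow E. (e \<in> p) \<noteq> (e \<in> F)} - {p \<in> Pow E. p \<inter> D = T}. w p = 0"
    proof (intro ballI, rule ccontr)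
      fix p assume p: "p \<in> {p \<in> Pow E. (e \<in> p) \<noteq> (e \<in> F)} - {p \<in> Pow E. p \<inter> D = T}" and "w p \<noteq> 0"
      then have "P p" using w0 by auto
      then obtain e' where e': "{x \<in> D. (x \<in> p) \<noteq> (x \<in> F)} = {e'}" using one p by blast
      moreover have "e \<in> {x \<in> D. (x \<in> p) \<noteq> (x \<in> F)}" using p eD by auto
      ultimately have "e' = e" by auto
      with e' have "p \<inter> D = T" using e D by blast
      with p show False by auto
    qed
  qed (use fin in auto)
  also have "\<dots> = (if e \<in> F then 1 - y e else y e)"
  proof (cases "e \<in> F")
    case True
    have "sum w (Pow E) = sum w {p \<in> Pow E. e \<in> p} + sum w {p \<in> Pow E. e \<notin> p}"
      using fin by (subst sum.union_disjoint[symmetric]) (auto intro!: sum.cong)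
    then show ?thesis using mx True eD D by (auto simp: mixture_def)
  next
    case False
    then show ?thesis using mx eD D by (auto simp: mixture_def)
  qed
  finally show ?thesis using e by simp
next
  case False
  have "w p = 0" if "p \<subseteq> E" "p \<inter> D = T" for p
  proof (rule ccontr)
    assume "w p \<noteq> 0"
    then have "P p" using mx unfolding mixture_def by blast
    then have "\<exists>e. {x \<in> D. (x \<in> p) \<noteq> (x \<in> F)} = {e}" using one that by blast
    moreover have "{x \<in> D. (x \<in> p) \<noteq> (x \<in> F)} = {x \<in> D. (x \<in> T) \<noteq> (x \<in> F)}" using that by auto
    ultimately show False using False by simp
  qed
  then show ?thesis using False by (auto intro: sum.neutral)
qed

section \<open>Linear systems over the reals and modulo 2\<close>

lemma homogeneous_nontrivial:
  fixes A :: "'v \<Rightarrow> 'e \<Rightarrow> real"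
  assumes "finite V" "finite E" "card V < card E"
  shows "\<exists>d. (\<exists>e\<in>E. d e \<noteq> 0) \<and> (\<forall>v\<in>V. (\<Sum>e\<in>E. A v e * d e) = 0)"
  using assms
proof (induction V arbitrary: E A rule: finite_induct)
  case empty
  then have "E \<noteq> {}" by auto
  then show ?case by (intro exI[of _ "\<lambda>_. 1"]) auto
next
  case (insert v V)
  show ?case
  proof (cases "\<forall>e\<in>E. A v e = 0")
    case True
    have "card V < card E" using insert by simp
    then obtain d where "\<exists>e\<in>E. d e \<noteq> 0" "\<forall>v\<in>V. (\<Sum>e\<in>E. A v e * d e) = 0" using insert by blast
    then show ?thesis using True by (intro exI[of _ d]) auto
  next
    case False
    then obtain f where f: "f \<in> E" "A v f \<noteq> 0" by blast
    \<comment> \<open>Gaussian elimination with pivot \<open>f\<close>: a multiple of row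
      \<open>v\<close> cancels column \<open>f\<close> in row \<open>u\<close>, and the value of
      \<open>d\<close> at \<open>f\<close> is then chosen to satisfy row \<open>v\<close>.\<close>
    define A' where "A' u e = A u e - A u f * (A v e / A v f)" for u e
    have "card V < card (E - {f})" using insert f by (simp add: card_Diff_singleton)
    then obtain d' where d': "\<exists>e\<in>E - {f}. d' e \<noteq> 0" "\<forall>u\<in>V. (\<Sum>e\<in>E - {f}. A' u e * d' e) = 0"
      using insert.IH[of "E - {f}" A'] insert.prems by auto
    define s where "s = (\<Sum>e\<in>E - {f}. A v e * d' e)"
    define d where "d = d'(f := - s / A v f)"
    have split: "(\<Sum>e\<in>E. A u e * d e) = (\<Sum>e\<in>E - {f}. A u e * d' e) - A u f * s / A v f" for u
    proof -
      have "(\<Sum>e\<in>E. A u e * d e) = A u f * d f + (\<Sum>e\<in>E - {f}. A u e * d e)"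
        using insert.prems f by (intro sum.remove) auto
      also have "(\<Sum>e\<in>E - {f}. A u e * d e) = (\<Sum>e\<in>E - {f}. A u e * d' e)"
        by (intro sum.cong) (auto simp: d_def)
      finally show ?thesis by (simp add: d_def)
    qed
    have "(\<Sum>e\<in>E. A u e * d e) = 0" if "u \<in> V" for u
    proof -
      have "0 = (\<Sum>e\<in>E - {f}. A u e * d' e - A u f / A v f * (A v e * d' e))"
        using d'(2) that by (simp add: A'_def algebra_simps)
      also have "\<dots> = (\<Sum>e\<in>E - {f}. A u e * d' e) - A u f / A v f * s"
        by (simp add: sum_subtractf sum_distrib_left s_def)
      finally show ?thesis unfolding split by simp
    qed
    moreover have "(\<Sum>e\<in>E. A v e * d e) = 0" unfolding split using f by (simp add: s_def)
    moreover have "\<exists>e\<in>E. d e \<noteq> 0" using d'(1) by (auto simp: d_def)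
    ultimately show ?thesis by blast
  qed
qed

lemma parity_sum_sym_diff:
  fixes f :: "'v \<Rightarrow> int"
  assumes "finite A" "finite B"
  shows "even (sum f ((A - B) \<union> (B - A))) \<longleftrightarrow> even (sum f A + sum f B)"
proof -
  have "sum f A = sum f (A - B) + sum f (A \<inter> B)" "sum f B = sum f (B - A) + sum f (A \<inter> B)"
    using assms by (metis sum.Int_Diff add.commute, metis sum.Int_Diff add.commute Int_commute)
  moreover have "sum f ((A - B) \<union> (B - A)) = sum f (A - B) + sum f (B - A)"
    using assms by (intro sum.union_disjoint) auto
  ultimately show ?thesis by presburger
qed

text \<open>The Fredholm alternative over the field with two elements: a set \<open>U\<close> with
  empty boundary and odd \<open>sum b U\<close> is a certificate of unsolvability. The induction
  decides whether the new edge is used, which changes \<open>b\<close> by the column of that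
  edge.\<close>

lemma parity_solvable:
  fixes a :: "'v \<Rightarrow> 'e \<Rightarrow> int"
  assumes "finite E" "finite V" "\<And>U. U \<subseteq> V \<Longrightarrow> bd E a U = {} \<Longrightarrow> even (sum b U)"
  shows "\<exists>p\<subseteq>E. \<forall>v\<in>V. even ((\<Sum>e\<in>p. a v e) - b v)"
  using assms
proof (induction E arbitrary: b rule: finite_induct)
  case empty
  have "even (b v)" if "v \<in> V" for v using empty(2)[of "{v}"] that by (simp add: bd_def)
  then show ?case by auto
next
  case (insert e E)
  let ?b = "\<lambda>v. b v - a v e"
  show ?case
  proof (cases "\<forall>U. U \<subseteq> V \<longrightarrow> bd E a U = {} \<longrightarrow> even (sum b U)")
    case True
    then obtain p where "p \<subseteq> E" "\<forall>v\<in>V. even ((\<Sum>e\<in>p. a v e) - b v)"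
      using insert.IH[of b] insert.prems(1) by auto
    then show ?thesis by blast
  next
    case no1: False
    show ?thesis
    proof (cases "\<forall>U. U \<subseteq> V \<longrightarrow> bd E a U = {} \<longrightarrow> even (sum ?b U)")
      case True
      then obtain p where p: "p \<subseteq> E" "\<forall>v\<in>V. even ((\<Sum>e\<in>p. a v e) - ?b v)"
        using insert.IH[of ?b] insert.prems(1) by auto
      have "finite p" "e \<notin> p" using p insert finite_subset by auto
      then show ?thesis using p by (intro exI[of _ "insert e p"]) (auto simp: algebra_simps)
    next
      case False
      then obtain U2 where U2: "U2 \<subseteq> V" "bd E a U2 = {}" "odd (sum ?b U2)" by blast
      obtain U1 where U1: "U1 \<subseteq> V" "bd E a U1 = {}" "odd (sum b U1)" using no1 by blast
    \<comment> \<open>Both choices for \<open>e\<close> have a certificate. Each certificate must be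
      crossed by \<open>e\<close>, so \<open>e\<close> cancels in the symmetric difference, which
      would be a certificate for the whole edge set.\<close>
    let ?U = "(U1 - U2) \<union> (U2 - U1)"
    have fin: "finite U1" "finite U2" using U1(1) U2(1) insert.prems(1) finite_subset by auto
    have e1: "odd (\<Sum>v\<in>U1. a v e)"
      using insert.prems(2)[OF U1(1)] U1(2,3) by (auto simp: bd_def)
    have e2: "odd (\<Sum>v\<in>U2. a v e)"
      using insert.prems(2)[OF U2(1)] U2(2,3) by (auto simp: bd_def sum_subtractf)
    then have "even (sum b U2)" using U2(3) by (simp add: sum_subtractf)
    then have "odd (sum b ?U)" using U1(3) parity_sum_sym_diff[OF fin, of b] by simp
    moreover have "bd (insert e E) a ?U = {}"
      using e1 e2 U1(2) U2(2) parity_sum_sym_diff[OF fin] by (auto simp: bd_def)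
    moreover have "?U \<subseteq> V" using U1 U2 by auto
    ultimately show ?thesis using insert.prems(2) by blast
    qed
  qed
qed

text \<open>The ratio test: a pair \<open>(c, r)\<close> is a constraint with present slack
  \<open>c\<close> and slope \<open>r\<close>, and \<open>t\<close> is the smallest time at which a
  decreasing slack vanishes.\<close>

lemma first_hitting_time:
  fixes I :: "(real \<times> real) set"
  assumes "finite I" "\<And>c r. (c, r) \<in> I \<Longrightarrow> 0 < c" "(c0, r0) \<in> I" "r0 < 0"
  shows "\<exists>t>0. (\<forall>(c, r)\<in>I. 0 \<le> c + t * r) \<and> (\<exists>(c, r)\<in>I. c + t * r = 0)"
proof -
  define J where "J = (\<lambda>(c, r). c / - r) ` {(c, r) \<in> I. r < 0}"
  have J: "finite J" "J \<noteq> {}" using assms by (auto simp: J_def intro: finite_subset[of _ I])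
  define t where "t = Min J"
  have "t \<in> J" using J by (simp add: t_def)
  then obtain c r where cr: "(c, r) \<in> I" "r < 0" "t = c / - r" by (auto simp: J_def)
  have t: "0 < t" using cr assms(2)[OF cr(1)] by (simp add: divide_pos_neg)
  have "0 \<le> c' + t * r'" if "(c', r') \<in> I" for c' r'
  proof (cases "r' < 0")
    case True
    then have "t \<le> c' / - r'" using J that unfolding t_def J_def by (intro Min_le) auto
    then show ?thesis using True by (simp add: field_simps)
  next
    case False
    then show ?thesis using t assms(2)[OF that] by (simp add: add_nonneg_nonneg)
  qed
  moreover have "c + t * r = 0" using cr by (simp add: field_simps)
  ultimately show ?thesis using t cr(1) by blast
qed


section \<open>Boundaries, gaps and parity cuts\<close>

lemma even_sum_abs: "even (\<Sum>v\<in>U. \<bar>f v :: int\<bar>) \<longleftrightarrow> even (\<Sum>v\<in>U. f v)"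
proof -
  have "even ((\<Sum>v\<in>U. \<bar>f v\<bar>) - (\<Sum>v\<in>U. f v))"
    unfolding sum_subtractf[symmetric] by (intro dvd_sum) (simp add: abs_if)
  then show ?thesis by simp
qed

lemma gap_line:
  "gap D F (\<lambda>e. y e + t * d e) = gap D F y + t * (sum d (D - F) - sum d F)"
  by (simp add: gap_def sum.distrib sum_subtractf sum_distrib_left algebra_simps)

lemma two_ended_even: "two_ended V a e \<Longrightarrow> even (\<Sum>v\<in>V. a v e)"
  using even_sum_abs[of "\<lambda>v. a v e" V] by (simp add: two_ended_def)

lemma bd_complement:
  assumes "finite V" "U \<subseteq> V" "\<And>e. e \<in> E \<Longrightarrow> two_ended V a e"
  shows "bd E a (V - U) = bd E a U"
  using assms two_ended_even[of V a] by (auto simp: bd_def sum_diff)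

text \<open>The gap at a single vertex is at least \<open>\<bar>s - b v\<bar>\<close>, where \<open>s\<close> is the sum of the signs of \<open>F\<close>;
  parity makes this difference non-zero.\<close>

lemma single_vertex_cut:
  assumes fin: "finite E" and a: "\<And>e. e \<in> E \<Longrightarrow> \<bar>a v e\<bar> \<le> 1" and y: "frac_sol V E a b y" "v \<in> V"
    and F: "F \<subseteq> bd E a {v}" "odd (int (card F) + b v)"
  shows "1 \<le> gap (bd E a {v}) F y"
proof -
  define D where "D = bd E a {v}"
  have D: "D \<subseteq> E" "finite D" "F \<subseteq> D" "finite F"
    using fin F finite_subset unfolding D_def bd_def by (auto intro: finite_subset)
  have aD: "a v e = 1 \<or> a v e = -1" if "e \<in> D" for e
    using a[of e] that by (auto simp: D_def bd_def abs_le_iff elim!: oddE)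
  have aE: "a v e = 0" if "e \<in> E - D" for e
  proof -
    have "\<bar>a v e\<bar> \<le> 1" "even (a v e)" using a[of e] that by (auto simp: D_def bd_def)
    then show ?thesis by presburger
  qed
  define s where "s = (\<Sum>e\<in>F. a v e)"
  have "real_of_int (b v) = (\<Sum>e\<in>E. of_int (a v e) * y e)" using y by (simp add: frac_sol_def)
  also have "\<dots> = (\<Sum>e\<in>D. of_int (a v e) * y e)"
    using D fin aE by (intro sum.mono_neutral_right) auto
  also have "\<dots> = (\<Sum>e\<in>D - F. of_int (a v e) * y e) + (\<Sum>e\<in>F. of_int (a v e) * y e)"
    using D by (intro sum.subset_diff)
  finally have b: "real_of_int (b v) = (\<Sum>e\<in>D - F. of_int (a v e) * y e) + (\<Sum>e\<in>F. of_int (a v e) * y e)" .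
  have y01: "0 \<le> y e" "y e \<le> 1" if "e \<in> D" for e using y that D by (auto simp: frac_sol_def)
  have sg: "0 \<le> 1 - real_of_int (a v e)" "0 \<le> 1 + real_of_int (a v e)" if "e \<in> D" for e
    using aD[OF that] by auto
  \<comment> \<open>The gap exceeds \<open>s - b v\<close>, and below likewise
    \<open>b v - s\<close>, by a sum of products of non-negative factors, since all coefficients on
    \<open>D\<close> are 1 or -1.\<close>
  have "gap D F y + of_int (b v) - of_int s =
    (\<Sum>e\<in>F. (1 - of_int (a v e)) * (1 - y e)) + (\<Sum>e\<in>D - F. (1 + of_int (a v e)) * y e)"
    unfolding gap_def b s_def by (simp add: sum.distrib sum_subtractf algebra_simps)
  also have "\<dots> \<ge> 0"
    using D(3) y01 sg by (intro add_nonneg_nonneg[OF sum_nonneg sum_nonneg] mult_nonneg_nonneg) auto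
  finally have 1: "of_int (s - b v) \<le> gap D F y" by simp
  have "gap D F y - of_int (b v) + of_int s =
    (\<Sum>e\<in>F. (1 + of_int (a v e)) * (1 - y e)) + (\<Sum>e\<in>D - F. (1 - of_int (a v e)) * y e)"
    unfolding gap_def b s_def by (simp add: sum.distrib sum_subtractf algebra_simps)
  also have "\<dots> \<ge> 0"
    using D(3) y01 sg by (intro add_nonneg_nonneg[OF sum_nonneg sum_nonneg] mult_nonneg_nonneg) auto
  finally have 2: "of_int (b v - s) \<le> gap D F y" by simp
  have "even (s + int (card F))"
  proof -
    have "s + int (card F) = (\<Sum>e\<in>F. a v e + 1)" by (simp add: s_def sum.distrib)
    also have "even \<dots>" using aD D by (intro dvd_sum) force
    finally show ?thesis .
  qed
  then have "s - b v \<noteq> 0" using F(2) by auto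
  then have "1 \<le> s - b v \<or> 1 \<le> b v - s" by linarith
  then have "1 \<le> real_of_int (s - b v) \<or> 1 \<le> real_of_int (b v - s)" by linarith
  then show ?thesis using 1 2 by (auto simp: D_def)
qed

text \<open>The only \<open>F\<close> in an empty boundary is the empty set, with gap 0; an odd
  \<open>sum b U\<close> would violate its inequality. This excludes the certificates of
  unsolvability modulo 2.\<close>

lemma parity_cuts_even:
  assumes "parity_cuts V E a b y" "U \<subseteq> V" "bd E a U = {}"
  shows "even (sum b U)"
  using assms unfolding parity_cuts_def gap_def
  by (metis add_0 card.empty empty_iff finite.emptyI int_ops(1) not_one_le_zero subsetI sum.empty Diff_empty)

text \<open>Cuts with at most one vertex on a side follow from the equations, after passing to the
  complement if necessary. What remains to be watched are exactly the cuts whose contraction makes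
  the graph smaller from both sides.\<close>

lemma parity_cuts_from_nontrivial:
  assumes fin: "finite V" "finite E" and te: "\<And>e. e \<in> E \<Longrightarrow> two_ended V a e"
    and y: "frac_sol V E a b y" and ev: "even (sum b V)"
    and nt: "\<And>U F. U \<subseteq> V \<Longrightarrow> 2 \<le> card U \<Longrightarrow> 2 \<le> card (V - U) \<Longrightarrow> F \<subseteq> bd E a U \<Longrightarrow>
      odd (int (card F) + sum b U) \<Longrightarrow> 1 \<le> gap (bd E a U) F y"
  shows "parity_cuts V E a b y"
  unfolding parity_cuts_def
proof (intro allI impI)
  fix U F assume U: "U \<subseteq> V" and F: "F \<subseteq> bd E a U" and odd: "odd (int (card F) + sum b U)"
  have small: "1 \<le> gap (bd E a W) F y"
    if "W \<subseteq> V" "card W \<le> 1" "F \<subseteq> bd E a W" "odd (int (card F) + sum b W)" for W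
  proof -
    have "finite W" using that fin finite_subset by blast
    show ?thesis
    proof (cases "W = {}")
      case True
      then show ?thesis using that by (auto simp: bd_def)
    next
      case False
      then have "card W = 1" using that(2) \<open>finite W\<close> by (metis card_0_eq le_antisym less_one linorder_not_le)
      then obtain v where v: "W = {v}" using card_1_singletonE by blast
      then show ?thesis
        using single_vertex_cut[OF fin(2) _ y, of v F] that te by (auto simp: two_ended_def)
    qed
  qed
  consider "card U \<le> 1" | "card (V - U) \<le> 1" | "2 \<le> card U" "2 \<le> card (V - U)" by linarith
  then show "1 \<le> gap (bd E a U) F y"
  proof cases
    case 1
    then show ?thesis using small U F odd by blast
  next
    case 2
    have "odd (int (card F) + sum b (V - U))" using odd ev U fin by (simp add: sum_diff)
    then show ?thesis
      using small[of "V - U"] 2 F bd_complement[OF fin(1) U te] by simp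
  next
    case 3
    then show ?thesis using nt U F odd by blast
  qed
qed

text \<open>The edge \<open>f\<close> is fixed at its value, and its contribution moves to the
  right-hand side. A parity cut crossed by \<open>f\<close> is compared with one of the full graph
  in which \<open>f\<close> adds nothing to the gap.\<close>

lemma delete_integral_edge:
  assumes fin: "finite V" "finite E" and f: "f \<in> E" "y f = of_bool c"
    and y: "frac_sol V E a b y" "parity_cuts V E a b y"
  defines "b' \<equiv> \<lambda>v. b v - a v f * of_bool c"
  shows "frac_sol V (E - {f}) a b' y" "parity_cuts V (E - {f}) a b' y"
    and "mixture (E - {f}) (int_sol V (E - {f}) a b') y w \<Longrightarrow> \<exists>w. mixture E (int_sol V E a b) y w"
proof -
  show "frac_sol V (E - {f}) a b' y"
    using y(1) fin f by (auto simp: frac_sol_def b'_def sum_diff1)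
  show "parity_cuts V (E - {f}) a b' y"
    unfolding parity_cuts_def
  proof (intro allI impI)
    fix U F assume U: "U \<subseteq> V" and F: "F \<subseteq> bd (E - {f}) a U" and odd: "odd (int (card F) + sum b' U)"
    have finU: "finite U" "finite F" using U F fin finite_subset[of F E] finite_subset by (auto simp: bd_def)
    have sb: "sum b' U = sum b U - of_bool c * (\<Sum>v\<in>U. a v f)"
      by (simp add: b'_def sum_subtractf sum_distrib_left mult.commute)
    have fF: "f \<notin> F" using F by (auto simp: bd_def)
    show "1 \<le> gap (bd (E - {f}) a U) F y"
    proof (cases "odd (\<Sum>v\<in>U. a v f)")
      case False
      then have "bd E a U = bd (E - {f}) a U" by (auto simp: bd_def)
      moreover have "odd (int (card F) + sum b U)" using odd False unfolding sb by simp
      ultimately show ?thesis using y(2) U F unfolding parity_cuts_def by metis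
    next
      case True
      then have bd: "bd E a U = insert f (bd (E - {f}) a U)" "f \<notin> bd (E - {f}) a U"
        using f by (auto simp: bd_def)
      have finbd: "finite (bd (E - {f}) a U)" using fin by (simp add: bd_def)
      \<comment> \<open>With \<open>f\<close> in the chosen set exactly when its value is 1, its gap
        term is 0, and the parity of the cardinality changes exactly when that of the right-hand
        side does.\<close>
      define F' where "F' = (if c then insert f F else F)"
      have "F' \<subseteq> bd E a U" using F bd by (auto simp: F'_def)
      moreover have "odd (int (card F') + sum b U)" using odd True fF finU unfolding sb F'_def by auto
      ultimately have "1 \<le> gap (bd E a U) F' y" using y(2) U unfolding parity_cuts_def by metis
      also have "\<dots> = gap (bd (E - {f}) a U) F y"
        using f(2) bd fF finU finbd
        by (cases c) (auto simp: gap_def F'_def insert_Diff_if)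
      finally show ?thesis .
    qed
  qed
  assume w: "mixture (E - {f}) (int_sol V (E - {f}) a b') y w"
  let ?f = "\<lambda>p. if c then insert f p else p"
  have "mixture E (int_sol V E a b) y (\<lambda>q. sum w {p \<in> Pow (E - {f}). ?f p = q})"
  proof (rule mixture_push[OF _ _ w])
    fix p assume p: "p \<subseteq> E - {f}"
    show "?f p \<subseteq> E" using p f by auto
    have "finite p" "f \<notin> p" using p fin finite_subset by auto
    moreover assume "int_sol V (E - {f}) a b' p"
    ultimately show "?f p \<subseteq> E \<and> int_sol V E a b (?f p)"
      using p f by (auto simp: int_sol_def b'_def)
  next
    fix e assume e: "e \<in> E"
    show "sum w {p \<in> Pow (E - {f}). e \<in> ?f p} = y e"
    proof (cases "e = f")
      case True
      have "{p \<in> Pow (E - {f}). e \<in> ?f p} = (if c then Pow (E - {f}) else {})" using True by auto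
      then show ?thesis using w True f by (simp add: mixture_def)
    next
      case False
      have "{p \<in> Pow (E - {f}). e \<in> ?f p} = {p \<in> Pow (E - {f}). e \<in> p}" using False by auto
      then show ?thesis using w False e unfolding mixture_def by auto
    qed
  qed (use fin in auto)
  then show "\<exists>w. mixture E (int_sol V E a b) y w" by blast
qed

section \<open>Contraction of a tight parity cut\<close>

lemma odd_sum_nonzero:
  assumes "odd (sum f U :: int)"
  shows "\<exists>v\<in>U. f v \<noteq> 0"
  using assms sum.neutral[of U f] by fastforce

text \<open>The side \<open>V - U\<close> shrinks to one of its vertices \<open>r\<close>. The new
  equation at \<open>r\<close>, with -1 on \<open>F\<close>, 1 on the rest of the boundary and
  right-hand side \<open>1 - card F\<close>, says that the gap is 1. For a 0/1 vector the gap counts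
  deviations from \<open>F\<close>, so an integral solution deviates in exactly one edge.\<close>

lemma contract_tight_cut:
  assumes fin: "finite V" "finite E" and te: "\<forall>e\<in>E. two_ended V a e"
    and y: "frac_sol V E a b y" "parity_cuts V E a b y"
    and U: "U \<subseteq> V" "r \<in> V - U" and F: "F \<subseteq> bd E a U" "odd (int (card F) + sum b U)"
    and tight: "gap (bd E a U) F y = 1"
  defines "E1 \<equiv> {e \<in> E. \<exists>v\<in>U. a v e \<noteq> 0}"
    and "a1 \<equiv> \<lambda>v e. if v = r then (if e \<in> bd E a U then (if e \<in> F then -1 else 1) else 0) else a v e"
    and "b1 \<equiv> b(r := 1 - int (card F))"
  shows "frac_sol (insert r U) E1 a1 b1 y" "parity_cuts (insert r U) E1 a1 b1 y"
    and "\<And>e. e \<in> E1 \<Longrightarrow> two_ended (insert r U) a1 e"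
    and "\<And>p. int_sol (insert r U) E1 a1 b1 p \<Longrightarrow>
      (\<exists>e. {x \<in> bd E a U. (x \<in> p) \<noteq> (x \<in> F)} = {e}) \<and> (\<forall>v\<in>U. (\<Sum>e\<in>p. a v e) = b v)"
proof -
  define D where "D = bd E a U"
  have finU: "finite U" and rU: "r \<notin> U" using U fin finite_subset by auto
  have D1: "D \<subseteq> E1"
  proof
    fix e assume "e \<in> D"
    then have "e \<in> E" "odd (\<Sum>v\<in>U. a v e)" by (auto simp: D_def bd_def)
    then show "e \<in> E1" using odd_sum_nonzero[of "\<lambda>v. a v e"] by (auto simp: E1_def)
  qed
  have E1E: "E1 \<subseteq> E" by (auto simp: E1_def)
  have finE1: "finite E1" using fin E1E finite_subset by auto
  have finD: "finite D" using finE1 D1 finite_subset by auto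
  have FD: "F \<subseteq> D" and finF: "finite F" using F(1) finD finite_subset by (auto simp: D_def)
  have a1U: "a1 v e = a v e" if "v \<in> U" for v e using that rU by (auto simp: a1_def)
  have a1r: "a1 r e = (if e \<in> D then (if e \<in> F then -1 else 1) else 0)" for e by (simp add: a1_def D_def)
  have sumr: "(\<Sum>e\<in>A. of_int (a1 r e) * g e) = sum g (A \<inter> D - F) - sum g (A \<inter> F)"
    if "finite A" for A and g :: "'b \<Rightarrow> 'c::ring_1"
  proof -
    have "(\<Sum>e\<in>A. of_int (a1 r e) * g e) = (\<Sum>e\<in>A \<inter> D. if e \<in> F then - g e else g e)"
      using that by (simp add: a1r sum.inter_restrict) (auto intro!: sum.cong)
    also have "\<dots> = (\<Sum>e\<in>A \<inter> D \<inter> F. - g e) + (\<Sum>e\<in>A \<inter> D \<inter> - F. g e)"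
      using that by (simp add: sum.If_cases)
    also have "A \<inter> D \<inter> F = A \<inter> F" using FD by blast
    also have "A \<inter> D \<inter> - F = A \<inter> D - F" by blast
    finally show ?thesis by (simp add: sum_negf)
  qed
  show "frac_sol (insert r U) E1 a1 b1 y"
    unfolding frac_sol_def
  proof (intro conjI ballI)
    fix v assume "v \<in> insert r U"
    then consider "v = r" | "v \<in> U" "v \<noteq> r" using rU by blast
    then show "(\<Sum>e\<in>E1. of_int (a1 v e) * y e) = of_int (b1 v)"
    proof cases
      case 1
      have "E1 \<inter> D = D" "E1 \<inter> F = F" using D1 FD by auto
      then have "(\<Sum>e\<in>E1. of_int (a1 r e) * y e) = sum y (D - F) - sum y F" using sumr[OF finE1, of y] by simp
      also have "\<dots> = 1 - real (card F)" using tight by (simp add: gap_def sum_subtractf D_def)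
      finally show ?thesis using 1 by (simp add: b1_def)
    next
      case 2
      have "(\<Sum>e\<in>E1. of_int (a1 v e) * y e) = (\<Sum>e\<in>E1. of_int (a v e) * y e)" using 2 by (simp add: a1U)
      also have "\<dots> = (\<Sum>e\<in>E. of_int (a v e) * y e)"
        using 2 fin by (intro sum.mono_neutral_left) (auto simp: E1_def)
      also have "\<dots> = of_int (b v)" using y(1) 2 U by (auto simp: frac_sol_def)
      finally show ?thesis using 2 by (simp add: b1_def)
    qed
  qed (use y(1) in \<open>auto simp: frac_sol_def E1_def\<close>)
  show "parity_cuts (insert r U) E1 a1 b1 y"
    unfolding parity_cuts_def
  proof (intro allI impI)
    fix U' F' assume U': "U' \<subseteq> insert r U" and F': "F' \<subseteq> bd E1 a1 U'" "odd (int (card F') + sum b1 U')"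
    \<comment> \<open>Each cut of the contracted graph has the boundary and the parity of a cut of
      the original graph. If it contains \<open>r\<close>, adding the row of \<open>r\<close>
      amounts modulo 2 to adding all rows of \<open>U\<close>, so the vertices of \<open>U\<close>
      outside \<open>U'\<close> define the original cut.\<close>
    obtain W where W: "W \<subseteq> V" "bd E1 a1 U' = bd E a W" "even (sum b1 U') = even (sum b W)"
    proof (cases "r \<in> U'")
      case False
      then have sub: "U' \<subseteq> U" using U' by blast
      have eq: "(\<Sum>v\<in>U'. a1 v e) = (\<Sum>v\<in>U'. a v e)" for e using sub by (intro sum.cong) (auto simp: a1U)
      have "e \<in> E1" if "e \<in> E" "odd (\<Sum>v\<in>U'. a v e)" for e
        using that sub odd_sum_nonzero[of "\<lambda>v. a v e" U'] by (auto simp: E1_def)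
      then have "bd E1 a1 U' = bd E a U'" using E1E by (auto simp: bd_def eq)
      moreover have "sum b1 U' = sum b U'" using False by (intro sum.cong) (auto simp: b1_def)
      ultimately show ?thesis using sub U by (intro that[of U']) auto
    next
      case True
      define W where "W = U' - {r}"
      have sub: "W \<subseteq> U" and finW: "finite W" and U'W: "U' = insert r W" "r \<notin> W"
        using U' True finU finite_subset by (auto simp: W_def)
      have eq: "even (\<Sum>v\<in>U'. a1 v e) \<longleftrightarrow> even (\<Sum>v\<in>U - W. a v e)" if "e \<in> E" for e
      proof -
        have "(\<Sum>v\<in>U'. a1 v e) = a1 r e + (\<Sum>v\<in>W. a1 v e)" using U'W finW by simp
        also have "(\<Sum>v\<in>W. a1 v e) = (\<Sum>v\<in>W. a v e)" using sub by (intro sum.cong) (auto simp: a1U)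
        finally have "(\<Sum>v\<in>U'. a1 v e) = a1 r e + (\<Sum>v\<in>W. a v e)" .
        moreover have "odd (a1 r e) \<longleftrightarrow> odd (\<Sum>v\<in>U. a v e)" using that by (auto simp: a1r D_def bd_def)
        moreover have "(\<Sum>v\<in>U - W. a v e) = (\<Sum>v\<in>U. a v e) - (\<Sum>v\<in>W. a v e)"
          using sub finU by (simp add: sum_diff)
        ultimately show ?thesis by presburger
      qed
      have "e \<in> E1" if "e \<in> E" "odd (\<Sum>v\<in>U - W. a v e)" for e
        using that odd_sum_nonzero[of "\<lambda>v. a v e" "U - W"] by (auto simp: E1_def)
      then have "bd E1 a1 U' = bd E a (U - W)" using E1E eq by (auto simp: bd_def)
      moreover have "sum b1 W = sum b W" using U'W by (intro sum.cong) (auto simp: b1_def)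
      then have "sum b1 U' = 1 - int (card F) + sum b W" using U'W finW by (simp add: b1_def)
      moreover have "sum b (U - W) = sum b U - sum b W" using sub finU by (simp add: sum_diff)
      ultimately show ?thesis using U F(2) by (intro that[of "U - W"]) auto
    qed
    show "1 \<le> gap (bd E1 a1 U') F' y"
      using y(2) W F' unfolding parity_cuts_def by (metis even_add)
  qed
  show "two_ended (insert r U) a1 e" if e: "e \<in> E1" for e
    unfolding two_ended_def
  proof (intro conjI ballI)
    have te': "\<And>v. v \<in> V \<Longrightarrow> \<bar>a v e\<bar> \<le> 1" "(\<Sum>v\<in>V. \<bar>a v e\<bar>) = 2"
      using te e E1E by (auto simp: two_ended_def)
    fix v assume "v \<in> insert r U"
    then show "\<bar>a1 v e\<bar> \<le> 1" using te'(1) U by (auto simp: a1_def)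
  next
    have te': "(\<Sum>v\<in>V. \<bar>a v e\<bar>) = 2" using te e E1E by (auto simp: two_ended_def)
    \<comment> \<open>An edge of \<open>E1\<close> has one or two ends in \<open>U\<close>; one
      exactly if it lies in \<open>D\<close>, and then \<open>r\<close> supplies the second.\<close>
    have "(\<Sum>v\<in>U. \<bar>a v e\<bar>) \<le> 2" unfolding te'[symmetric] using fin U by (intro sum_mono2) auto
    moreover have "0 < (\<Sum>v\<in>U. \<bar>a v e\<bar>)" using e finU by (auto simp: E1_def intro: sum_pos2)
    moreover have "odd (\<Sum>v\<in>U. \<bar>a v e\<bar>) \<longleftrightarrow> e \<in> D" using e E1E by (auto simp: D_def bd_def even_sum_abs)
    moreover from calculation have "(\<Sum>v\<in>U. \<bar>a v e\<bar>) = 1 \<or> (\<Sum>v\<in>U. \<bar>a v e\<bar>) = 2" by linarith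
    ultimately have "(\<Sum>v\<in>U. \<bar>a v e\<bar>) = (if e \<in> D then 1 else 2)" by auto
    moreover have "(\<Sum>v\<in>insert r U. \<bar>a1 v e\<bar>) = \<bar>a1 r e\<bar> + (\<Sum>v\<in>U. \<bar>a v e\<bar>)"
      using finU rU by (simp add: a1U)
    ultimately show "(\<Sum>v\<in>insert r U. \<bar>a1 v e\<bar>) = 2" by (simp add: a1r)
  qed
  show "(\<exists>e. {x \<in> bd E a U. (x \<in> p) \<noteq> (x \<in> F)} = {e}) \<and> (\<forall>v\<in>U. (\<Sum>e\<in>p. a v e) = b v)"
    if p: "int_sol (insert r U) E1 a1 b1 p" for p
  proof (intro conjI ballI)
    have finp: "finite p" using p finE1 finite_subset by (auto simp: int_sol_def)
    have "(\<Sum>e\<in>p. a1 r e) = 1 - int (card F)" using p by (simp add: int_sol_def b1_def)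
    moreover have "(\<Sum>e\<in>p. a1 r e) = int (card (p \<inter> D - F)) - int (card (p \<inter> F))"
      using sumr[OF finp, of "\<lambda>_. 1::int"] by simp
    moreover have "card F = card (p \<inter> F) + card (F - p)"
      using finF by (metis card_Int_Diff inf_commute)
    moreover have "{x \<in> D. (x \<in> p) \<noteq> (x \<in> F)} = (p \<inter> D - F) \<union> (F - p)" using FD by auto
    then have "card {x \<in> D. (x \<in> p) \<noteq> (x \<in> F)} = card (p \<inter> D - F) + card (F - p)"
      using finp finF by (simp, subst card_Un_disjoint) auto
    ultimately have "card {x \<in> D. (x \<in> p) \<noteq> (x \<in> F)} = 1" by linarith
    then show "\<exists>e. {x \<in> bd E a U. (x \<in> p) \<noteq> (x \<in> F)} = {e}"
      unfolding D_def by (meson card_1_singletonE)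
    fix v assume v: "v \<in> U"
    then have "(\<Sum>e\<in>p. a1 v e) = b1 v" using p by (auto simp: int_sol_def)
    then show "(\<Sum>e\<in>p. a v e) = b v" using v rU by (auto simp: a1U b1_def)
  qed
qed

definition decomposable :: "'v set \<Rightarrow> 'e set \<Rightarrow> ('v \<Rightarrow> 'e \<Rightarrow> int) \<Rightarrow> ('v \<Rightarrow> int) \<Rightarrow> ('e \<Rightarrow> real) \<Rightarrow> bool" where
  "decomposable V E a b y \<longleftrightarrow> (\<exists>w. mixture E (int_sol V E a b) y w)"

lemma decompose_tight_cut:
  fixes V :: "'v set" and a :: "'v \<Rightarrow> 'e \<Rightarrow> int"
  assumes fin: "finite V" "finite E" and te: "\<And>e. e \<in> E \<Longrightarrow> two_ended V a e"
    and y: "frac_sol V E a b y" "parity_cuts V E a b y"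
    and U: "U \<subseteq> V" "2 \<le> card U" "2 \<le> card (V - U)"
    and F: "F \<subseteq> bd E a U" "odd (int (card F) + sum b U)" and tight: "gap (bd E a U) F y = 1"
    and IH: "\<And>(V' :: 'v set) E' a' b'. finite V' \<Longrightarrow> finite E' \<Longrightarrow> card V' + card E' < card V + card E \<Longrightarrow>
      (\<forall>e\<in>E'. two_ended V' a' e) \<Longrightarrow> frac_sol V' E' a' b' y \<Longrightarrow> parity_cuts V' E' a' b' y \<Longrightarrow>
      decomposable V' E' a' b' y"
  shows "decomposable V E a b y"
proof -
  define D where "D = bd E a U"
  have finU: "finite U" using U fin finite_subset by blast
  \<comment> \<open>Applied to \<open>U\<close> and to its complement, which have the same boundary
    and, as \<open>sum b V\<close> is even, the same parity. Replacing at least two vertices outside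
    \<open>W\<close> by \<open>r\<close> lowers the vertex count.\<close>
  have side: "\<exists>P w. mixture {e \<in> E. \<exists>v\<in>W. a v e \<noteq> 0} P y w \<and>
      (\<forall>p. P p \<longrightarrow> (\<exists>e. {x \<in> D. (x \<in> p) \<noteq> (x \<in> F)} = {e}) \<and> (\<forall>v\<in>W. (\<Sum>e\<in>p. a v e) = b v))"
    if W: "W \<subseteq> V" "2 \<le> card (V - W)" "bd E a W = D" "odd (int (card F) + sum b W)" for W
  proof -
    have "V - W \<noteq> {}" using W(2) by (metis card.empty not_numeral_le_zero)
    then obtain r where r: "r \<in> V - W" by blast
    have te': "\<forall>e\<in>E. two_ended V a e" using te by blast
    have FD: "F \<subseteq> bd E a W" "gap (bd E a W) F y = 1" using F tight W(3) by (auto simp: D_def)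
    note c = contract_tight_cut[OF fin te' y W(1) r FD(1) W(4) FD(2)]
    let ?E = "{e \<in> E. \<exists>v\<in>W. a v e \<noteq> 0}"
    have finW: "finite W" using W fin finite_subset by blast
    have "card V = card W + card (V - W)" using fin W finW by (simp add: card_Diff_subset card_mono)
    then have "card (insert r W) < card V" using W(2) finW r by simp
    moreover have "card ?E \<le> card E" using fin by (intro card_mono) auto
    ultimately have "card (insert r W) + card ?E < card V + card E" by linarith
    moreover have "finite (insert r W)" "finite ?E" using finW fin by auto
    ultimately have "decomposable (insert r W) ?E
        (\<lambda>v e. if v = r then (if e \<in> bd E a W then (if e \<in> F then -1 else 1) else 0) else a v e)
        (b(r := 1 - int (card F))) y"
      using c(1-3) by (intro IH) auto
    then show ?thesis using c(4) unfolding W(3) decomposable_def by blast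
  qed
  have ev: "even (sum b V)"
  proof (rule parity_cuts_even[OF y(2) order_refl])
    show "bd E a V = {}" using te two_ended_even by (force simp: bd_def)
  qed
  have VVU: "V - (V - U) = U" using U by blast
  have odd': "odd (int (card F) + sum b (V - U))" using F ev fin U by (simp add: sum_diff)
  have bdc: "bd E a (V - U) = D" using te unfolding D_def by (intro bd_complement[OF fin(1) U(1)])
  obtain P1 w1 where 1: "mixture {e \<in> E. \<exists>v\<in>U. a v e \<noteq> 0} P1 y w1"
    "\<And>p. P1 p \<Longrightarrow> \<exists>e. {x \<in> D. (x \<in> p) \<noteq> (x \<in> F)} = {e}" "\<And>p v. P1 p \<Longrightarrow> v \<in> U \<Longrightarrow> (\<Sum>e\<in>p. a v e) = b v"
    using side[OF U(1) U(3) D_def[symmetric] F(2)] by blast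
  obtain P2 w2 where 2: "mixture {e \<in> E. \<exists>v\<in>V - U. a v e \<noteq> 0} P2 y w2"
    "\<And>p. P2 p \<Longrightarrow> \<exists>e. {x \<in> D. (x \<in> p) \<noteq> (x \<in> F)} = {e}" "\<And>p v. P2 p \<Longrightarrow> v \<in> V - U \<Longrightarrow> (\<Sum>e\<in>p. a v e) = b v"
    using side[OF Diff_subset _ bdc odd'] U(2) unfolding VVU by blast
  define E1 where "E1 = {e \<in> E. \<exists>v\<in>U. a v e \<noteq> 0}"
  define E2 where "E2 = {e \<in> E. \<exists>v\<in>V - U. a v e \<noteq> 0}"
  have finE: "finite E1" "finite E2" using fin by (auto simp: E1_def E2_def)
  \<comment> \<open>An edge has absolute column sum 2, so its share in \<open>U\<close> is odd
    exactly if it has one end on each side. Hence the two sides have precisely the edges of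
    \<open>D\<close> in common.\<close>
  have ends: "e \<in> E1 \<union> E2" "e \<in> D \<longleftrightarrow> e \<in> E1 \<inter> E2" if e: "e \<in> E" for e
  proof -
    have 2: "(\<Sum>v\<in>U. \<bar>a v e\<bar>) + (\<Sum>v\<in>V - U. \<bar>a v e\<bar>) = 2"
      using te[OF e] fin U sum.subset_diff[OF U(1) fin(1), of "\<lambda>v. \<bar>a v e\<bar>"] by (simp add: two_ended_def)
    have nn: "0 \<le> (\<Sum>v\<in>U. \<bar>a v e\<bar>)" "0 \<le> (\<Sum>v\<in>V - U. \<bar>a v e\<bar>)" by (auto intro: sum_nonneg)
    have z: "(\<Sum>v\<in>U. \<bar>a v e\<bar>) = 0 \<longleftrightarrow> e \<notin> E1" "(\<Sum>v\<in>V - U. \<bar>a v e\<bar>) = 0 \<longleftrightarrow> e \<notin> E2"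
      using fin finU e by (auto simp: sum_nonneg_eq_0_iff E1_def E2_def)
    have d: "odd (\<Sum>v\<in>U. \<bar>a v e\<bar>) \<longleftrightarrow> e \<in> D" using e by (simp add: even_sum_abs D_def bd_def)
    show "e \<in> E1 \<union> E2" using 2 z by auto
    have "odd (\<Sum>v\<in>U. \<bar>a v e\<bar>) \<longleftrightarrow> (\<Sum>v\<in>U. \<bar>a v e\<bar>) \<noteq> 0 \<and> (\<Sum>v\<in>V - U. \<bar>a v e\<bar>) \<noteq> 0"
      using 2 nn by presburger
    then show "e \<in> D \<longleftrightarrow> e \<in> E1 \<inter> E2" using z d by blast
  qed
  have E12: "E1 \<union> E2 = E" "E1 \<inter> E2 = D"
    using ends by (auto simp: E1_def E2_def D_def bd_def)
  have m: "sum w1 {p \<in> Pow E1. p \<inter> E2 = T} = sum w2 {p \<in> Pow E2. p \<inter> E1 = T}" if T: "T \<subseteq> E1 \<inter> E2" for T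
  proof -
    have FD: "F \<subseteq> D" using F by (simp add: D_def)
    have "{p \<in> Pow E1. p \<inter> E2 = T} = {p \<in> Pow E1. p \<inter> D = T}" "{p \<in> Pow E2. p \<inter> E1 = T} = {p \<in> Pow E2. p \<inter> D = T}"
      using E12 by auto
    moreover have "D \<subseteq> E1" "D \<subseteq> E2" "T \<subseteq> D" using E12 T by auto
    ultimately show ?thesis
      using trace_marginal[OF finE(1) 1(1)[folded E1_def] _ FD _ 1(2)]
        trace_marginal[OF finE(2) 2(1)[folded E2_def] _ FD _ 2(2)] by simp
  qed
  obtain w where w: "mixture E (\<lambda>p. P1 (p \<inter> E1) \<and> P2 (p \<inter> E2)) y w"
    using glue_mixtures[OF finE 1(1)[folded E1_def] 2(1)[folded E2_def] m] unfolding E12 by blast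
  have "int_sol V E a b p" if p: "p \<subseteq> E" "P1 (p \<inter> E1)" "P2 (p \<inter> E2)" for p
    unfolding int_sol_def
  proof (intro conjI ballI)
    have finp: "finite p" using p fin finite_subset by blast
    fix v assume v: "v \<in> V"
    show "(\<Sum>e\<in>p. a v e) = b v"
    proof (cases "v \<in> U")
      case True
      have "(\<Sum>e\<in>p. a v e) = (\<Sum>e\<in>p \<inter> E1. a v e)"
        using finp True p by (intro sum.mono_neutral_right) (auto simp: E1_def)
      then show ?thesis using 1(3)[OF p(2) True] by simp
    next
      case False
      have "(\<Sum>e\<in>p. a v e) = (\<Sum>e\<in>p \<inter> E2. a v e)"
        using finp False v p by (intro sum.mono_neutral_right) (auto simp: E2_def)
      then show ?thesis using 2(3)[OF p(3)] False v by simp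
    qed
  qed (use p in auto)
  then have "mixture E (int_sol V E a b) y w" by (intro mixture_mono[OF w]) simp
  then show ?thesis unfolding decomposable_def by blast
qed

section \<open>Moving within the polytope\<close>

definition tight_cut :: "'v set \<Rightarrow> 'e set \<Rightarrow> ('v \<Rightarrow> 'e \<Rightarrow> int) \<Rightarrow> ('v \<Rightarrow> int) \<Rightarrow> ('e \<Rightarrow> real) \<Rightarrow> bool" where
  "tight_cut V E a b y \<longleftrightarrow> (\<exists>U F. U \<subseteq> V \<and> 2 \<le> card U \<and> 2 \<le> card (V - U) \<and> F \<subseteq> bd E a U \<and>
     odd (int (card F) + sum b U) \<and> gap (bd E a U) F y = 1)"

text \<open>\<open>I1\<close>, \<open>I2\<close> and \<open>I3\<close> list slack and slope along
  \<open>d\<close> for the lower bounds, the upper bounds and the parity cuts with two vertices on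
  each side. All slacks are positive at the start, and the first one to vanish stops the motion; the
  remaining parity cuts hold because the equations are preserved.\<close>

lemma move_to_boundary:
  assumes fin: "finite V" "finite E" and te: "\<And>e. e \<in> E \<Longrightarrow> two_ended V a e"
    and y: "frac_sol V E a b y" "parity_cuts V E a b y"
    and frac: "\<And>e. e \<in> E \<Longrightarrow> 0 < y e \<and> y e < 1" and nt: "\<not> tight_cut V E a b y"
    and d: "f \<in> E" "d f \<noteq> 0" "\<And>v. v \<in> V \<Longrightarrow> (\<Sum>e\<in>E. of_int (a v e) * d e) = 0"
  obtains t where "0 < t" "frac_sol V E a b (\<lambda>e. y e + t * d e)" "parity_cuts V E a b (\<lambda>e. y e + t * d e)"
    "(\<exists>e\<in>E. y e + t * d e = 0 \<or> y e + t * d e = 1) \<or> tight_cut V E a b (\<lambda>e. y e + t * d e)"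
proof -
  define N where "N = {(U, F). U \<subseteq> V \<and> 2 \<le> card U \<and> 2 \<le> card (V - U) \<and> F \<subseteq> bd E a U \<and> odd (int (card F) + sum b U)}"
  define I1 where "I1 = (\<lambda>e. (y e, d e)) ` E"
  define I2 where "I2 = (\<lambda>e. (1 - y e, - d e)) ` E"
  define I3 where "I3 = (\<lambda>(U, F). (gap (bd E a U) F y - 1, sum d (bd E a U - F) - sum d F)) ` N"
  have "N \<subseteq> Pow V \<times> Pow E" by (auto simp: N_def bd_def)
  then have finI: "finite (I1 \<union> I2 \<union> I3)"
    using fin finite_subset[of N "Pow V \<times> Pow E"] by (auto simp: I1_def I2_def I3_def)
  have "1 < gap (bd E a U) F y" if "(U, F) \<in> N" for U F
  proof -
    have "1 \<le> gap (bd E a U) F y" using that y(2) by (simp add: N_def parity_cuts_def)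
    moreover have "gap (bd E a U) F y \<noteq> 1" using that nt by (auto simp: N_def tight_cut_def)
    ultimately show ?thesis by simp
  qed
  then have pos: "0 < c" if "(c, r) \<in> I1 \<union> I2 \<union> I3" for c r
    using that frac by (auto simp: I1_def I2_def I3_def)
  \<comment> \<open>As \<open>d f\<close> is non-zero, one of the two bounds on \<open>f\<close> is
    approached, so the motion must stop.\<close>
  obtain c0 r0 where c0: "(c0, r0) \<in> I1 \<union> I2 \<union> I3" "r0 < 0"
  proof (cases "d f < 0")
    case True
    then show ?thesis using that[of "y f" "d f"] d(1) by (auto simp: I1_def)
  next
    case False
    then show ?thesis using that[of "1 - y f" "- d f"] d(1,2) by (auto simp: I2_def)
  qed
  have "\<exists>t>0. (\<forall>(c, r)\<in>I1 \<union> I2 \<union> I3. 0 \<le> c + t * r) \<and> (\<exists>(c, r)\<in>I1 \<union> I2 \<union> I3. c + t * r = 0)"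
    using pos c0 by (intro first_hitting_time[OF finI]) auto
  then
  obtain t where t: "0 < t" "\<And>c r. (c, r) \<in> I1 \<union> I2 \<union> I3 \<Longrightarrow> 0 \<le> c + t * r"
    "\<exists>(c, r)\<in>I1 \<union> I2 \<union> I3. c + t * r = 0" by auto
  define z where "z e = y e + t * d e" for e
  have gz: "gap (bd E a U) F z = gap (bd E a U) F y + t * (sum d (bd E a U - F) - sum d F)" for U F
    unfolding z_def by (rule gap_line)
  have z01: "0 \<le> z e" "z e \<le> 1" if "e \<in> E" for e
    using t(2)[of "y e" "d e"] t(2)[of "1 - y e" "- d e"] that by (auto simp: z_def I1_def I2_def)
  have fz: "frac_sol V E a b z"
    using y(1) d(3) z01
    by (auto simp: frac_sol_def z_def algebra_simps sum.distrib sum_distrib_left[symmetric])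
  moreover have "parity_cuts V E a b z"
  proof (rule parity_cuts_from_nontrivial[OF fin te fz])
    show "even (sum b V)"
      using two_ended_even[OF te] by (intro parity_cuts_even[OF y(2) order_refl]) (auto simp: bd_def)
  next
    fix U F assume "U \<subseteq> V" "2 \<le> card U" "2 \<le> card (V - U)" "F \<subseteq> bd E a U" "odd (int (card F) + sum b U)"
    then have "(U, F) \<in> N" by (simp add: N_def)
    then have "0 \<le> gap (bd E a U) F y - 1 + t * (sum d (bd E a U - F) - sum d F)"
      by (intro t(2)) (auto simp: I3_def)
    then show "1 \<le> gap (bd E a U) F z" by (simp add: gz)
  qed
  moreover have "(\<exists>e\<in>E. z e = 0 \<or> z e = 1) \<or> tight_cut V E a b z"
  proof -
    obtain c r where cr: "(c, r) \<in> I1 \<union> I2 \<union> I3" "c + t * r = 0" using t(3) by auto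
    then consider "(c, r) \<in> I1" | "(c, r) \<in> I2" | "(c, r) \<in> I3" by blast
    then show ?thesis
    proof cases
      case 1
      then show ?thesis using cr(2) by (auto simp: I1_def z_def)
    next
      case 2
      then obtain e where e: "e \<in> E" "c = 1 - y e" "r = - d e" by (auto simp: I2_def)
      then have "z e = 1" using cr(2) by (simp add: z_def algebra_simps)
      then show ?thesis using e(1) by blast
    next
      case 3
      then obtain U F where UF: "(U, F) \<in> N" "c = gap (bd E a U) F y - 1" "r = sum d (bd E a U - F) - sum d F"
        by (auto simp: I3_def)
      then have "gap (bd E a U) F z = 1" using cr(2) by (simp add: gz)
      then show ?thesis using UF(1) unfolding tight_cut_def N_def by blast
    qed
  qed
  moreover have "z = (\<lambda>e. y e + t * d e)" by (simp add: z_def fun_eq_iff)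
  ultimately show ?thesis using t(1) by (intro that[of t]) simp_all
qed

text \<open>A solution \<open>p\<close> of the equations modulo \<open>2\<close> and its complement differ by at most \<open>2\<close> at every vertex,
  so both are exact solutions, and \<open>y\<close> is their average.\<close>

lemma half_integral_decomposable:
  assumes fin: "finite V" "finite E" and y: "frac_sol V E a b y" "parity_cuts V E a b y"
    and half: "\<And>e. e \<in> E \<Longrightarrow> y e = 1 / 2" and deg: "\<And>v. v \<in> V \<Longrightarrow> (\<Sum>e\<in>E. \<bar>a v e\<bar>) \<le> 2"
  shows "decomposable V E a b y"
proof -
  obtain p where p: "p \<subseteq> E" "\<And>v. v \<in> V \<Longrightarrow> even ((\<Sum>e\<in>p. a v e) - b v)"
    using parity_solvable[OF fin(2,1), of a b] parity_cuts_even[OF y(2)] by blast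
  have sol: "(\<Sum>e\<in>p. a v e) = b v" "(\<Sum>e\<in>E - p. a v e) = b v" if v: "v \<in> V" for v
  proof -
    have "real_of_int (b v) = (\<Sum>e\<in>E. of_int (a v e) * y e)" using y(1) v by (simp add: frac_sol_def)
    also have "\<dots> = of_int (\<Sum>e\<in>E. a v e) / 2" by (simp add: sum_divide_distrib half cong: sum.cong)
    finally have 1: "(\<Sum>e\<in>E. a v e) = 2 * b v" by linarith
    have 2: "(\<Sum>e\<in>E. a v e) = (\<Sum>e\<in>E - p. a v e) + (\<Sum>e\<in>p. a v e)"
      using fin p by (intro sum.subset_diff)
    have "\<bar>(\<Sum>e\<in>p. a v e) - (\<Sum>e\<in>E - p. a v e)\<bar> \<le> (\<Sum>e\<in>p. \<bar>a v e\<bar>) + (\<Sum>e\<in>E - p. \<bar>a v e\<bar>)"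
      using sum_abs[of "a v" p] sum_abs[of "a v" "E - p"] by linarith
    also have "\<dots> = (\<Sum>e\<in>E. \<bar>a v e\<bar>)" using sum.subset_diff[OF p(1) fin(2), of "\<lambda>e. \<bar>a v e\<bar>"] by simp
    finally have 3: "\<bar>(\<Sum>e\<in>p. a v e) - (\<Sum>e\<in>E - p. a v e)\<bar> \<le> 2" using deg[OF v] by linarith
    have "\<bar>(\<Sum>e\<in>p. a v e) - b v\<bar> \<le> 1" using 1 2 3 by linarith
    then show "(\<Sum>e\<in>p. a v e) = b v" using p(2)[OF v] by presburger
    then show "(\<Sum>e\<in>E - p. a v e) = b v" using 1 2 by linarith
  qed
  have "mixture E (int_sol V E a b) (\<lambda>e. of_bool (e \<in> p)) (\<lambda>q. of_bool (q = p))"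
    "mixture E (int_sol V E a b) (\<lambda>e. of_bool (e \<in> E - p)) (\<lambda>q. of_bool (q = E - p))"
    using fin p sol by (intro mixture_indicator; auto simp: int_sol_def)+
  from mixture_convex[OF this, of "1/2" "1/2" y] show ?thesis
    using half unfolding decomposable_def by (force simp: of_bool_def)
qed

text \<open>Unless edges outnumber the vertices of positive degree, all these degrees are \<open>2\<close>; then \<open>2 y - 1\<close> solves the homogeneous system, because its value at a
  vertex is an even integer of absolute value less than \<open>2\<close>.\<close>

lemma fractional_direction:
  assumes fin: "finite V" "finite E" and te: "\<And>e. e \<in> E \<Longrightarrow> two_ended V a e"
    and y: "frac_sol V E a b y" and frac: "\<And>e. e \<in> E \<Longrightarrow> 0 < y e \<and> y e < 1"
  shows "(\<exists>d. (\<exists>e\<in>E. d e \<noteq> 0) \<and> (\<forall>v\<in>V. (\<Sum>e\<in>E. real_of_int (a v e) * d e) = 0)) \<or>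
    (\<forall>e\<in>E. y e = 1 / 2) \<and> (\<forall>v\<in>V. (\<Sum>e\<in>E. \<bar>a v e\<bar>) \<le> 2)"
proof -
  define deg where "deg v = (\<Sum>e\<in>E. \<bar>a v e\<bar>)" for v
  define V' where "V' = {v \<in> V. deg v \<noteq> 0}"
  have finV': "finite V'" using fin by (simp add: V'_def)
  have degz: "a v e = 0" if "v \<in> V - V'" "e \<in> E" for v e
    using that fin by (auto simp: V'_def deg_def sum_nonneg_eq_0_iff)
  have eq: "(\<Sum>e\<in>E. real_of_int (a v e) * y e) = of_int (b v)" if "v \<in> V" for v
    using y that by (simp add: frac_sol_def)
  show ?thesis
  proof (cases "card V' < card E")
    case True
    obtain d where "\<exists>e\<in>E. d e \<noteq> 0" "\<forall>v\<in>V'. (\<Sum>e\<in>E. real_of_int (a v e) * d e) = 0"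
      using homogeneous_nontrivial[OF finV' fin(2) True, of "\<lambda>v e. of_int (a v e)"] by blast
    moreover have "(\<Sum>e\<in>E. real_of_int (a v e) * d e) = 0" if "v \<in> V - V'" for v
      using degz[OF that] by simp
    ultimately show ?thesis by blast
  next
    case False
    \<comment> \<open>An edge alone at a vertex would have value \<open>b v\<close> or
      \<open>- b v\<close>, an integer strictly between 0 and 1.\<close>
    have ge2: "2 \<le> deg v" if v: "v \<in> V'" for v
    proof (rule ccontr)
      assume "\<not> 2 \<le> deg v"
      moreover have "0 \<le> deg v" by (simp add: deg_def sum_nonneg)
      ultimately have 1: "deg v = 1" using v by (auto simp: V'_def)
      have "\<exists>f\<in>E. a v f \<noteq> 0" using v by (auto simp: V'_def deg_def intro: ccontr)
      then obtain f where f: "f \<in> E" "a v f \<noteq> 0" by blast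
      have "deg v = \<bar>a v f\<bar> + (\<Sum>e\<in>E - {f}. \<bar>a v e\<bar>)"
        using f fin unfolding deg_def by (intro sum.remove) auto
      moreover have "0 \<le> (\<Sum>e\<in>E - {f}. \<bar>a v e\<bar>)" by (simp add: sum_nonneg)
      moreover have "1 \<le> \<bar>a v f\<bar>" using f by simp
      ultimately have f1: "\<bar>a v f\<bar> = 1" and "(\<Sum>e\<in>E - {f}. \<bar>a v e\<bar>) = 0" using 1 by linarith+
      then have z: "a v e = 0" if "e \<in> E - {f}" for e
        using that fin by (auto simp: sum_nonneg_eq_0_iff)
      have "of_int (b v) = (\<Sum>e\<in>E. real_of_int (a v e) * y e)" using eq v by (auto simp: V'_def)
      also have "\<dots> = of_int (a v f) * y f + (\<Sum>e\<in>E - {f}. real_of_int (a v e) * y e)"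
        using f fin by (intro sum.remove) auto
      also have "\<dots> = of_int (a v f) * y f" using z by simp
      finally have "of_int (b v) = of_int (a v f) * y f" .
      moreover have "a v f = 1 \<or> a v f = -1" using f1 by linarith
      ultimately obtain k :: int where k: "y f = of_int k" by (metis mult_1 mult_minus1 of_int_1 of_int_minus minus_equation_iff)
      have "0 < k" "k < 1" using frac[OF f(1)] unfolding k by simp_all
      then show False by simp
    qed
    \<comment> \<open>Double counting: the degrees sum to twice the number of edges, which is at
      most twice the number of vertices in \<open>V'\<close>, so no degree exceeds 2.\<close>
    have "sum deg V' = sum deg V" using fin by (intro sum.mono_neutral_left) (auto simp: V'_def)
    also have "\<dots> = (\<Sum>e\<in>E. \<Sum>v\<in>V. \<bar>a v e\<bar>)" unfolding deg_def by (rule sum.swap)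
    also have "\<dots> = 2 * int (card E)" using te by (simp add: two_ended_def)
    finally have "(\<Sum>v\<in>V'. deg v - 2) \<le> 0" using False by (simp add: sum_subtractf)
    moreover have "0 \<le> (\<Sum>v\<in>V'. deg v - 2)" using ge2 by (intro sum_nonneg) simp
    ultimately have "(\<Sum>v\<in>V'. deg v - 2) = 0" by linarith
    then have deg2: "deg v = 2" if "v \<in> V'" for v
      using that ge2 finV' by (subst (asm) sum_nonneg_eq_0_iff) auto
    have zero: "(\<Sum>e\<in>E. real_of_int (a v e) * (2 * y e - 1)) = 0" if v: "v \<in> V" for v
    proof (cases "v \<in> V'")
      case False
      then show ?thesis using degz v by simp
    next
      case True
      have int: "(\<Sum>e\<in>E. real_of_int (a v e) * (2 * y e - 1)) = of_int (2 * b v - (\<Sum>e\<in>E. a v e))"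
      proof -
        have "(\<Sum>e\<in>E. real_of_int (a v e) * (2 * y e - 1)) =
          (\<Sum>e\<in>E. 2 * (real_of_int (a v e) * y e) - of_int (a v e))" by (simp add: algebra_simps)
        then show ?thesis using eq[OF v] by (simp add: sum_subtractf sum_distrib_left[symmetric])
      qed
      obtain f where f: "f \<in> E" "a v f \<noteq> 0"
        using sum.not_neutral_contains_not_neutral[of "\<lambda>e. \<bar>a v e\<bar>" E] True by (auto simp: V'_def deg_def)
      have "\<bar>\<Sum>e\<in>E. real_of_int (a v e) * (2 * y e - 1)\<bar> \<le> (\<Sum>e\<in>E. \<bar>real_of_int (a v e) * (2 * y e - 1)\<bar>)"
        by (rule sum_abs)
      also have "\<dots> < (\<Sum>e\<in>E. real_of_int \<bar>a v e\<bar>)"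
      proof (rule sum_strict_mono_ex1[OF fin(2)])
        have 1: "\<bar>2 * y e - 1\<bar> < 1" if "e \<in> E" for e using frac[OF that] by (simp add: abs_less_iff)
        then show "\<forall>e\<in>E. \<bar>real_of_int (a v e) * (2 * y e - 1)\<bar> \<le> real_of_int \<bar>a v e\<bar>"
          by (auto simp: abs_mult intro!: mult_left_le intro: less_imp_le)
        show "\<exists>e\<in>E. \<bar>real_of_int (a v e) * (2 * y e - 1)\<bar> < real_of_int \<bar>a v e\<bar>"
          using f 1[OF f(1)] by (intro bexI[of _ f]) (simp_all add: abs_mult)
      qed
      also have "\<dots> = 2" using deg2[OF True] unfolding deg_def by (metis of_int_sum of_int_numeral)
      finally have "\<bar>2 * b v - (\<Sum>e\<in>E. a v e)\<bar> < 2" unfolding int by linarith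
      moreover have "even (\<Sum>e\<in>E. a v e)"
        using even_sum_abs[of "a v" E] deg2[OF True] by (simp add: deg_def)
      ultimately have "2 * b v - (\<Sum>e\<in>E. a v e) = 0" by presburger
      then show ?thesis unfolding int by simp
    qed
    have le2: "\<forall>v\<in>V. (\<Sum>e\<in>E. \<bar>a v e\<bar>) \<le> 2"
    proof
      fix v assume "v \<in> V"
      then show "(\<Sum>e\<in>E. \<bar>a v e\<bar>) \<le> 2"
        using deg2[of v] degz[of v] by (cases "v \<in> V'") (auto simp: deg_def)
    qed
    show ?thesis
    proof (cases "\<exists>e\<in>E. 2 * y e - 1 \<noteq> 0")
      case True
      then show ?thesis using zero by (intro disjI1 exI[of _ "\<lambda>e. 2 * y e - 1"]) blast
    next
      case False
      then show ?thesis using le2 by force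
    qed
  qed
qed

text \<open>Two ends are demanded of fractional edges only: integral edges, whatever their ends, are
  deleted before anything else is done. This is what admits the last-column variables of the
  application.\<close>

theorem edmonds_johnson_01:
  fixes V :: "'v set" and E :: "'e set"
  assumes "finite V" "finite E" "\<And>e. e \<in> E \<Longrightarrow> 0 < y e \<Longrightarrow> y e < 1 \<Longrightarrow> two_ended V a e"
    and "frac_sol V E a b y" "parity_cuts V E a b y"
  shows "decomposable V E a b y"
  using assms
proof (induction "card V + card E" arbitrary: V E a b y rule: less_induct)
  case less
  note fin = less.prems(1,2) and y = less.prems(4,5)
  have delete: "decomposable V E a b z"
    if z: "frac_sol V E a b z" "parity_cuts V E a b z"
      "\<And>e. e \<in> E \<Longrightarrow> 0 < z e \<Longrightarrow> z e < 1 \<Longrightarrow> two_ended V a e"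
      and f: "f \<in> E" "z f = 0 \<or> z f = 1" for z f
  proof -
    have zf: "z f = of_bool (z f = 1)" using f by auto
    have "card V + card (E - {f}) < card V + card E" using f fin card_Diff1_less[of E f] by auto
    then have "decomposable V (E - {f}) a (\<lambda>v. b v - a v f * of_bool (z f = 1)) z"
      using fin z(3) delete_integral_edge(1,2)[OF fin f(1) zf z(1,2)] by (intro less.hyps) auto
    then show ?thesis
      using delete_integral_edge(3)[OF fin f(1) zf z(1,2)] unfolding decomposable_def by blast
  qed
  show ?case
  proof (cases "\<exists>f\<in>E. y f = 0 \<or> y f = 1")
    case True
    then show ?thesis using delete[OF y less.prems(3)] by blast
  next
    case False
    have frac: "0 < y e \<and> y e < 1" if "e \<in> E" for e
      using y(1) False that unfolding frac_sol_def by (metis less_eq_real_def)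
    then have te: "two_ended V a e" if "e \<in> E" for e using less.prems(3) that by blast
    have tight: "decomposable V E a b z"
      if z: "frac_sol V E a b z" "parity_cuts V E a b z" "tight_cut V E a b z" for z
    proof -
      obtain U F where UF: "U \<subseteq> V" "2 \<le> card U" "2 \<le> card (V - U)" "F \<subseteq> bd E a U"
        "odd (int (card F) + sum b U)" "gap (bd E a U) F z = 1"
        using z(3) by (auto simp: tight_cut_def)
      show ?thesis
        using less.hyps by (intro decompose_tight_cut[OF fin te z(1,2) UF]) auto
    qed
    show ?thesis
    proof (cases "tight_cut V E a b y")
      case True
      then show ?thesis using tight y by blast
    next
      case nt: False
      have move: "\<exists>t>0. decomposable V E a b (\<lambda>e. y e + t * d e)"
        if d: "f \<in> E" "d f \<noteq> 0" "\<And>v. v \<in> V \<Longrightarrow> (\<Sum>e\<in>E. real_of_int (a v e) * d e) = 0" for d f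
      proof -
        obtain t where t: "0 < t" "frac_sol V E a b (\<lambda>e. y e + t * d e)" "parity_cuts V E a b (\<lambda>e. y e + t * d e)"
          "(\<exists>e\<in>E. y e + t * d e = 0 \<or> y e + t * d e = 1) \<or> tight_cut V E a b (\<lambda>e. y e + t * d e)"
          by (rule move_to_boundary[OF fin _ y _ nt d]) (use te frac in auto)
        then show ?thesis using delete[OF t(2,3)] tight[OF t(2,3)] te by blast
      qed
      show ?thesis
      proof (cases "\<exists>d. (\<exists>e\<in>E. d e \<noteq> 0) \<and> (\<forall>v\<in>V. (\<Sum>e\<in>E. real_of_int (a v e) * d e) = 0)")
        case True
        then obtain d f where d: "f \<in> E" "d f \<noteq> 0" "\<And>v. v \<in> V \<Longrightarrow> (\<Sum>e\<in>E. real_of_int (a v e) * d e) = 0" by blast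
        then have d': "- d f \<noteq> 0" "\<And>v. v \<in> V \<Longrightarrow> (\<Sum>e\<in>E. real_of_int (a v e) * - d e) = 0"
          by (auto simp: sum_negf)
        obtain s where s: "0 < s" "decomposable V E a b (\<lambda>e. y e + s * d e)" using move[OF d] by blast
        obtain t where t: "0 < t" "decomposable V E a b (\<lambda>e. y e + t * - d e)"
          using move[OF d(1) d'] by blast
        obtain w1 w2 where "mixture E (int_sol V E a b) (\<lambda>e. y e + s * d e) w1"
          "mixture E (int_sol V E a b) (\<lambda>e. y e + t * - d e) w2"
          using s(2) t(2) unfolding decomposable_def by blast
        \<comment> \<open>The weights make the displacements \<open>s * d\<close> and
          \<open>- t * d\<close> cancel.\<close>
        moreover have "t / (s + t) + s / (s + t) = 1" using s t by (simp add: add_divide_distrib[symmetric] add.commute)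
        moreover have "y e = t / (s + t) * (y e + s * d e) + s / (s + t) * (y e + t * - d e)" for e
          using s(1) t(1) by (simp add: divide_simps) (simp add: algebra_simps)
        moreover have "0 \<le> t / (s + t)" "0 \<le> s / (s + t)" using s(1) t(1) by simp_all
        ultimately show ?thesis
          unfolding decomposable_def using mixture_convex by blast
      next
        case no: False
        have "(\<forall>e\<in>E. y e = 1 / 2) \<and> (\<forall>v\<in>V. (\<Sum>e\<in>E. \<bar>a v e\<bar>) \<le> 2)"
          using fractional_direction[OF fin te y(1) frac] no by simp
        then show ?thesis by (intro half_integral_decomposable[OF fin y]) auto
      qed
    qed
  qed
qed

section \<open>Alternating lines and matrices given by entries\<close>

text \<open>After the leading non-zero entry \<open>c\<close> the non-zero entries continue with
  \<open>- c\<close>, so the partial sums oscillate between 0 and \<open>c\<close>. Both signs are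
  covered because the induction flips \<open>c\<close>.\<close>

lemma alternating_prefix_sums:
  fixes r :: "real list"
  assumes "set r \<subseteq> {0, 1, -1}" "c = 1 \<or> c = -1"
    and "successively (\<lambda>x y. sgn y = - sgn x) (filter (\<lambda>x. x \<noteq> 0) r)"
    and "filter (\<lambda>x. x \<noteq> 0) r \<noteq> [] \<Longrightarrow> hd (filter (\<lambda>x. x \<noteq> 0) r) = c"
  shows "(sum_list (take m r) = 0 \<or> sum_list (take m r) = c) \<and>
    sum_list r = (if filter (\<lambda>x. x \<noteq> 0) r \<noteq> [] \<and> last (filter (\<lambda>x. x \<noteq> 0) r) = c then c else 0)"
  using assms
proof (induction r arbitrary: c m)
  case Nil
  then show ?case by simp
next
  case (Cons x r)
  let ?f = "filter (\<lambda>x::real. x \<noteq> 0)"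
  show ?case
  proof (cases "x = 0")
    case True
    then show ?thesis using Cons.IH[of c "m - 1"] Cons.prems by (cases m) auto
  next
    case False
    then have x: "x = c" using Cons.prems(4) by simp
    have hd': "hd (?f r) = - c" if "?f r \<noteq> []"
    proof -
      obtain z zs where z: "?f r = z # zs" using \<open>?f r \<noteq> []\<close> by (meson neq_Nil_conv)
      then have "z \<in> set (?f r)" by simp
      then have "z = 1 \<or> z = -1" using Cons.prems(1) by auto
      moreover have "sgn z = - sgn x" using Cons.prems(3) False z by simp
      ultimately show ?thesis using Cons.prems(2) x z by auto
    qed
    have last': "last (?f r) = 1 \<or> last (?f r) = -1" if "?f r \<noteq> []"
      using last_in_set[OF that] Cons.prems(1) by auto
    have "successively (\<lambda>x y. sgn y = - sgn x) (?f r)"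
      using Cons.prems(3) False by (auto simp: successively_Cons)
    then have IH: "(sum_list (take m' r) = 0 \<or> sum_list (take m' r) = - c) \<and>
      sum_list r = (if ?f r \<noteq> [] \<and> last (?f r) = - c then - c else 0)" for m'
      using Cons.IH[of "- c" m'] Cons.prems(1,2) hd' by auto
    have "sum_list (take m (x # r)) = 0 \<or> sum_list (take m (x # r)) = c"
      using IH[of "m - 1"] x by (cases m) auto
    moreover have "sum_list (x # r) = (if ?f (x # r) \<noteq> [] \<and> last (?f (x # r)) = c then c else 0)"
      using IH[of 0] x False last' Cons.prems(2) by (cases "?f r = []") auto
    ultimately show ?thesis by blast
  qed
qed

lemma alternating_line_prefix_sums:
  assumes "alternating_line (map f [1..<n + 1])"
  shows "m \<le> n \<Longrightarrow> (\<Sum>j=1..m. f j) = 0 \<or> (\<Sum>j=1..m. f j) = 1" "(\<Sum>j=1..n. f j) = 1"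
proof -
  let ?r = "map f [1..<n + 1]"
  have *: "sum_list (map f [1..<m + 1]) = (\<Sum>j=1..m. f j)" for m
    by (simp only: interv_sum_list_conv_sum_set_nat set_upt atLeastLessThanSuc_atLeastAtMost Suc_eq_plus1[symmetric])
  have r: "(sum_list (take m ?r) = 0 \<or> sum_list (take m ?r) = 1) \<and> sum_list ?r = 1" for m
    using alternating_prefix_sums[of ?r 1 m] assms by (auto simp: alternating_line_def Let_def)
  show "(\<Sum>j=1..m. f j) = 0 \<or> (\<Sum>j=1..m. f j) = 1" if "m \<le> n"
  proof -
    have "take m ?r = map f [1..<m + 1]" using that by (simp add: take_map take_upt del: upt_Suc)
    then show ?thesis using r[of m] * by metis
  qed
  show "(\<Sum>j=1..n. f j) = 1" using r * by metis
qed

lemma alternating_line_differences: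
  fixes Y :: "nat \<Rightarrow> real"
  assumes "Y 0 = 0" "Y n = 1" "\<And>j. j \<le> n \<Longrightarrow> Y j = 0 \<or> Y j = 1"
  shows "alternating_line (map (\<lambda>j. Y j - Y (j - 1)) [1..<n + 1])"
proof -
  let ?r = "\<lambda>n. map (\<lambda>j. Y j - Y (j - 1)) [1..<n + 1]"
  let ?x = "\<lambda>n. filter (\<lambda>x. x \<noteq> 0) (?r n)"
  \<comment> \<open>The invariant ties the value of \<open>Y m\<close> to the sign of the last
    non-zero difference so far, so a step up can only follow a step down, and vice versa.\<close>
  have "m \<le> n \<Longrightarrow> set (?r m) \<subseteq> {0, 1, -1} \<and> (?x m \<noteq> [] \<longrightarrow> hd (?x m) = 1) \<and>
    successively (\<lambda>x y. sgn y = - sgn x) (?x m) \<and>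
    (if Y m = 1 then ?x m \<noteq> [] \<and> last (?x m) = 1 else ?x m = [] \<or> last (?x m) = -1)" for m
  proof (induction m)
    case 0
    then show ?case using assms(1) by simp
  next
    case (Suc m)
    define R where "R = ?r m"
    have r: "?r (Suc m) = R @ [Y (Suc m) - Y m]" by (simp add: R_def)
    have "set R \<subseteq> {0, 1, -1} \<and> (filter (\<lambda>x. x \<noteq> 0) R \<noteq> [] \<longrightarrow> hd (filter (\<lambda>x. x \<noteq> 0) R) = 1) \<and>
      successively (\<lambda>x y. sgn y = - sgn x) (filter (\<lambda>x. x \<noteq> 0) R) \<and>
      (if Y m = 1 then filter (\<lambda>x. x \<noteq> 0) R \<noteq> [] \<and> last (filter (\<lambda>x. x \<noteq> 0) R) = 1
       else filter (\<lambda>x. x \<noteq> 0) R = [] \<or> last (filter (\<lambda>x. x \<noteq> 0) R) = -1)"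
      unfolding R_def by (rule Suc.IH) (use Suc.prems in simp)
    moreover have "Y m = 0 \<or> Y m = 1" "Y (Suc m) = 0 \<or> Y (Suc m) = 1" using assms(3) Suc.prems by auto
    ultimately show ?case unfolding r filter_append set_append
      by (auto simp: successively_append_iff hd_append)
  qed
  from this[of n] show ?thesis
    using assms(2) unfolding alternating_line_def Let_def by auto
qed

section \<open>Matrices addressed by numeric indices\<close>

lemma idx_bij: "bij_betw idx {1..CARD('n)} (UNIV :: 'n::{finite,linorder} set)"
proof -
  let ?l = "sorted_list_of_set (UNIV :: 'n set)"
  have "bij_betw ((!) ?l) {..<length ?l} (set ?l)"
    by (intro bij_betw_nth) auto
  then have "bij_betw ((!) ?l) {..<CARD('n)} UNIV" by simp
  moreover have "bij_betw (\<lambda>i. i - 1) {1..CARD('n)} {..<CARD('n)}"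
    by (rule bij_betw_byWitness[of _ Suc]) auto
  ultimately have "bij_betw ((!) ?l \<circ> (\<lambda>i. i - 1)) {1..CARD('n)} UNIV" by (rule bij_betw_trans[rotated])
  then show ?thesis by (simp add: comp_def idx_def[abs_def])
qed

definition of_entries :: "(nat \<Rightarrow> nat \<Rightarrow> real) \<Rightarrow> real ^ 'n::{finite,linorder} ^ 'n::{finite,linorder}" where
  "of_entries f = (\<chi> a b. f (the_inv_into {1..CARD('n)} idx a) (the_inv_into {1..CARD('n)} idx b))"

lemma entry_of_entries:
  assumes "i \<in> {1..CARD('n)}" "j \<in> {1..CARD('n)}"
  shows "entry (of_entries f :: real ^ 'n::{finite,linorder} ^ 'n::{finite,linorder}) i j = f i j"
  using assms idx_bij[where 'n = 'n]
  by (simp add: entry_def of_entries_def bij_betw_def the_inv_into_f_f del: atLeastAtMost_iff)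

lemma matrix_eqI:
  fixes X Z :: "real ^ 'n::{finite,linorder} ^ 'n::{finite,linorder}"
  assumes "\<And>i j. i \<in> {1..CARD('n)} \<Longrightarrow> j \<in> {1..CARD('n)} \<Longrightarrow> entry X i j = entry Z i j"
  shows "X = Z"
proof -
  have "X $ a $ b = Z $ a $ b" for a b
  proof -
    have "idx ` {1..CARD('n)} = (UNIV :: 'n set)" using idx_bij bij_betw_imp_surj_on by blast
    then obtain i j where "i \<in> {1..CARD('n)}" "a = idx i" "j \<in> {1..CARD('n)}" "b = idx j"
      by (metis UNIV_I imageE)
    then show ?thesis using assms by (simp add: entry_def)
  qed
  then show ?thesis by (simp add: vec_eq_iff)
qed

lemma entry_scale_add: "entry (u *\<^sub>R X + v *\<^sub>R Z) i j = u * entry X i j + v * entry Z i j"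
  by (simp add: entry_def)

lemma entry_sum_scale: "entry (\<Sum>p\<in>A. w p *\<^sub>R X p) i j = (\<Sum>p\<in>A. w p * entry (X p) i j)"
  by (simp add: entry_def)

section \<open>The system of prefix sums\<close>

lemma C_tilde_iff:
  "(i, j) \<in> C_tilde n \<longleftrightarrow>
    1 \<le> i \<and> 1 \<le> j \<and> (i \<le> n div 2 \<and> j \<le> n \<or> odd n \<and> i = n div 2 + 1 \<and> j \<le> n div 2)"
  by (auto simp: C_tilde_def)

lemma C_set_iff: "(i, j) \<in> C_set n \<longleftrightarrow> 1 \<le> i \<and> i \<le> (n + 1) div 2 \<and> 1 \<le> j \<and> j \<le> n div 2"
  by (auto simp: C_set_def)

lemma finite_C_set: "finite (C_set n)"
  by (simp add: C_set_def)

lemma finite_C_tilde: "finite (C_tilde n)"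
  by (rule finite_subset[of _ "{1..n + 1} \<times> {1..n}"]) (auto simp: C_tilde_iff)

lemma C_tilde_Sigma: "C_tilde n = (SIGMA i:{1..(n + 1) div 2}. {1..row_len n i})"
  by (cases "even n") (auto simp: C_tilde_iff row_len_def elim!: evenE oddE split: if_splits)

lemma C_set_subset: "C_set n \<subseteq> C_tilde n"
  by (auto simp: C_tilde_Sigma C_set_def row_len_def)

text \<open>Summation by parts along each row gives the entry at \<open>(i, j)\<close> the tail sum
  of \<open>s\<close> from \<open>j\<close> on as coefficient. The entries of the right half, the
  region \<open>R\<close>, are then rotated back into \<open>C_set\<close>, where the two
  coefficients add up to the expression whose evenness defines \<open>S_set\<close>.\<close>

lemma weighted_prefix_sums:
  fixes x :: "nat \<Rightarrow> nat \<Rightarrow> 'a::comm_ring_1"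
  assumes sym: "\<And>i j. i \<in> {1..n} \<Longrightarrow> j \<in> {1..n} \<Longrightarrow> x i j = x j (n + 1 - i)"
  shows "(\<Sum>(i, j)\<in>C_tilde n. s (i, j) * (\<Sum>j'=1..j. x i j')) =
    (\<Sum>(i, j)\<in>C_set n. x i j * ((\<Sum>j'=j..row_len n i. s (i, j')) + (\<Sum>i'=n + 1 - i..n. s (j, i'))))"
proof -
  define T where "T i j = (\<Sum>j'=j..row_len n i. s (i, j'))" for i j
  define R where "R = {(i, j). 1 \<le> i \<and> i \<le> n div 2 \<and> n div 2 < j \<and> j \<le> n}"
  have finR: "finite R" by (rule finite_subset[of _ "{1..n} \<times> {1..n}"]) (auto simp: R_def)
  have CR: "C_tilde n = C_set n \<union> R"
    by (cases "even n") (auto simp: C_tilde_iff C_set_def R_def elim!: evenE oddE)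
  have row: "(\<Sum>j=1..m. s (i, j) * (\<Sum>j'=1..j. x i j')) = (\<Sum>j=1..m. x i j * (\<Sum>j'=j..m. s (i, j')))" for i m
  proof -
    have "(\<Sum>j=1..m. s (i, j) * (\<Sum>j'=1..j. x i j')) = (\<Sum>j=1..m. \<Sum>j'=1..j. x i j' * s (i, j))"
      by (simp add: sum_distrib_left mult.commute)
    also have "\<dots> = (\<Sum>j'=1..m. \<Sum>j=j'..m. x i j' * s (i, j))"
      unfolding sum.Sigma[OF finite_atLeastAtMost ballI[OF finite_atLeastAtMost]]
      by (rule sum.reindex_bij_witness[of _ "\<lambda>(a, b). (b, a)" "\<lambda>(a, b). (b, a)"]) auto
    finally show ?thesis by (simp add: sum_distrib_left)
  qed
  have "(\<Sum>(i, j)\<in>C_tilde n. s (i, j) * (\<Sum>j'=1..j. x i j')) =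
      (\<Sum>i=1..(n + 1) div 2. \<Sum>j=1..row_len n i. s (i, j) * (\<Sum>j'=1..j. x i j'))"
    unfolding C_tilde_Sigma by (rule sum.Sigma[symmetric]) auto
  also have "\<dots> = (\<Sum>i=1..(n + 1) div 2. \<Sum>j=1..row_len n i. x i j * T i j)"
    by (simp only: row T_def)
  also have "\<dots> = (\<Sum>(i, j)\<in>C_tilde n. x i j * T i j)"
    unfolding C_tilde_Sigma by (rule sum.Sigma) auto
  also have "\<dots> =
      (\<Sum>(i, j)\<in>C_set n. x i j * T i j) + (\<Sum>(i, j)\<in>R. x i j * T i j)"
    unfolding CR using finR finite_C_set by (intro sum.union_disjoint) (auto simp: R_def C_set_def)
  also have "(\<Sum>(i, j)\<in>R. x i j * T i j) = (\<Sum>(i, j)\<in>C_set n. x i j * (\<Sum>i'=n + 1 - i..n. s (j, i')))"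
  proof (rule sum.reindex_bij_witness[of _ "\<lambda>(i, j). (j, n + 1 - i)" "\<lambda>(i, j). (n + 1 - j, i)"])
    fix c assume c: "c \<in> R"
    obtain i j where ij: "c = (i, j)" by (cases c)
    then have b: "1 \<le> i" "i \<le> n div 2" "n div 2 < j" "j \<le> n" using c by (auto simp: R_def)
    then show "(case case c of (i, j) \<Rightarrow> (n + 1 - j, i) of (i, j) \<Rightarrow> (j, n + 1 - i)) = c"
      using ij by auto
    show "(case c of (i, j) \<Rightarrow> (n + 1 - j, i)) \<in> C_set n"
      using ij b by (auto simp: C_set_iff)
    have "n + 1 - j \<in> {1..n}" "i \<in> {1..n}" "n + 1 - (n + 1 - j) = j" using b by auto
    then have "x (n + 1 - j) i = x i j" using sym[of "n + 1 - j" i] by metis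
    moreover have "row_len n i = n" using b by (simp add: row_len_def)
    ultimately show "(case case c of (i, j) \<Rightarrow> (n + 1 - j, i) of (i, j) \<Rightarrow> x i j * (\<Sum>i'=n + 1 - i..n. s (j, i'))) =
      (case c of (i, j) \<Rightarrow> x i j * T i j)"
      using ij b by (simp add: T_def)
  next
    fix c assume "c \<in> C_set n"
    then obtain i j where ij: "c = (i, j)" "1 \<le> i" "i \<le> (n + 1) div 2" "1 \<le> j" "j \<le> n div 2"
      by (cases c) (auto simp: C_set_iff)
    then have "i \<le> n" by linarith
    then show "(case case c of (i, j) \<Rightarrow> (j, n + 1 - i) of (i, j) \<Rightarrow> (n + 1 - j, i)) = c"
      using ij by auto
    show "(case c of (i, j) \<Rightarrow> (j, n + 1 - i)) \<in> R"
      using ij \<open>i \<le> n\<close> by (auto simp: R_def)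
  qed
  finally show ?thesis by (simp add: T_def distrib_left sum.distrib case_prod_unfold)
qed

text \<open>By \<open>weighted_prefix_sums\<close> the sum on the left is even, so its half is an
  integer and can be compared with the rounded bound. A prefix sum is 0 or 1, so a term is at most
  1, and at most 0 unless \<open>s\<close> is 1; in the last column the prefix sum is exactly 1, and
  an entry -1 contributes -1.\<close>

lemma QTS_integral_inequality:
  fixes x :: "nat \<Rightarrow> nat \<Rightarrow> int"
  assumes sym: "\<And>i j. i \<in> {1..n} \<Longrightarrow> j \<in> {1..n} \<Longrightarrow> x i j = x j (n + 1 - i)"
    and pre: "\<And>i j. i \<in> {1..n} \<Longrightarrow> j \<le> n \<Longrightarrow> (\<Sum>j'=1..j. x i j') \<in> {0, 1}"
    and tot: "\<And>i. i \<in> {1..n} \<Longrightarrow> (\<Sum>j'=1..n. x i j') = 1"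
    and s: "s \<in> S_set n"
  shows "real_of_int (\<Sum>(i, j)\<in>C_tilde n. s (i, j) * (\<Sum>j'=1..j. x i j')) / 2 \<le>
    real_of_int \<lfloor>(real (card {(i, j) \<in> C_tilde n. s (i, j) = 1}) - real (card {i \<in> {1..n div 2}. s (i, n) = -1})) / 2\<rfloor>"
proof -
  let ?L = "\<Sum>(i, j)\<in>C_tilde n. s (i, j) * (\<Sum>j'=1..j. x i j')"
  have L: "?L = (\<Sum>(i, j)\<in>C_set n. x i j * ((\<Sum>j'=j..row_len n i. s (i, j')) + (\<Sum>i'=n + 1 - i..n. s (j, i'))))"
    by (rule weighted_prefix_sums) (rule sym)
  have "even ?L"
    unfolding L using s by (intro dvd_sum) (auto simp: S_set_def)
  then obtain q where q: "?L = 2 * q" by (auto elim: evenE)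
  have inj: "inj_on (\<lambda>i. (i, n)) A" for A :: "nat set" by (auto simp: inj_on_def)
  have "?L \<le> (\<Sum>(i, j)\<in>C_tilde n. of_bool (s (i, j) = 1) - of_bool (i \<in> {1..n div 2} \<and> j = n \<and> s (i, j) = -1))"
  proof (rule sum_mono)
    fix c assume c: "c \<in> C_tilde n"
    obtain i j where ij: "c = (i, j)" by (cases c)
    have b: "i \<in> {1..n}" "j \<le> n" using c ij by (auto simp: C_tilde_iff elim!: oddE)
    have sc: "s (i, j) \<in> {0, 1, -1}" using s c ij by (auto simp: S_set_def PiE_def Pi_def)
    show "(case c of (i, j) \<Rightarrow> s (i, j) * (\<Sum>j'=1..j. x i j')) \<le>
      (case c of (i, j) \<Rightarrow> of_bool (s (i, j) = 1) - of_bool (i \<in> {1..n div 2} \<and> j = n \<and> s (i, j) = -1))"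
    proof (cases "i \<in> {1..n div 2} \<and> j = n")
      case True
      then show ?thesis using sc tot[OF b(1)] ij by auto
    next
      case False
      then show ?thesis using sc pre[OF b] ij by auto
    qed
  qed
  also have "\<dots> = int (card {(i, j) \<in> C_tilde n. s (i, j) = 1}) - int (card {i \<in> {1..n div 2}. s (i, n) = -1})"
  proof -
    have "(\<Sum>c\<in>C_tilde n. of_bool (case c of (i, j) \<Rightarrow> s (i, j) = 1) :: int) = int (card {(i, j) \<in> C_tilde n. s (i, j) = 1})"
      using finite_C_tilde[of n] by (simp add: of_bool_def sum.If_cases Int_def case_prod_unfold)
    moreover have "(\<Sum>c\<in>C_tilde n. of_bool (case c of (i, j) \<Rightarrow> i \<in> {1..n div 2} \<and> j = n \<and> s (i, j) = -1) :: int) =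
      int (card ((\<lambda>i. (i, n)) ` {i \<in> {1..n div 2}. s (i, n) = -1}))"
    proof -
      have "{c \<in> C_tilde n. case c of (i, j) \<Rightarrow> i \<in> {1..n div 2} \<and> j = n \<and> s (i, j) = -1} =
        (\<lambda>i. (i, n)) ` {i \<in> {1..n div 2}. s (i, n) = -1}"
        by (auto simp: C_tilde_iff)
      then show ?thesis using finite_C_tilde[of n] by (simp add: of_bool_def sum.If_cases Int_def)
    qed
    ultimately show ?thesis
      by (simp add: sum_subtractf case_prod_unfold card_image[OF inj])
  qed
  finally have "2 * real_of_int q \<le> real (card {(i, j) \<in> C_tilde n. s (i, j) = 1}) - real (card {i \<in> {1..n div 2}. s (i, n) = -1})"
    unfolding q by linarith
  then have "q \<le> \<lfloor>(real (card {(i, j) \<in> C_tilde n. s (i, j) = 1}) - real (card {i \<in> {1..n div 2}. s (i, n) = -1})) / 2\<rfloor>"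
    by (simp add: le_floor_iff)
  then show ?thesis unfolding q by simp
qed

text \<open>The equation \<open>x i j = x j (n + 1 - i)\<close> in terms of prefix sums, with all
  terms on one side. Indicators let coinciding variables add up: at the central cell of an even
  \<open>n\<close> the variable \<open>(k, k)\<close> receives coefficient 2.\<close>

definition cell_row :: "nat \<Rightarrow> nat \<times> nat \<Rightarrow> nat \<times> nat \<Rightarrow> int" where
  "cell_row n v e = (case v of (i, j) \<Rightarrow>
     of_bool (e = (i, j)) - of_bool (e = (i, j - 1)) - of_bool (e = (j, n + 1 - i)) + of_bool (e = (j, n - i)))"

lemma sum_cell_row:
  fixes g :: "nat \<times> nat \<Rightarrow> 'a::comm_ring_1"
  assumes ij: "(i, j) \<in> C_set n" and g: "\<And>i. g (i, 0) = 0"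
  shows "(\<Sum>e\<in>C_tilde n. of_int (cell_row n (i, j) e) * g e) =
    g (i, j) - g (i, j - 1) - g (j, n + 1 - i) + g (j, n - i)"
proof -
  \<comment> \<open>A variable in column 0 is an empty prefix sum: it is no edge, and
    \<open>g\<close> vanishes there.\<close>
  have pick: "(\<Sum>e\<in>C_tilde n. of_bool (e = c) * g e) = g c" if "c \<in> C_tilde n \<or> snd c = 0" for c
  proof (cases "c \<in> C_tilde n")
    case True
    then show ?thesis using finite_C_tilde[of n] by (simp add: of_bool_def if_distrib[of "\<lambda>x. x * _"] sum.delta cong: if_cong)
  next
    case False
    then have "g c = 0" using that g[of "fst c"] by (metis prod.collapse)
    then show ?thesis using False by (intro sum.neutral[THEN trans]) auto
  qed
  have b: "1 \<le> i" "i \<le> (n + 1) div 2" "1 \<le> j" "j \<le> n div 2" using ij by (auto simp: C_set_iff)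
  have "(i, j) \<in> C_tilde n" using ij C_set_subset by blast
  moreover have "(i, j - 1) \<in> C_tilde n \<or> j - 1 = 0"
  proof (cases "j = 1")
    case False
    then have "(i, j - 1) \<in> C_set n" using b by (auto simp: C_set_iff)
    then show ?thesis using C_set_subset by blast
  qed auto
  moreover have "(j, n + 1 - i) \<in> C_tilde n" using b by (auto simp: C_tilde_iff)
  moreover have "(j, n - i) \<in> C_tilde n" using b by (auto simp: C_tilde_iff)
  ultimately show ?thesis
    by (simp add: cell_row_def left_diff_distrib distrib_right sum.distrib sum_subtractf pick)
qed

text \<open>The prefix sums of the elementary rotation-invariant matrix supported on the orbit of the
  cell \<open>(i, j)\<close> satisfy all cell equations; this makes every set of cells yield an element of \<open>S_set\<close>.\<close>

lemma cell_row_orthogonal: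
  assumes ij: "(i, j) \<in> C_set n" and v: "v \<in> C_set n"
  shows "(\<Sum>j'=j..row_len n i. cell_row n v (i, j')) + (\<Sum>i'=n + 1 - i..n. cell_row n v (j, i')) = 0"
proof -
  \<comment> \<open>Of the orbit of \<open>(i, j)\<close> only \<open>(i, j)\<close> and
    \<open>(j, n + 1 - i)\<close> influence prefix sums on \<open>C_tilde n\<close>; each raises its
    row by 1 from its column on.\<close>
  define h :: "nat \<times> nat \<Rightarrow> int" where
    "h = (\<lambda>(p, q). of_bool (p = i \<and> j \<le> q) + of_bool (p = j \<and> n + 1 - i \<le> q))"
  have b: "1 \<le> i" "i \<le> (n + 1) div 2" "1 \<le> j" "j \<le> n div 2" using ij by (auto simp: C_set_iff)
  obtain p q where pq: "v = (p, q)" by (cases v)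
  have bv: "1 \<le> p" "p \<le> (n + 1) div 2" "1 \<le> q" "q \<le> n div 2" using v pq by (auto simp: C_set_iff)
  have "(\<Sum>j'=j..row_len n i. cell_row n v (i, j')) = (\<Sum>e\<in>C_tilde n. cell_row n v e * of_bool (fst e = i \<and> j \<le> snd e))"
  proof -
    have "(\<Sum>e\<in>C_tilde n. cell_row n v e * of_bool (fst e = i \<and> j \<le> snd e)) =
        (\<Sum>e\<in>Pair i ` {j..row_len n i}. cell_row n v e)"
      using finite_C_tilde b
      by (intro sum.mono_neutral_cong_right) (auto simp: C_tilde_Sigma)
    then show ?thesis by (simp add: sum.reindex inj_on_def)
  qed
  moreover have "(\<Sum>i'=n + 1 - i..n. cell_row n v (j, i')) = (\<Sum>e\<in>C_tilde n. cell_row n v e * of_bool (fst e = j \<and> n + 1 - i \<le> snd e))"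
  proof -
    have "(\<Sum>e\<in>C_tilde n. cell_row n v e * of_bool (fst e = j \<and> n + 1 - i \<le> snd e)) =
        (\<Sum>e\<in>Pair j ` {n + 1 - i..n}. cell_row n v e)"
      using finite_C_tilde b
      by (intro sum.mono_neutral_cong_right) (auto simp: C_tilde_iff)
    then show ?thesis by (simp add: sum.reindex inj_on_def)
  qed
  ultimately have "(\<Sum>j'=j..row_len n i. cell_row n v (i, j')) + (\<Sum>i'=n + 1 - i..n. cell_row n v (j, i')) =
      (\<Sum>e\<in>C_tilde n. of_int (cell_row n v e) * h e)"
    by (simp add: h_def case_prod_unfold distrib_left sum.distrib)
  also have "\<dots> = h (p, q) - h (p, q - 1) - h (q, n + 1 - p) + h (q, n - p)"
    unfolding pq using v pq b by (intro sum_cell_row) (auto simp: h_def)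
  also have "\<dots> = 0"
  proof -
    have "\<not> n + 1 - i \<le> q" "\<not> n + 1 - i \<le> q - 1" "j \<le> n + 1 - p" "j \<le> n - p" using b bv by linarith+
    moreover have "j \<le> q - 1 \<longleftrightarrow> j < q" "n + 1 - i \<le> n + 1 - p \<longleftrightarrow> p \<le> i" "n + 1 - i \<le> n - p \<longleftrightarrow> p < i"
      using b bv by linarith+
    ultimately have "h (p, q) = of_bool (p = i \<and> j \<le> q)" "h (p, q - 1) = of_bool (p = i \<and> j < q)"
      "h (q, n + 1 - p) = of_bool (q = i) + of_bool (q = j \<and> p \<le> i)"
      "h (q, n - p) = of_bool (q = i) + of_bool (q = j \<and> p < i)"
      unfolding h_def by simp_all
    then show ?thesis by (cases "p = i"; cases "q = j"; simp; linarith?)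
  qed
  finally show ?thesis .
qed

text \<open>The cut is the inequality of the element of \<open>S_set n\<close> that is 1 on
  \<open>F\<close>, -1 on the rest of the boundary and 0 on the other cells: for odd
  \<open>card F\<close> and no -1 in the last column the bound rounds to
  \<open>(card F - 1) / 2\<close>.\<close>

lemma parity_cut_inequality:
  fixes y :: "nat \<times> nat \<Rightarrow> real"
  assumes y01: "\<And>e. e \<in> C_tilde n \<Longrightarrow> 0 \<le> y e \<and> y e \<le> 1" and yn: "\<And>i. i \<in> {1..n div 2} \<Longrightarrow> y (i, n) = 1"
    and ineq: "\<And>s. s \<in> S_set n \<Longrightarrow> (\<Sum>e\<in>C_tilde n. real_of_int (s e) * y e) / 2 \<le>
      real_of_int \<lfloor>(real (card {e \<in> C_tilde n. s e = 1}) - real (card {i \<in> {1..n div 2}. s (i, n) = -1})) / 2\<rfloor>"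
    and U: "U \<subseteq> C_set n" and F: "F \<subseteq> bd (C_tilde n) (cell_row n) U" "odd (card F)"
  shows "1 \<le> gap (bd (C_tilde n) (cell_row n) U) F y"
proof -
  define D where "D = bd (C_tilde n) (cell_row n) U"
  have D: "D \<subseteq> C_tilde n" "finite D" "F \<subseteq> D" "finite F"
    using finite_C_tilde[of n] F by (auto simp: D_def bd_def intro: finite_subset)
  have nn: "0 \<le> (\<Sum>e\<in>F. 1 - y e)" using D y01 by (intro sum_nonneg) auto
  show ?thesis
  \<comment> \<open>A last-column edge in \<open>D - F\<close> has value 1 and settles the cut at
    once. Otherwise \<open>s\<close> has no -1 in the last column and the correction term of the
    bound vanishes.\<close>
  proof (cases "\<exists>i\<in>{1..n div 2}. (i, n) \<in> D - F")
    case True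
    then obtain i where i: "i \<in> {1..n div 2}" "(i, n) \<in> D - F" by blast
    then have "1 \<le> (\<Sum>e\<in>D - F. y e)"
      using member_le_sum[of "(i, n)" "D - F" y] yn[OF i(1)] D y01 by auto
    then show ?thesis using nn by (simp add: gap_def D_def)
  next
    case False
    define s :: "nat \<times> nat \<Rightarrow> int" where
      "s = (\<lambda>e. if e \<in> C_tilde n then if e \<in> F then 1 else if e \<in> D then -1 else 0 else undefined)"
    \<comment> \<open>Modulo 2, \<open>s\<close> is the sum of the rows of \<open>U\<close>, each of
      which satisfies the condition of \<open>S_set\<close> by
      \<open>cell_row_orthogonal\<close>.\<close>
    have par: "even (s e) \<longleftrightarrow> even (\<Sum>v\<in>U. cell_row n v e)" if "e \<in> C_tilde n" for e
      using that D by (auto simp: s_def D_def bd_def)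
    have "s \<in> S_set n"
    proof -
      have "even ((\<Sum>j'=j..row_len n i. s (i, j')) + (\<Sum>i'=n + 1 - i..n. s (j, i')))" if ij: "(i, j) \<in> C_set n" for i j
      proof -
        have b: "1 \<le> i" "i \<le> (n + 1) div 2" "1 \<le> j" "j \<le> n div 2" using ij by (auto simp: C_set_iff)
        let ?c = "\<lambda>e. \<Sum>v\<in>U. cell_row n v e"
        have "(\<Sum>j'=j..row_len n i. ?c (i, j')) + (\<Sum>i'=n + 1 - i..n. ?c (j, i')) =
          (\<Sum>v\<in>U. (\<Sum>j'=j..row_len n i. cell_row n v (i, j')) + (\<Sum>i'=n + 1 - i..n. cell_row n v (j, i')))"
          by (simp add: sum.distrib sum.swap[of _ U])
        also have "\<dots> = 0" using cell_row_orthogonal[OF ij] U by (intro sum.neutral) auto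
        finally have z: "(\<Sum>j'=j..row_len n i. ?c (i, j')) + (\<Sum>i'=n + 1 - i..n. ?c (j, i')) = 0" .
        have "(i, j') \<in> C_tilde n" if "j' \<in> {j..row_len n i}" for j'
          using that b by (auto simp: C_tilde_Sigma)
        then have "even (\<Sum>j'=j..row_len n i. s (i, j') - ?c (i, j'))"
          using par by (intro dvd_sum) auto
        moreover have "(j, i') \<in> C_tilde n" if "i' \<in> {n + 1 - i..n}" for i'
          using that b by (auto simp: C_tilde_iff)
        then have "even (\<Sum>i'=n + 1 - i..n. s (j, i') - ?c (j, i'))"
          using par by (intro dvd_sum) auto
        ultimately show ?thesis using z unfolding sum_subtractf by presburger
      qed
      moreover have "s \<in> C_tilde n \<rightarrow>\<^sub>E {0, 1, -1}" by (rule PiE_I) (auto simp: s_def)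
      ultimately show ?thesis by (auto simp: S_set_def)
    qed
    from ineq[OF this] have main: "(\<Sum>e\<in>C_tilde n. real_of_int (s e) * y e) / 2 \<le>
      real_of_int \<lfloor>(real (card {e \<in> C_tilde n. s e = 1}) - real (card {i \<in> {1..n div 2}. s (i, n) = -1})) / 2\<rfloor>" .
    have cF: "{e \<in> C_tilde n. s e = 1} = F" using D by (auto simp: s_def)
    have c0: "{i \<in> {1..n div 2}. s (i, n) = -1} = {}"
      using False by (auto simp: s_def C_tilde_iff)
    have "real_of_int \<lfloor>(real (card {e \<in> C_tilde n. s e = 1}) - real (card {i \<in> {1..n div 2}. s (i, n) = -1})) / 2\<rfloor>
      = (real (card F) - 1) / 2"
    proof -
      obtain q where q: "card F = 2 * q + 1" using F(2) by (elim oddE)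
      have "\<lfloor>real (card F) / 2\<rfloor> = int q" unfolding q by (simp add: floor_eq_iff)
      then show ?thesis unfolding cF c0 by (simp add: q)
    qed
    moreover have "(\<Sum>e\<in>C_tilde n. real_of_int (s e) * y e) = (\<Sum>e\<in>F. y e) - (\<Sum>e\<in>D - F. y e)"
    proof -
      have "(\<Sum>e\<in>C_tilde n. real_of_int (s e) * y e) = (\<Sum>e\<in>D. real_of_int (s e) * y e)"
        using D finite_C_tilde by (intro sum.mono_neutral_right) (auto simp: s_def)
      also have "\<dots> = (\<Sum>e\<in>D - F. real_of_int (s e) * y e) + (\<Sum>e\<in>F. real_of_int (s e) * y e)"
        using D by (intro sum.subset_diff)
      also have "(\<Sum>e\<in>D - F. real_of_int (s e) * y e) = (\<Sum>e\<in>D - F. - y e)"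
        using D by (intro sum.cong) (auto simp: s_def)
      also have "(\<Sum>e\<in>F. real_of_int (s e) * y e) = (\<Sum>e\<in>F. y e)"
        using D by (intro sum.cong) (auto simp: s_def)
      finally show ?thesis by (simp add: sum_negf)
    qed
    ultimately show ?thesis using main by (simp add: gap_def D_def sum_subtractf)
  qed
qed

section \<open>Ends of the edges and the exceptional boundaries\<close>

lemma halves:
  obtains k r :: nat where "n = 2 * k + r" "r \<le> 1" "n div 2 = k" "(n + 1) div 2 = k + r"
proof (cases "even n")
  case True
  then show ?thesis by (intro that[of "n div 2" 0]) auto
next
  case False
  then show ?thesis by (intro that[of "n div 2" 1]) (auto elim!: oddE)
qed

text \<open>A prefix sum left of column \<open>n div 2\<close> is shared by two neighbouring cells
  of its row; one beyond that column is shared by two cells that rotate into its row. At the seam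
  \<open>q = n div 2\<close> one end is direct and one rotated, and both coefficients are 1.\<close>

lemma cell_row_cases:
  assumes v: "v \<in> C_set n" and e: "(p, q) \<in> C_tilde n"
  shows "q < n div 2 \<Longrightarrow> cell_row n v (p, q) = of_bool (v = (p, q)) - of_bool (v = (p, q + 1))"
    and "q = n div 2 \<Longrightarrow> cell_row n v (p, q) = of_bool (v = (p, q)) + of_bool (v = (n - q, p))"
    and "n div 2 < q \<Longrightarrow> cell_row n v (p, q) = of_bool (v = (n - q, p)) - of_bool (v = (n + 1 - q, p))"
proof -
  obtain i j where ij: "v = (i, j)" by (cases v)
  obtain k r where k: "n = 2 * k + r" "r \<le> 1" "n div 2 = k" "(n + 1) div 2 = k + r" by (rule halves)
  have b: "1 \<le> i" "i \<le> k + r" "1 \<le> j" "j \<le> k" using v ij k by (auto simp: C_set_iff)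
  have pq: "1 \<le> p" "1 \<le> q" "q \<le> n" using e by (auto simp: C_tilde_iff)
  have "i \<le> n" using b k(1) by linarith
  have row: "cell_row n v (p, q) = of_bool (v = (p, q)) - of_bool (v = (p, q + 1))
      - of_bool (v = (n + 1 - q, p)) + of_bool (v = (n - q, p))"
  proof -
    have "(p, q) = (i, j) \<longleftrightarrow> v = (p, q)" "(p, q) = (i, j - 1) \<longleftrightarrow> v = (p, q + 1)"
      "(p, q) = (j, n + 1 - i) \<longleftrightarrow> v = (n + 1 - q, p)" "(p, q) = (j, n - i) \<longleftrightarrow> v = (n - q, p)"
      unfolding ij prod.inject using \<open>i \<le> n\<close> pq(2,3) b(1,3) by presburger+
    then show ?thesis by (simp only: cell_row_def ij prod.case)
  qed
  show "cell_row n v (p, q) = of_bool (v = (p, q)) - of_bool (v = (p, q + 1))" if "q < n div 2"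
  proof -
    have "i \<noteq> n + 1 - q" "i \<noteq> n - q" using b that k(1,2) unfolding k(3) by linarith+
    then show ?thesis unfolding row by (simp add: ij)
  qed
  show "cell_row n v (p, q) = of_bool (v = (p, q)) + of_bool (v = (n - q, p))" if "q = n div 2"
  proof -
    have "j \<noteq> q + 1" "i \<noteq> n + 1 - q" using b that k(1,2) unfolding k(3) by linarith+
    then show ?thesis unfolding row by (simp add: ij)
  qed
  show "cell_row n v (p, q) = of_bool (v = (n - q, p)) - of_bool (v = (n + 1 - q, p))" if "n div 2 < q"
  proof -
    have "j \<noteq> q" "j \<noteq> q + 1" using b that unfolding k(3) by linarith+
    then show ?thesis unfolding row by (simp add: ij)
  qed
qed

lemma two_endedI:
  assumes "finite V" "u1 \<in> V" "u2 \<in> V" "u1 \<noteq> u2" "\<bar>a u1 e\<bar> = 1" "\<bar>a u2 e\<bar> = 1"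
    and "\<And>v. v \<in> V \<Longrightarrow> v \<noteq> u1 \<Longrightarrow> v \<noteq> u2 \<Longrightarrow> a v e = 0"
  shows "two_ended V a e"
proof -
  have "(\<Sum>v\<in>V. \<bar>a v e\<bar>) = (\<Sum>v\<in>{u1, u2}. \<bar>a v e\<bar>)"
    using assms by (intro sum.mono_neutral_right) auto
  then show ?thesis using assms by (auto simp: two_ended_def) (metis abs_0 order_refl zero_le_one)
qed

text \<open>The exceptions are \<open>(p, n)\<close>, whose end \<open>(0, p)\<close> does not
  exist, and the variable in row \<open>(n + 1) div 2\<close> and column \<open>k = n div 2\<close>:
  for even \<open>n\<close> both its ends are the same cell, for odd \<open>n\<close> the end
  \<open>(k + 1, k + 1)\<close> is missing.\<close>

lemma two_ended_cell_row:
  assumes e: "(p, q) \<in> C_tilde n"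
    and "p \<le> n div 2 \<Longrightarrow> q \<noteq> n" "q = n div 2 \<Longrightarrow> p \<noteq> (n + 1) div 2"
  shows "two_ended (C_set n) (cell_row n) (p, q)"
proof -
  obtain k r where k: "n = 2 * k + r" "r \<le> 1" "n div 2 = k" "(n + 1) div 2 = k + r" by (rule halves)
  have pq: "1 \<le> p" "1 \<le> q" "q \<le> n" "p \<le> k + r" "k < q \<Longrightarrow> p \<le> k"
    using e k by (auto simp: C_tilde_iff elim!: oddE)
  have C: "(i, j) \<in> C_set n \<longleftrightarrow> 1 \<le> i \<and> i \<le> k + r \<and> 1 \<le> j \<and> j \<le> k" for i j
    unfolding C_set_iff k(3,4) ..
  note asm = assms(2,3)[unfolded k(3,4)]
  note c = cell_row_cases[OF _ e]
  consider "q < k" | "q = k" | "k < q" by linarith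
  then show ?thesis
  proof cases
    case 1
    then have "(p, q) \<in> C_set n" "(p, q + 1) \<in> C_set n" unfolding C using pq(1-4) by linarith+
    then show ?thesis
      using 1 c(1) finite_C_set by (intro two_endedI[of _ "(p, q)" "(p, q + 1)"]) (auto simp: k(3))
  next
    case 2
    then have "p \<noteq> k + r" using asm(2) by blast
    then have "(p, q) \<in> C_set n" "(n - q, p) \<in> C_set n" "p \<noteq> n - q"
      unfolding C using 2 pq(1-4) k(1,2) by linarith+
    then show ?thesis
      using 2 c(2) finite_C_set by (intro two_endedI[of _ "(p, q)" "(n - q, p)"]) (auto simp: k(3))
  next
    case 3
    then have "p \<le> k" using pq(5) by blast
    then have "q < n" using asm(1) pq(3) by (simp add: le_neq_implies_less)
    have "(n + 1 - q, p) \<in> C_set n" "(n - q, p) \<in> C_set n" "n + 1 - q \<noteq> n - q"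
      unfolding C using 3 \<open>p \<le> k\<close> \<open>q < n\<close> pq(1) k(1) by linarith+
    then show ?thesis
      using 3 c(3) finite_C_set by (intro two_endedI[of _ "(n + 1 - q, p)" "(n - q, p)"]) (auto simp: k(3))
  qed
qed

text \<open>Summed over all cells, edges with two ends cancel modulo 2 and the one-ended ones
  survive. As the last column has value 1, this cut isolates the value at
  \<open>(n div 2 + 1, n div 2)\<close>.\<close>

lemma boundary_all_cells:
  assumes "odd n" "0 < n div 2"
  shows "bd (C_tilde n) (cell_row n) (C_set n) = insert (n div 2 + 1, n div 2) ((\<lambda>i. (i, n)) ` {1..n div 2})"
proof (intro set_eqI iffI)
  fix e assume "e \<in> bd (C_tilde n) (cell_row n) (C_set n)"
  then have e: "e \<in> C_tilde n" "odd (\<Sum>v\<in>C_set n. cell_row n v e)" by (auto simp: bd_def)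
  obtain p q where pq: "e = (p, q)" by (cases e)
  have l: "(n + 1) div 2 = n div 2 + 1" using assms by presburger
  have "\<not> two_ended (C_set n) (cell_row n) e" using e two_ended_even[of "C_set n" "cell_row n" e] by blast
  then have "p \<le> n div 2 \<and> q = n \<or> q = n div 2 \<and> p = n div 2 + 1"
    using two_ended_cell_row[of p q n] e(1) l unfolding pq by blast
  then show "e \<in> insert (n div 2 + 1, n div 2) ((\<lambda>i. (i, n)) ` {1..n div 2})"
    using e(1) unfolding pq by (auto simp: C_tilde_iff)
next
  fix e assume "e \<in> insert (n div 2 + 1, n div 2) ((\<lambda>i. (i, n)) ` {1..n div 2})"
  then consider "e = (n div 2 + 1, n div 2)" | i where "e = (i, n)" "1 \<le> i" "i \<le> n div 2" by auto
  then show "e \<in> bd (C_tilde n) (cell_row n) (C_set n)"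
  proof cases
    case 1
    have e: "(n div 2 + 1, n div 2) \<in> C_tilde n" using assms by (auto simp: C_tilde_iff)
    have u: "(n div 2 + 1, n div 2) \<in> C_set n" using assms by (auto simp: C_set_iff elim!: oddE)
    have "(\<Sum>v\<in>C_set n. cell_row n v e) = (\<Sum>v\<in>C_set n. of_bool (v = (n div 2 + 1, n div 2)))"
      unfolding 1 using cell_row_cases(2)[OF _ e] by (intro sum.cong) (auto simp: C_set_iff)
    also have "\<dots> = 1" using u finite_C_set[of n] by (simp add: of_bool_def)
    finally show ?thesis using e 1 by (simp add: bd_def)
  next
    case 2
    have e: "(i, n) \<in> C_tilde n" using 2 by (auto simp: C_tilde_iff)
    have u: "(1, i) \<in> C_set n" using 2 assms by (auto simp: C_set_iff)
    have "n div 2 < n" using assms by linarith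
    then have "(\<Sum>v\<in>C_set n. cell_row n v e) = (\<Sum>v\<in>C_set n. - of_bool (v = (1, i)))"
      unfolding 2 using cell_row_cases(3)[OF _ e] by (intro sum.cong) (auto simp: C_set_iff)
    also have "\<dots> = -1" using u finite_C_set[of n] by (simp add: of_bool_def sum_negf)
    finally show ?thesis using e 2 by (simp add: bd_def)
  qed
qed

text \<open>The loop \<open>(k, k)\<close> has coefficient 2 and is absent. For \<open>k = 1\<close>
  the variable \<open>(k, k - 1)\<close> lies in column 0 and is no edge.\<close>

lemma boundary_central_cell:
  assumes "n = 2 * k" "0 < k"
  shows "bd (C_tilde n) (cell_row n) {(k, k)} = {e. e = (k, k + 1) \<or> e = (k, k - 1) \<and> 2 \<le> k}"
proof -
  have "n + 1 - k = k + 1" "n - k = k" using assms by auto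
  then have "odd (cell_row n (k, k) e) \<longleftrightarrow> e = (k, k + 1) \<or> e = (k, k - 1)" for e
    using assms(2) by (auto simp: cell_row_def)
  moreover have "(k, k + 1) \<in> C_tilde n" "(k, k - 1) \<in> C_tilde n \<longleftrightarrow> 2 \<le> k"
    using assms by (auto simp: C_tilde_iff)
  ultimately show ?thesis by (auto simp: bd_def)
qed

definition cell_equations :: "nat \<Rightarrow> (nat \<times> nat \<Rightarrow> 'a::ab_group_add) \<Rightarrow> bool" where
  "cell_equations n g \<longleftrightarrow> (\<forall>(i, j)\<in>C_set n. g (i, j) - g (i, j - 1) = g (j, n + 1 - i) - g (j, n - i))"

lemma mixture_certain:
  assumes "mixture E P y w" "finite E" "e \<in> E" "y e = 1" "w p \<noteq> 0"
  shows "e \<in> p"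
proof (rule ccontr)
  assume e: "e \<notin> p"
  have p: "p \<in> Pow E" using assms(1,5) unfolding mixture_def by blast
  have "sum w (Pow E) = sum w {p \<in> Pow E. e \<in> p} + sum w {p \<in> Pow E. e \<notin> p}"
    using assms(2) by (subst sum.union_disjoint[symmetric]) (auto intro!: sum.cong)
  moreover have "sum w (Pow E) = 1" "sum w {p \<in> Pow E. e \<in> p} = 1"
    using assms(1,3,4) unfolding mixture_def by auto
  ultimately have "sum w {p \<in> Pow E. e \<notin> p} = 0" by linarith
  then have "\<forall>p\<in>{p \<in> Pow E. e \<notin> p}. w p = 0"
    using assms(1,2) by (subst (asm) sum_nonneg_eq_0_iff) (auto simp: mixture_def)
  then show False using e p assms(5) by blast
qed

text \<open>For even \<open>n = 2 * k\<close> the variable \<open>(k, k)\<close> is a loop at the central cell. The two parity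
  cuts at that cell force the values at \<open>(k, k - 1)\<close>, \<open>(k, k)\<close> and \<open>(k, k + 1)\<close> to agree,
  so the loop can be dropped and reinserted afterwards. For odd \<open>n\<close> the only variable with
  a single end, besides those fixed to \<open>1\<close>, is made integral by the parity cut of all cells.\<close>

lemma prefix_sums_decomposable:
  fixes y :: "nat \<times> nat \<Rightarrow> real"
  assumes n: "0 < n" and y0: "\<And>i. y (i, 0) = 0"
    and y01: "\<And>e. e \<in> C_tilde n \<Longrightarrow> 0 \<le> y e \<and> y e \<le> 1" and yn: "\<And>i. i \<in> {1..n div 2} \<Longrightarrow> y (i, n) = 1"
    and eq: "cell_equations n y"
    and cut: "\<And>U F. U \<subseteq> C_set n \<Longrightarrow> F \<subseteq> bd (C_tilde n) (cell_row n) U \<Longrightarrow> odd (card F) \<Longrightarrow>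
      1 \<le> gap (bd (C_tilde n) (cell_row n) U) F y"
  shows "\<exists>w. mixture (C_tilde n) (\<lambda>p. (\<forall>i\<in>{1..n div 2}. (i, n) \<in> p) \<and>
    cell_equations n (\<lambda>e. of_bool (e \<in> p) :: int)) y w"
proof -
  define k where "k = n div 2"
  define E where "E = (if even n then C_tilde n - {(k, k)} else C_tilde n)"
  \<comment> \<open>At the central cell of an even \<open>n\<close> the equation becomes
    \<open>y (k, k + 1) = y (k, k - 1)\<close>, without the loop. All other coefficients keep their
    absolute values, so the boundaries are those of \<open>cell_row\<close>.\<close>
  define A where "A v e = (if even n \<and> v = (k, k) then of_bool (e = (k, k + 1)) - of_bool (e = (k, k - 1))
    else cell_row n v e)" for v e
  define g where "g p = (if even n \<and> (k, k - 1) \<in> p then insert (k, k) p else p)" for p :: "(nat \<times> nat) set"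
  have center: "2 \<le> k" "y (k, k - 1) = y (k, k)" "y (k, k + 1) = y (k, k)" if ev: "even n"
  proof -
    have nk: "n = 2 * k" "0 < k" using ev n by (auto simp: k_def)
    note B = boundary_central_cell[OF nk]
    have c: "(k, k) \<in> C_set n" using nk by (auto simp: C_set_iff)
    then have two: "2 * y (k, k) = y (k, k - 1) + y (k, k + 1)"
      using eq nk by (auto simp: cell_equations_def)
    have 1: "1 \<le> gap (bd (C_tilde n) (cell_row n) {(k, k)}) {(k, k + 1)} y"
      using c by (intro cut) (auto simp: B)
    \<comment> \<open>For \<open>n = 2\<close> the boundary is just the last-column edge
      \<open>(1, 2)\<close> of value 1 and its cut fails: the hypotheses are contradictory, in line
      with the absence of quarter-turn symmetric matrices of size 2.\<close>
    have k2: "2 \<le> k"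
    proof (rule ccontr)
      assume "\<not> 2 \<le> k"
      then have "k = 1" using nk by simp
      then show False using 1 yn[of 1] nk unfolding B by (auto simp: gap_def numeral_2_eq_2)
    qed
    have B': "bd (C_tilde n) (cell_row n) {(k, k)} = {(k, k + 1), (k, k - 1)}" using B k2 by auto
    have 2: "1 \<le> gap (bd (C_tilde n) (cell_row n) {(k, k)}) {(k, k - 1)} y"
      using c by (intro cut) (auto simp: B')
    have "{(k, k + 1), (k, k - 1)} - {(k, k + 1)} = {(k, k - 1)}" "{(k, k + 1), (k, k - 1)} - {(k, k - 1)} = {(k, k + 1)}"
      by auto
    then have "y (k, k + 1) = y (k, k - 1)" using 1 2 unfolding B' by (simp add: gap_def)
    then show "2 \<le> k" "y (k, k - 1) = y (k, k)" "y (k, k + 1) = y (k, k)" using two k2 by auto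
  qed
  have half_edge: "y (k + 1, k) = 0 \<or> y (k + 1, k) = 1" if od: "odd n" "0 < k"
  proof -
    define R where "R = (\<lambda>i. (i, n)) ` {1..k}"
    have B: "bd (C_tilde n) (cell_row n) (C_set n) = insert (k + 1, k) R"
      using boundary_all_cells od unfolding R_def k_def by blast
    have cR: "card R = k" "finite R" unfolding R_def by (auto simp: card_image inj_on_def)
    have nR: "(k + 1, k) \<notin> R" by (auto simp: R_def)
    have yR: "y e = 1" if "e \<in> R" for e using that yn by (auto simp: R_def k_def)
    have f: "(k + 1, k) \<in> C_tilde n" using od by (auto simp: C_tilde_iff k_def)
    have 1: "1 \<le> gap (insert (k + 1, k) R) F y" if "F \<subseteq> insert (k + 1, k) R" "odd (card F)" for F
      using cut[of "C_set n" F] that unfolding B by simp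
    show ?thesis
    \<comment> \<open>The \<open>k\<close> edges of \<open>R\<close> have value 1, so an odd set
      \<open>F\<close> containing all of \<open>R\<close> forces the remaining edge to 1 for odd
      \<open>k\<close> and to 0 for even \<open>k\<close>.\<close>
    proof (cases "odd k")
      case True
      then have "1 \<le> gap (insert (k + 1, k) R) R y" using cR by (intro 1) auto
      also have "\<dots> = y (k + 1, k)" using nR cR yR by (simp add: gap_def insert_Diff_if)
      finally show ?thesis using y01[OF f] by simp
    next
      case False
      then have "1 \<le> gap (insert (k + 1, k) R) (insert (k + 1, k) R) y" using cR nR by (intro 1) auto
      also have "\<dots> = 1 - y (k + 1, k)" using nR cR yR by (simp add: gap_def)
      finally show ?thesis using y01[OF f] by simp
    qed
  qed
  have E: "E \<subseteq> C_tilde n" "finite E" using finite_C_tilde[of n] by (auto simp: E_def)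
  have loop: "cell_row n v (k, k) = 2 * of_bool (v = (k, k))" if "even n" "v \<in> C_set n" for v
  proof -
    have "(k, k) \<in> C_tilde n" "n - k = k" using that center by (auto simp: C_tilde_iff k_def)
    then show ?thesis using cell_row_cases(2)[OF that(2), of k k] by (simp add: k_def)
  qed
  have absA: "\<bar>A v e\<bar> = \<bar>cell_row n v e\<bar>" if "v \<in> C_set n" "e \<in> E" for v e
  proof (cases "even n \<and> v = (k, k)")
    case True
    then have "n - k = k" "n + 1 - k = k + 1" "e \<noteq> (k, k)" using that(2) by (auto simp: E_def k_def)
    then show ?thesis using True by (auto simp: A_def cell_row_def)
  next
    case False
    then have "A v e = cell_row n v e" unfolding A_def by (simp only: if_False)
    then show ?thesis by simp
  qed
  have sumA: "even (\<Sum>v\<in>U. A v e) \<longleftrightarrow> even (\<Sum>v\<in>U. cell_row n v e)" if "U \<subseteq> C_set n" "e \<in> E" for U e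
  proof -
    have "(\<Sum>v\<in>U. \<bar>A v e\<bar>) = (\<Sum>v\<in>U. \<bar>cell_row n v e\<bar>)"
      using that absA[OF subsetD[OF that(1)] that(2)] by (intro sum.cong) simp_all
    then show ?thesis using even_sum_abs[of "\<lambda>v. A v e" U] even_sum_abs[of "\<lambda>v. cell_row n v e" U] by simp
  qed
  have bdA: "bd E A U = bd (C_tilde n) (cell_row n) U" if U: "U \<subseteq> C_set n" for U
  proof -
    have "even (\<Sum>v\<in>U. cell_row n v (k, k))" if "even n"
      using loop[OF that] U by (intro dvd_sum) auto
    then show ?thesis using sumA[OF U] E(1) by (auto simp: bd_def E_def split: if_splits)
  qed
  have te: "two_ended (C_set n) A e" if e: "e \<in> E" "0 < y e" "y e < 1" for e
  proof -
    obtain p q where pq: "e = (p, q)" by (cases e)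
    have eC: "(p, q) \<in> C_tilde n" using e E pq by blast
    have "two_ended (C_set n) (cell_row n) (p, q)"
    proof (rule two_ended_cell_row[OF eC])
      show "q \<noteq> n" if "p \<le> n div 2" using that yn[of p] e(3) eC unfolding pq by (auto simp: C_tilde_iff)
      show "p \<noteq> (n + 1) div 2" if q: "q = n div 2"
      proof (cases "even n")
        case True
        then show ?thesis using e(1) q unfolding pq E_def k_def by auto
      next
        case False
        then have "(n + 1) div 2 = k + 1" by (auto simp: k_def elim!: oddE)
        moreover have "0 < k" using eC q by (auto simp: C_tilde_iff k_def)
        ultimately show ?thesis using half_edge[OF False] e(2,3) q unfolding pq k_def by auto
      qed
    qed
    then show ?thesis using absA[OF _ e(1)] unfolding pq two_ended_def by simp
  qed
  have noncentral: "(\<Sum>e\<in>E. of_int (A v e) * h e) = h (i, j) - h (i, j - 1) - h (j, n + 1 - i) + h (j, n - i)"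
    if v: "v = (i, j)" "v \<in> C_set n" "\<not> (even n \<and> v = (k, k))" and h: "\<And>i. h (i, 0) = 0"
    for v i j and h :: "nat \<times> nat \<Rightarrow> 'b::comm_ring_1"
  proof -
    have "(\<Sum>e\<in>E. of_int (A v e) * h e) = (\<Sum>e\<in>C_tilde n. of_int (cell_row n v e) * h e)"
      using v loop E finite_C_tilde
      by (intro sum.mono_neutral_cong_left) (auto simp: A_def E_def split: if_splits)
    then show ?thesis using sum_cell_row[of i j n h] v h by simp
  qed
  have central: "(\<Sum>e\<in>E. of_int (A (k, k) e) * h e) = h (k, k + 1) - h (k, k - 1)" if "even n"
    for h :: "nat \<times> nat \<Rightarrow> 'b::comm_ring_1"
  proof -
    have in_E: "(k, k + 1) \<in> E" "(k, k - 1) \<in> E" using that center[OF that] by (auto simp: E_def C_tilde_iff k_def)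
    have "(\<Sum>e\<in>E. of_int (A (k, k) e) * h e) = (\<Sum>e\<in>E. of_bool (e = (k, k + 1)) * h e) - (\<Sum>e\<in>E. of_bool (e = (k, k - 1)) * h e)"
      using that by (simp add: A_def left_diff_distrib sum_subtractf)
    also have "\<dots> = h (k, k + 1) - h (k, k - 1)"
      using in_E E(2) by (simp add: of_bool_def if_distrib[of "\<lambda>x. x * _"] cong: if_cong)
    finally show ?thesis .
  qed
  have "frac_sol (C_set n) E A (\<lambda>_. 0) y"
    unfolding frac_sol_def
  proof (intro conjI ballI)
    fix v assume v: "v \<in> C_set n"
    obtain i j where ij: "v = (i, j)" by (cases v)
    show "(\<Sum>e\<in>E. real_of_int (A v e) * y e) = real_of_int 0"
    proof (cases "even n \<and> v = (k, k)")
      case True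
      then show ?thesis using central[of y] center by simp
    next
      case False
      then show ?thesis using noncentral[OF ij v False, of y] y0 eq v ij by (auto simp: cell_equations_def)
    qed
  qed (use y01 E in auto)
  moreover have "parity_cuts (C_set n) E A (\<lambda>_. 0) y"
    using cut by (simp add: parity_cuts_def bdA)
  ultimately have "decomposable (C_set n) E A (\<lambda>_. 0) y"
    using te finite_C_set E(2) by (intro edmonds_johnson_01) auto
  then obtain w where w: "mixture E (int_sol (C_set n) E A (\<lambda>_. 0)) y w"
    by (auto simp: decomposable_def)
  define w' where "w' = (\<lambda>q. sum w {p \<in> Pow E. g p = q})"
  have w': "mixture (C_tilde n) (\<lambda>p. cell_equations n (\<lambda>e. of_bool (e \<in> p) :: int)) y w'"
    unfolding w'_def
  proof (rule mixture_push[OF finite_C_tilde E(2) w])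
    fix p assume p: "p \<subseteq> E"
    have kk: "(k, k) \<in> C_tilde n" if "even n" using center[OF that] that by (auto simp: C_tilde_iff k_def)
    show sub: "g p \<subseteq> C_tilde n" using p E kk by (auto simp: g_def)
    assume sol: "int_sol (C_set n) E A (\<lambda>_. 0) p"
    define h :: "nat \<times> nat \<Rightarrow> int" where "h = (\<lambda>e. of_bool (e \<in> g p))"
    have h0: "h (i, 0) = 0" for i using sub by (auto simp: h_def C_tilde_iff)
    have hp: "h e = of_bool (e \<in> p)" if "e \<noteq> (k, k) \<or> odd n" for e using that by (auto simp: h_def g_def)
    have hE: "h e = of_bool (e \<in> p)" if "e \<in> E" for e
      using that by (intro hp) (auto simp: E_def split: if_splits)
    have sum0: "(\<Sum>e\<in>E. of_int (A v e) * h e) = 0" if "v \<in> C_set n" for v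
    proof -
      have "(\<Sum>e\<in>E. of_int (A v e) * h e) = (\<Sum>e\<in>E. A v e * of_bool (e \<in> p))"
        by (intro sum.cong refl) (simp add: hE)
      also have "\<dots> = (\<Sum>e\<in>p. A v e)"
        using p E(2) by (intro sum.mono_neutral_cong_right) auto
      finally show ?thesis using sol that by (simp add: int_sol_def)
    qed
    have "h (i, j) - h (i, j - 1) = h (j, n + 1 - i) - h (j, n - i)" if ij: "(i, j) \<in> C_set n" for i j
    proof (cases "even n \<and> (i, j) = (k, k)")
      case True
      then have "h (k, k + 1) = h (k, k - 1)" using central[of h] sum0 ij by auto
      moreover have "h (k, k) = h (k, k - 1)"
      proof -
        have "(k, k) \<notin> p" using p True by (auto simp: E_def)
        moreover have "k - 1 \<noteq> k" using center(1) True by auto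
        ultimately show ?thesis using True by (auto simp: h_def g_def)
      qed
      moreover have "n + 1 - k = k + 1" "n - k = k" using True by (auto simp: k_def)
      ultimately show ?thesis using True by simp
    next
      case False
      then show ?thesis using noncentral[OF refl ij False, of h] h0 sum0[OF ij] by simp
    qed
    then show "g p \<subseteq> C_tilde n \<and> cell_equations n (\<lambda>e. of_bool (e \<in> g p) :: int)"
      using sub unfolding cell_equations_def h_def by blast
  next
    fix e assume e: "e \<in> C_tilde n"
    have yE: "sum w {p \<in> Pow E. e \<in> p} = y e" if "e \<in> E" for e using w that by (simp add: mixture_def)
    show "sum w {p \<in> Pow E. e \<in> g p} = y e"
    proof (cases "e \<in> E")
      case True
      then have "{p \<in> Pow E. e \<in> g p} = {p \<in> Pow E. e \<in> p}" by (auto simp: g_def E_def split: if_splits)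
      then show ?thesis using yE[OF True] by simp
    next
      case False
      then have ev: "even n" "e = (k, k)" using e by (auto simp: E_def split: if_splits)
      then have "{p \<in> Pow E. e \<in> g p} = {p \<in> Pow E. (k, k - 1) \<in> p}" by (auto simp: g_def E_def)
      moreover have "(k, k - 1) \<in> E" using ev center[OF ev(1)] by (auto simp: E_def C_tilde_iff k_def)
      ultimately show ?thesis using yE[of "(k, k - 1)"] center(2) ev by simp
    qed
  qed
  have sat: "(i, n) \<in> p" if nz: "w' p \<noteq> 0" and i: "i \<in> {1..n div 2}" for p i
  proof (rule mixture_certain[OF w' finite_C_tilde _ _ nz])
    show "(i, n) \<in> C_tilde n" using i by (auto simp: C_tilde_iff)
    show "y (i, n) = 1" by (rule yn[OF i])
  qed
  have "p \<subseteq> C_tilde n \<and> cell_equations n (\<lambda>e. of_bool (e \<in> p) :: int)" if "w' p \<noteq> 0" for p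
    using w' that unfolding mixture_def by blast
  then have "mixture (C_tilde n) (\<lambda>p. (\<forall>i\<in>{1..n div 2}. (i, n) \<in> p) \<and>
    cell_equations n (\<lambda>e. of_bool (e \<in> p) :: int)) y w'"
    using w' sat unfolding mixture_def by simp
  then show ?thesis by (rule exI[of _ w'])
qed

section \<open>Quarter-turn symmetric matrices\<close>

text \<open>\<open>C_set\<close> contains one representative of every orbit of the quarter turn
  except the fixed centre of an odd square. One rotation equation per orbit, together with half-turn
  invariance, yields the other three.\<close>

lemma rotation_orbit:
  fixes x :: "nat \<Rightarrow> nat \<Rightarrow> 'a"
  assumes cells: "\<And>i j. (i, j) \<in> C_set n \<Longrightarrow> x i j = x j (n + 1 - i)"
    and half: "\<And>i j. i \<in> {1..n} \<Longrightarrow> j \<in> {1..n} \<Longrightarrow> x (n + 1 - i) (n + 1 - j) = x i j"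
    and ij: "i \<in> {1..n}" "j \<in> {1..n}"
  shows "x i j = x j (n + 1 - i)"
proof -
  obtain k r where k: "n = 2 * k + r" "r \<le> 1" "n div 2 = k" "(n + 1) div 2 = k + r" by (rule halves)
  have C: "(i, j) \<in> C_set n \<longleftrightarrow> 1 \<le> i \<and> i \<le> k + r \<and> 1 \<le> j \<and> j \<le> k" for i j
    unfolding C_set_iff k(3,4) ..
  have turn: "x j' (n + 1 - i') = x (n + 1 - i') (n + 1 - j')"
    if c: "x i' j' = x j' (n + 1 - i')" and b: "i' \<in> {1..n}" "j' \<in> {1..n}" for i' j'
    using half[OF b] c by simp
  have upper: "x i j = x j (n + 1 - i)" if b: "1 \<le> i" "i \<le> k" "1 \<le> j" "j \<le> n" for i j
  proof (cases "j \<le> k")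
    case True
    then show ?thesis using b by (intro cells) (simp add: C)
  next
    case False
    define i' where "i' = n + 1 - j"
    have i': "1 \<le> i'" "i' \<le> k + r" "j = n + 1 - i'" using False b k(1) by (auto simp: i'_def)
    have c: "x i' i = x i (n + 1 - i')" using i' b by (intro cells) (simp add: C)
    have "i' \<in> {1..n}" "i \<in> {1..n}" using i' b k(1,2) by auto
    from turn[OF c this] show ?thesis using i'(3) by simp
  qed
  have turned: "x i j = x j (n + 1 - i)"
    if u: "x (n + 1 - i) (n + 1 - j) = x (n + 1 - j) (n + 1 - (n + 1 - i))" and b: "i \<in> {1..n}" "j \<in> {1..n}" for i j
  proof -
    have 1: "x (n + 1 - i) (n + 1 - j) = x i j" by (rule half[OF b])
    have "n + 1 - i \<in> {1..n}" "n + 1 - (n + 1 - i) = i" using b by auto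
    then have 2: "x (n + 1 - j) i = x j (n + 1 - i)" using half[OF b(2), of "n + 1 - i"] by simp
    show ?thesis using u 1 2 \<open>n + 1 - (n + 1 - i) = i\<close> by simp
  qed
  consider "i \<le> k" | "k + r < i" | "r = 1" "i = k + 1" using k(2) by linarith
  then show ?thesis
  proof cases
    case 1
    then show ?thesis using upper ij by simp
  next
    case 2
    have "1 \<le> n + 1 - i" "n + 1 - i \<le> k" "1 \<le> n + 1 - j" "n + 1 - j \<le> n" using 2 ij k(1) by auto
    then show ?thesis using turned[OF upper ij] by simp
  next
    case 3
    consider "j \<le> k" | "j = k + 1" | "k + 1 < j" by linarith
    then show ?thesis
    proof cases
      case 1
      then show ?thesis using 3 ij by (intro cells) (simp add: C)
    next
      case 2
      then show ?thesis using 3 k(1) by simp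
    next
      case j: 3
      have "(n + 1 - i, n + 1 - j) \<in> C_set n" unfolding C using 3 j ij k(1) by auto
      then show ?thesis using ij by (rule turned[OF cells])
    qed
  qed
qed

text \<open>The core fixes the prefix sums of the upper half; the lower half is their half-turn image.\<close>

definition full_prefix :: "nat \<Rightarrow> (nat \<times> nat) set \<Rightarrow> nat \<Rightarrow> nat \<Rightarrow> real" where
  "full_prefix n p i j = (if i \<le> n div 2 \<or> odd n \<and> i = n div 2 + 1 \<and> j \<le> n div 2
     then of_bool ((i, j) \<in> p) else 1 - of_bool ((n + 1 - i, n - j) \<in> p))"

text \<open>The first \<open>n - j\<close> entries of the half-turned row are the last
  \<open>n - j\<close> entries of the row, whence the complement to 1. Exactly one of the two
  positions lies in the branch read off directly from \<open>p\<close>.\<close>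

lemma full_prefix_half_turn:
  assumes "i \<in> {1..n}" "j \<le> n"
  shows "full_prefix n p (n + 1 - i) (n - j) = 1 - full_prefix n p i j"
proof -
  obtain k r where k: "n = 2 * k + r" "r \<le> 1" "n div 2 = k" "(n + 1) div 2 = k + r" by (rule halves)
  have o: "odd n \<longleftrightarrow> r = 1" using k(1,2) by (auto simp: le_Suc_eq)
  have "n + 1 - i \<le> k \<or> r = 1 \<and> n + 1 - i = k + 1 \<and> n - j \<le> k \<longleftrightarrow> \<not> (i \<le> k \<or> r = 1 \<and> i = k + 1 \<and> j \<le> k)"
    using assms k(1,2) by auto
  moreover have "n + 1 - (n + 1 - i) = i" "n - (n - j) = j" using assms by auto
  ultimately show ?thesis unfolding full_prefix_def k(3) o by auto
qed

text \<open>Rows alternate because they are differences of 0/1 sequences from 0 to 1. By rotation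
  invariance a column is a row read backwards and inherits this.\<close>

lemma QTSASM_of_prefix_set:
  fixes p :: "(nat \<times> nat) set"
  assumes p: "p \<subseteq> C_tilde CARD('n::{finite,linorder})" "\<And>i. i \<in> {1..CARD('n) div 2} \<Longrightarrow> (i, CARD('n)) \<in> p"
    and eq: "cell_equations CARD('n) (\<lambda>e. of_bool (e \<in> p) :: int)"
  defines "Y \<equiv> full_prefix CARD('n) p"
  shows "(of_entries (\<lambda>i j. Y i j - Y i (j - 1)) :: real ^ 'n::{finite,linorder} ^ 'n::{finite,linorder}) \<in> ASM \<inter> P_QTS"
proof -
  define n where "n = CARD('n)"
  define x where "x i j = Y i j - Y i (j - 1)" for i j
  note p = p[folded n_def] and eq = eq[folded n_def]
  obtain k r where k: "n = 2 * k + r" "r \<le> 1" "n div 2 = k" "(n + 1) div 2 = k + r" by (rule halves)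
  have o: "odd n \<longleftrightarrow> r = 1" using k(1,2) by (auto simp: le_Suc_eq)
  have C: "(i, j) \<in> C_set n \<longleftrightarrow> 1 \<le> i \<and> i \<le> k + r \<and> 1 \<le> j \<and> j \<le> k" for i j
    unfolding C_set_iff k(3,4) ..
  have Ydef: "Y i j = (if i \<le> k \<or> r = 1 \<and> i = k + 1 \<and> j \<le> k
     then of_bool ((i, j) \<in> p) else 1 - of_bool ((n + 1 - i, n - j) \<in> p))" for i j
    unfolding Y_def n_def[symmetric] full_prefix_def k(3) o ..
  have Yhalf: "Y (n + 1 - i) (n - j) = 1 - Y i j" if "i \<in> {1..n}" "j \<le> n" for i j
    using full_prefix_half_turn[OF that] unfolding Y_def n_def[symmetric] .
  have p0: "(i, 0) \<notin> p" for i using p(1) by (auto simp: C_tilde_iff)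
  have pn: "(i, n) \<in> p" if "1 \<le> i" "i \<le> k" for i using p(2)[of i] that k(3) by simp
  have Y0: "Y i 0 = 0" if "i \<in> {1..n}" for i
  proof (cases "i \<le> k \<or> r = 1 \<and> i = k + 1")
    case True
    then show ?thesis using p0 by (auto simp: Ydef)
  next
    case False
    then have "1 \<le> n + 1 - i" "n + 1 - i \<le> k" using that k(1,2) by auto
    then show ?thesis using pn False by (auto simp: Ydef)
  qed
  have Yn: "Y i n = 1" if "i \<in> {1..n}" for i
  proof -
    have "n + 1 - i \<in> {1..n}" using that by auto
    then show ?thesis using Yhalf[OF that, of n] Y0[of "n + 1 - i"] by simp
  qed
  have Y01: "Y i j = 0 \<or> Y i j = 1" for i j by (auto simp: Ydef)
  have half: "x (n + 1 - i) (n + 1 - j) = x i j" if b: "i \<in> {1..n}" "j \<in> {1..n}" for i j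
  proof -
    have e: "n + 1 - j = n - (j - 1)" "n - (j - 1) - 1 = n - j" and le: "j \<le> n" "j - 1 \<le> n" using b by auto
    show ?thesis unfolding x_def e using Yhalf[OF b(1) le(1)] Yhalf[OF b(1) le(2)] by linarith
  qed
  have cells: "x i j = x j (n + 1 - i)" if c: "(i, j) \<in> C_set n" for i j
  proof -
    have "of_bool ((i, j) \<in> p) - of_bool ((i, j - 1) \<in> p) =
      (of_bool ((j, n + 1 - i) \<in> p) - of_bool ((j, n - i) \<in> p) :: int)"
      using eq c unfolding cell_equations_def by blast
    from arg_cong[OF this, of real_of_int]
    have "of_bool ((i, j) \<in> p) - of_bool ((i, j - 1) \<in> p) =
      (of_bool ((j, n + 1 - i) \<in> p) - of_bool ((j, n - i) \<in> p) :: real)"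
      by (simp only: of_int_diff of_int_of_bool)
    moreover have "i \<le> k \<or> r = 1 \<and> i = k + 1" "j \<le> k" "n + 1 - i - 1 = n - i"
      using c k(2) unfolding C by auto
    ultimately show ?thesis by (auto simp: x_def Ydef)
  qed
  have rot: "x i j = x j (n + 1 - i)" if "i \<in> {1..n}" "j \<in> {1..n}" for i j
    using rotation_orbit[of n x i j] cells half that by blast
  let ?X = "of_entries x :: real ^ 'n::{finite,linorder} ^ 'n::{finite,linorder}"
  have e: "entry ?X i j = x i j" if "i \<in> {1..n}" "j \<in> {1..n}" for i j
    using that unfolding n_def by (rule entry_of_entries)
  have "alternating_line (map (\<lambda>j. entry ?X i j) [1..<n + 1])" if i: "i \<in> {1..n}" for i
  proof -
    have eq: "map (\<lambda>j. entry ?X i j) [1..<n + 1] = map (\<lambda>j. Y i j - Y i (j - 1)) [1..<n + 1]"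
    proof (rule map_cong[OF refl])
      fix j assume "j \<in> set [1..<n + 1]"
      then have "j \<in> {1..n}" by auto
      then show "entry ?X i j = Y i j - Y i (j - 1)" using e[OF i] unfolding x_def by blast
    qed
    show ?thesis unfolding eq using Y0 Yn Y01 i by (intro alternating_line_differences) blast+
  qed
  moreover have "alternating_line (map (\<lambda>i. entry ?X i j) [1..<n + 1])" if j: "j \<in> {1..n}" for j
  proof -
    \<comment> \<open>Partial sums of column \<open>j\<close> from the top, that is, of row
      \<open>j\<close> from its right end.\<close>
    define Z where "Z i = 1 - Y j (n - i)" for i
    have "entry ?X i j = Z i - Z (i - 1)" if "i \<in> {1..n}" for i
    proof -
      have "n - (i - 1) = n + 1 - i" "n + 1 - i - 1 = n - i" using that by auto
      then have "Z i - Z (i - 1) = x j (n + 1 - i)" by (simp only: Z_def x_def)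
      then show ?thesis using e[OF that j] rot[OF that j] by simp
    qed
    then have eq: "map (\<lambda>i. entry ?X i j) [1..<n + 1] = map (\<lambda>i. Z i - Z (i - 1)) [1..<n + 1]"
      by (intro map_cong refl) (auto simp del: upt_Suc)
    have "Z i = 0 \<or> Z i = 1" for i using Y01[of j "n - i"] by (auto simp: Z_def)
    moreover have "Z 0 = 0" "Z n = 1" using Y0 Yn j by (auto simp: Z_def)
    ultimately show ?thesis unfolding eq by (intro alternating_line_differences) blast+
  qed
  moreover have "entry ?X i j = entry ?X j (n + 1 - i)" if b: "i \<in> {1..n}" "j \<in> {1..n}" for i j
  proof -
    have "n + 1 - i \<in> {1..n}" using b by auto
    then show ?thesis using rot b by (simp add: e)
  qed
  ultimately have "?X \<in> ASM \<inter> P_QTS" unfolding ASM_def P_QTS_def n_def[symmetric] by blast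
  then show ?thesis by (simp add: x_def[abs_def])
qed

section \<open>Passing to convex hulls\<close>

lemma P_ASM_row_prefix_sums:
  fixes X :: "real ^ 'n::{finite,linorder} ^ 'n::{finite,linorder}"
  assumes X: "X \<in> P_ASM" and i: "i \<in> {1..CARD('n)}"
  shows "m \<le> CARD('n) \<Longrightarrow> 0 \<le> (\<Sum>j=1..m. entry X i j) \<and> (\<Sum>j=1..m. entry X i j) \<le> 1"
    and "(\<Sum>j=1..CARD('n). entry X i j) = 1"
proof -
  let ?S = "{X :: real ^ 'n::{finite,linorder} ^ 'n::{finite,linorder}. (\<forall>m\<le>CARD('n). 0 \<le> (\<Sum>j=1..m. entry X i j) \<and> (\<Sum>j=1..m. entry X i j) \<le> 1) \<and>
    (\<Sum>j=1..CARD('n). entry X i j) = 1}"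
  have "convex ?S"
  proof (rule convexI)
    fix X Z :: "real ^ 'n::{finite,linorder} ^ 'n::{finite,linorder}" and u v :: real
    assume XZ: "X \<in> ?S" "Z \<in> ?S" and uv: "0 \<le> u" "0 \<le> v" "u + v = 1"
    have s: "(\<Sum>j=1..m. entry (u *\<^sub>R X + v *\<^sub>R Z) i j) = u * (\<Sum>j=1..m. entry X i j) + v * (\<Sum>j=1..m. entry Z i j)" for m
      by (simp add: entry_scale_add sum.distrib sum_distrib_left)
    show "u *\<^sub>R X + v *\<^sub>R Z \<in> ?S"
      unfolding mem_Collect_eq s
    proof (intro conjI allI impI)
      fix m assume m: "m \<le> CARD('n)"
      have X: "0 \<le> (\<Sum>j=1..m. entry X i j)" "(\<Sum>j=1..m. entry X i j) \<le> 1"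
        and Z: "0 \<le> (\<Sum>j=1..m. entry Z i j)" "(\<Sum>j=1..m. entry Z i j) \<le> 1"
        using XZ m by blast+
      show "0 \<le> u * (\<Sum>j=1..m. entry X i j) + v * (\<Sum>j=1..m. entry Z i j)"
        using X(1) Z(1) uv by (intro add_nonneg_nonneg mult_nonneg_nonneg)
      show "u * (\<Sum>j=1..m. entry X i j) + v * (\<Sum>j=1..m. entry Z i j) \<le> 1"
        using X(2) Z(2) uv by (rule convex_bound_le)
    next
      have "(\<Sum>j=1..CARD('n). entry X i j) = 1" "(\<Sum>j=1..CARD('n). entry Z i j) = 1" using XZ by blast+
      then show "u * (\<Sum>j=1..CARD('n). entry X i j) + v * (\<Sum>j=1..CARD('n). entry Z i j) = 1"
        using uv(3) by (simp only: mult_1_right)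
    qed
  qed
  moreover have "ASM \<subseteq> ?S"
  proof
    fix X :: "real ^ 'n::{finite,linorder} ^ 'n::{finite,linorder}" assume "X \<in> ASM"
    then have "alternating_line (map (\<lambda>j. entry X i j) [1..<CARD('n) + 1])"
      using i unfolding ASM_def by blast
    note a = alternating_line_prefix_sums[OF this]
    have "0 \<le> (\<Sum>j=1..m. entry X i j) \<and> (\<Sum>j=1..m. entry X i j) \<le> 1" if "m \<le> CARD('n)" for m
      using a(1)[OF that] by auto
    then show "X \<in> ?S" using a(2) by simp
  qed
  ultimately have "P_ASM \<subseteq> ?S" unfolding P_ASM_def by (intro hull_minimal)
  then have "X \<in> ?S" using X by blast
  then show "m \<le> CARD('n) \<Longrightarrow> 0 \<le> (\<Sum>j=1..m. entry X i j) \<and> (\<Sum>j=1..m. entry X i j) \<le> 1"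
    "(\<Sum>j=1..CARD('n). entry X i j) = 1" by auto
qed

lemma convex_P_QTS: "convex (P_QTS :: (real ^ 'n::{finite,linorder} ^ 'n::{finite,linorder}) set)"
  by (auto intro!: convexI simp: P_QTS_def entry_scale_add)

lemma QTSASM_inequality:
  fixes X :: "real ^ 'n::{finite,linorder} ^ 'n::{finite,linorder}"
  assumes n_def: "n = CARD('n)" and m: "m = n div 2" and X: "X \<in> ASM \<inter> P_QTS" and s: "s \<in> S_set n"
  shows "(\<Sum>(i, j)\<in>C_tilde n. real_of_int (s (i, j)) * (\<Sum>j'=1..j. entry X i j')) / 2
    \<le> real_of_int \<lfloor>(real (card {(i, j) \<in> C_tilde n. s (i, j) = 1})
       - real (card {i \<in> {1..m}. s (i, n) = -1})) / 2\<rfloor>"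
proof -
  define x where "x i j = \<lfloor>entry X i j\<rfloor>" for i j
  have al: "alternating_line (map (\<lambda>j. entry X i j) [1..<n + 1])" if "i \<in> {1..n}" for i
    using X that unfolding ASM_def n_def by blast
  have x: "entry X i j = of_int (x i j)" if "i \<in> {1..n}" "j \<in> {1..n}" for i j
  proof -
    have "set (map (\<lambda>j. entry X i j) [1..<n + 1]) \<subseteq> {0, 1, -1}"
      using al[OF that(1)] unfolding alternating_line_def by (rule conjunct1)
    moreover have "entry X i j \<in> set (map (\<lambda>j. entry X i j) [1..<n + 1])"
      using that(2) unfolding set_map set_upt by (intro imageI) simp
    ultimately have "entry X i j \<in> {0, 1, -1}" by blast
    then show ?thesis by (auto simp: x_def)
  qed
  have sx: "(\<Sum>j'=1..j. entry X i j') = of_int (\<Sum>j'=1..j. x i j')" if "i \<in> {1..n}" "j \<le> n" for i j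
    using that by (auto simp: x intro!: sum.cong)
  have "(\<Sum>(i, j)\<in>C_tilde n. real_of_int (s (i, j)) * (\<Sum>j'=1..j. entry X i j')) =
    (\<Sum>(i, j)\<in>C_tilde n. real_of_int (s (i, j)) * of_int (\<Sum>j'=1..j. x i j'))"
  proof (intro sum.cong refl)
    fix c assume c: "c \<in> C_tilde n"
    obtain i j where ij: "c = (i, j)" by (cases c)
    have "i \<in> {1..n}" "j \<le> n" using c ij by (auto simp: C_tilde_iff elim!: oddE)
    then show "(case c of (i, j) \<Rightarrow> real_of_int (s (i, j)) * (\<Sum>j'=1..j. entry X i j')) =
      (case c of (i, j) \<Rightarrow> real_of_int (s (i, j)) * of_int (\<Sum>j'=1..j. x i j'))"
      unfolding ij prod.case by (simp only: sx)
  qed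
  also have "\<dots> = real_of_int (\<Sum>(i, j)\<in>C_tilde n. s (i, j) * (\<Sum>j'=1..j. x i j'))"
    by (simp add: case_prod_unfold)
  finally have L: "(\<Sum>(i, j)\<in>C_tilde n. real_of_int (s (i, j)) * (\<Sum>j'=1..j. entry X i j')) =
    real_of_int (\<Sum>(i, j)\<in>C_tilde n. s (i, j) * (\<Sum>j'=1..j. x i j'))" .
  show ?thesis unfolding L m
  proof (rule QTS_integral_inequality)
    show "x i j = x j (n + 1 - i)" if "i \<in> {1..n}" "j \<in> {1..n}" for i j
      using X that by (simp add: P_QTS_def x_def n_def)
    show "(\<Sum>j'=1..j. x i j') \<in> {0, 1}" if "i \<in> {1..n}" "j \<le> n" for i j
    proof -
      have "real_of_int (\<Sum>j'=1..j. x i j') = 0 \<or> real_of_int (\<Sum>j'=1..j. x i j') = 1"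
        using alternating_line_prefix_sums(1)[OF al[OF that(1)] that(2)] unfolding sx[OF that] .
      then have "(\<Sum>j'=1..j. x i j') = 0 \<or> (\<Sum>j'=1..j. x i j') = 1" unfolding of_int_eq_0_iff of_int_eq_1_iff .
      then show ?thesis by blast
    qed
    show "(\<Sum>j'=1..n. x i j') = 1" if "i \<in> {1..n}" for i
    proof -
      have "real_of_int (\<Sum>j'=1..n. x i j') = 1"
        using alternating_line_prefix_sums(2)[OF al[OF that]] unfolding sx[OF that order_refl] .
      then show ?thesis by linarith
    qed
    show "s \<in> S_set n" by (rule s)
  qed
qed

text \<open>The prefix sums of \<open>X\<close> on \<open>C_tilde n\<close> are a mixture of sets,
  each of which extends to a matrix by \<open>full_prefix\<close>. This extension is affine in the
  indicator of the set, and the prefix sums of \<open>X\<close> obey the same half-turn law, so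
  \<open>X\<close> is the mean of these matrices.\<close>

lemma QTSASM_decomposition:
  fixes X :: "real ^ 'n::{finite,linorder} ^ 'n::{finite,linorder}"
  assumes n_def: "n = CARD('n)" and m: "m = n div 2" and X: "X \<in> P_ASM" "X \<in> P_QTS"
    and ineq: "\<And>s. s \<in> S_set n \<Longrightarrow>
      (\<Sum>(i, j)\<in>C_tilde n. real_of_int (s (i, j)) * (\<Sum>j'=1..j. entry X i j')) / 2
      \<le> real_of_int \<lfloor>(real (card {(i, j) \<in> C_tilde n. s (i, j) = 1})
         - real (card {i \<in> {1..m}. s (i, n) = -1})) / 2\<rfloor>"
  shows "X \<in> P_QTSASM"
proof -
  define y where "y = (\<lambda>(i, j). \<Sum>j'=1..j. entry X i j')"
  have n: "0 < n" by (simp add: n_def)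
  have sym: "entry X i j = entry X j (n + 1 - i)" if "i \<in> {1..n}" "j \<in> {1..n}" for i j
    using X(2) that unfolding P_QTS_def n_def by blast
  have y0: "y (i, 0) = 0" for i by (simp add: y_def)
  have y01: "0 \<le> y (i, j) \<and> y (i, j) \<le> 1" if "i \<in> {1..n}" "j \<le> n" for i j
    using P_ASM_row_prefix_sums(1)[OF X(1)] that by (simp add: y_def n_def)
  have yn: "y (i, n) = 1" if "i \<in> {1..n}" for i
    using P_ASM_row_prefix_sums(2)[OF X(1)] that by (simp add: y_def n_def)
  have diff: "y (i, j) - y (i, j - 1) = entry X i j" if "1 \<le> j" for i j
    using that by (cases j) (simp_all add: y_def)
  have tilde: "i \<in> {1..n} \<and> j \<le> n" if "(i, j) \<in> C_tilde n" for i j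
    using that by (auto simp: C_tilde_iff elim!: oddE)
  have ceq: "cell_equations n y"
    unfolding cell_equations_def
  proof (intro ballI, clarify)
    fix i j assume c: "(i, j) \<in> C_set n"
    then have "(i, j) \<in> C_tilde n" "1 \<le> j" using C_set_subset by (blast, simp add: C_set_iff)
    then have b: "i \<in> {1..n}" "j \<in> {1..n}" using tilde by auto
    have "n + 1 - i - 1 = n - i" "1 \<le> n + 1 - i" using b by auto
    then show "y (i, j) - y (i, j - 1) = y (j, n + 1 - i) - y (j, n - i)"
      using diff[of j i] diff[of "n + 1 - i" j] sym[OF b] \<open>1 \<le> j\<close> by simp
  qed
  have cut: "1 \<le> gap (bd (C_tilde n) (cell_row n) U) F y"
    if "U \<subseteq> C_set n" "F \<subseteq> bd (C_tilde n) (cell_row n) U" "odd (card F)" for U F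
  proof (rule parity_cut_inequality[OF _ _ _ that])
    fix s assume "s \<in> S_set n"
    from ineq[OF this]
    show "(\<Sum>e\<in>C_tilde n. real_of_int (s e) * y e) / 2 \<le>
      real_of_int \<lfloor>(real (card {e \<in> C_tilde n. s e = 1}) - real (card {i \<in> {1..n div 2}. s (i, n) = -1})) / 2\<rfloor>"
      unfolding m y_def by (simp add: case_prod_unfold)
  next
    show "0 \<le> y e \<and> y e \<le> 1" if "e \<in> C_tilde n" for e
      using y01 tilde that by (cases e) auto
    show "y (i, n) = 1" if "i \<in> {1..n div 2}" for i using that by (intro yn) auto
  qed
  have c01: "0 \<le> y e \<and> y e \<le> 1" if "e \<in> C_tilde n" for e
    using y01 tilde that by (cases e) auto
  have cn: "y (i, n) = 1" if "i \<in> {1..n div 2}" for i using that by (intro yn) auto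
  have "\<exists>w. mixture (C_tilde n) (\<lambda>p. (\<forall>i\<in>{1..n div 2}. (i, n) \<in> p) \<and>
    cell_equations n (\<lambda>e. of_bool (e \<in> p) :: int)) y w"
    by (intro prefix_sums_decomposable n y0 c01 cn ceq cut)
  then obtain w where w: "mixture (C_tilde n) (\<lambda>p. (\<forall>i\<in>{1..n div 2}. (i, n) \<in> p) \<and>
    cell_equations n (\<lambda>e. of_bool (e \<in> p) :: int)) y w"
    by (rule exE)
  define M where "M p = (of_entries (\<lambda>i j. full_prefix n p i j - full_prefix n p i (j - 1)) :: real ^ 'n::{finite,linorder} ^ 'n::{finite,linorder})" for p
  define P where "P = {p \<in> Pow (C_tilde n). w p \<noteq> 0}"
  have finP: "finite P" using finite_C_tilde by (simp add: P_def)
  have sumP: "(\<Sum>p\<in>P. w p * h p) = (\<Sum>p\<in>Pow (C_tilde n). w p * h p)" for h :: "(nat \<times> nat) set \<Rightarrow> real"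
    unfolding P_def using finite_C_tilde[of n] by (intro sum.mono_neutral_left) auto
  have w1: "sum w P = 1" using sumP[of "\<lambda>_. 1"] w by (simp add: mixture_def)
  have M: "M p \<in> ASM \<inter> P_QTS" if "p \<in> P" for p
  proof -
    have "p \<subseteq> C_tilde n" "\<forall>i\<in>{1..n div 2}. (i, n) \<in> p" "cell_equations n (\<lambda>e. of_bool (e \<in> p) :: int)"
      using w that unfolding mixture_def P_def by blast+
    then show ?thesis unfolding M_def n_def by (intro QTSASM_of_prefix_set) auto
  qed
  have mean: "(\<Sum>p\<in>P. w p * of_bool (e \<in> p)) = y e" if "e \<in> C_tilde n \<or> snd e = 0" for e
  proof (cases "e \<in> C_tilde n")
    case True
    have "(\<Sum>p\<in>Pow (C_tilde n). w p * of_bool (e \<in> p)) = sum w {p \<in> Pow (C_tilde n). e \<in> p}"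
      using finite_C_tilde[of n] by (intro sum.mono_neutral_cong_right) auto
    then show ?thesis using w True unfolding sumP mixture_def by simp
  next
    case False
    then have "e \<notin> p" if "p \<in> P" for p using that by (auto simp: P_def)
    moreover have "y e = 0" using False that y0 by (metis prod.collapse)
    ultimately show ?thesis by simp
  qed
  obtain k r where k: "n = 2 * k + r" "r \<le> 1" "n div 2 = k" "(n + 1) div 2 = k + r" by (rule halves)
  have o: "odd n \<longleftrightarrow> r = 1" using k(1,2) by (auto simp: le_Suc_eq)
  have Ct: "(i, j) \<in> C_tilde n \<longleftrightarrow> 1 \<le> i \<and> 1 \<le> j \<and> (i \<le> k \<and> j \<le> n \<or> r = 1 \<and> i = k + 1 \<and> j \<le> k)" for i j
    unfolding C_tilde_iff k(3) o ..
  have yhalf: "y (n + 1 - i, n - j) = 1 - y (i, j)" if b: "i \<in> {1..n}" "j \<le> n" for i j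
  proof -
    have "entry X (n + 1 - i) (n + 1 - j') = entry X i j'" if j': "j' \<in> {1..n}" for j'
    proof -
      have "n + 1 - i \<in> {1..n}" using b by auto
      then show ?thesis using sym[OF b(1) j'] sym[of j' "n + 1 - i"] j' by simp
    qed
    then have "(\<Sum>j'=j+1..n. entry X i j') = (\<Sum>j'=j+1..n. entry X (n + 1 - i) (n + 1 - j'))"
      by (intro sum.cong) auto
    also have "\<dots> = y (n + 1 - i, n - j)"
      unfolding y_def prod.case
      by (rule sum.reindex_bij_witness[of _ "\<lambda>a. n + 1 - a" "\<lambda>a. n + 1 - a"]) (use b in auto)
    finally have "y (n + 1 - i, n - j) = (\<Sum>j'=j+1..n. entry X i j')" ..
    moreover have "y (i, n) = y (i, j) + (\<Sum>j'=j+1..n. entry X i j')"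
    proof -
      have "{1..n} = {1..j} \<union> {j+1..n}" using b(2) by auto
      moreover have "sum (entry X i) ({1..j} \<union> {j+1..n}) = sum (entry X i) {1..j} + sum (entry X i) {j+1..n}"
        by (rule sum.union_disjoint) auto
      ultimately show ?thesis by (simp only: y_def prod.case)
    qed
    ultimately show ?thesis using yn[OF b(1)] by simp
  qed
  have full: "(\<Sum>p\<in>P. w p * full_prefix n p i j) = y (i, j)" if b: "i \<in> {1..n}" "j \<le> n" for i j
  proof (cases "i \<le> k \<or> r = 1 \<and> i = k + 1 \<and> j \<le> k")
    case True
    then have "(i, j) \<in> C_tilde n \<or> snd (i, j) = 0" using b by (auto simp: Ct)
    then show ?thesis using mean True by (simp add: full_prefix_def k(3) o)
  next
    case False
    then have "(n + 1 - i, n - j) \<in> C_tilde n \<or> snd (n + 1 - i, n - j) = 0"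
    proof (cases "r = 1 \<and> i = k + 1")
      case True
      then have "1 \<le> n + 1 - i" "n + 1 - i = k + 1" "n - j \<le> k" using False k(1) by auto
      then show ?thesis using True unfolding Ct by auto
    next
      case no: False
      then have "1 \<le> n + 1 - i" "n + 1 - i \<le> k" "n - j \<le> n" using False b k(1,2) by auto
      then show ?thesis unfolding Ct by auto
    qed
    then have "(\<Sum>p\<in>P. w p * of_bool ((n + 1 - i, n - j) \<in> p)) = 1 - y (i, j)"
      using mean yhalf[OF b] by simp
    moreover have "(\<Sum>p\<in>P. w p * full_prefix n p i j) = (\<Sum>p\<in>P. w p - w p * of_bool ((n + 1 - i, n - j) \<in> p))"
    proof (intro sum.cong refl)
      fix p
      have "full_prefix n p i j = 1 - of_bool ((n + 1 - i, n - j) \<in> p)"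
        unfolding full_prefix_def k(3) o using False by (simp only: if_False)
      then show "w p * full_prefix n p i j = w p - w p * of_bool ((n + 1 - i, n - j) \<in> p)"
        by (simp only: right_diff_distrib mult_1_right)
    qed
    ultimately show ?thesis using w1 by (simp add: sum_subtractf)
  qed
  have "X = (\<Sum>p\<in>P. w p *\<^sub>R M p)"
  proof (rule matrix_eqI)
    fix i j assume "i \<in> {1..CARD('n)}" "j \<in> {1..CARD('n)}"
    then have b: "i \<in> {1..n}" "j \<in> {1..n}" by (auto simp: n_def)
    have "entry (\<Sum>p\<in>P. w p *\<^sub>R M p) i j = (\<Sum>p\<in>P. w p * (full_prefix n p i j - full_prefix n p i (j - 1)))"
      unfolding entry_sum_scale M_def using b by (simp add: n_def entry_of_entries del: atLeastAtMost_iff)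
    also have "\<dots> = y (i, j) - y (i, j - 1)"
    proof -
      have "j \<le> n" "j - 1 \<le> n" using b by auto
      then show ?thesis using full[OF b(1)] by (simp only: right_diff_distrib sum_subtractf)
    qed
    also have "\<dots> = entry X i j" using b by (intro diff) simp
    finally show "entry X i j = entry (\<Sum>p\<in>P. w p *\<^sub>R M p) i j" ..
  qed
  also have "\<dots> \<in> convex hull (ASM \<inter> P_QTS)"
    using M w w1 finP by (intro convex_sum) (auto simp: mixture_def intro: hull_inc)
  finally show ?thesis unfolding P_QTSASM_def .
qed

theorem theorem6p5:
  fixes n k :: nat
  assumes "n = CARD('n::{finite,linorder})"
    and "k = n div 2"
  shows "(P_QTSASM :: (real ^ 'n::{finite,linorder} ^ 'n::{finite,linorder}) set) =
    {X \<in> P_ASM \<inter> P_QTS.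
       \<forall>s\<in>S_set n.
         (\<Sum>(i, j)\<in>C_tilde n. real_of_int (s (i, j)) * (\<Sum>j'=1..j. entry X i j')) / 2
         \<le> real_of_int \<lfloor>(real (card {(i, j) \<in> C_tilde n. s (i, j) = 1})
                          - real (card {i \<in> {1..k}. s (i, n) = -1})) / 2\<rfloor>}"
    (is "_ = {X \<in> _. \<forall>s\<in>_. ?L s X / 2 \<le> ?c s}")
proof
  have lin: "?L s (u *\<^sub>R X + v *\<^sub>R Z) = u * ?L s X + v * ?L s Z" for s u v and X Z :: "real ^ 'n::{finite,linorder} ^ 'n::{finite,linorder}"
    by (simp add: entry_scale_add sum.distrib sum_distrib_left case_prod_unfold algebra_simps)
  \<comment> \<open>By linearity of the left-hand side each inequality cuts out a convex set, so it
    is enough to check it at the matrices spanning the hull.\<close>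
  define G where "G s = {X :: real ^ 'n::{finite,linorder} ^ 'n::{finite,linorder}. ?L s X / 2 \<le> ?c s}" for s
  have rhs: "{X \<in> P_ASM \<inter> P_QTS. \<forall>s\<in>S_set n. ?L s X / 2 \<le> ?c s} = P_ASM \<inter> P_QTS \<inter> (\<Inter>s\<in>S_set n. G s)"
    unfolding G_def by (rule set_eqI) (simp only: mem_Collect_eq Int_iff INT_iff)
  have "convex (G s)" for s
  proof (rule convexI)
    fix X Z :: "real ^ 'n::{finite,linorder} ^ 'n::{finite,linorder}" and u v :: real
    assume "X \<in> G s" "Z \<in> G s" and uv: "0 \<le> u" "0 \<le> v" "u + v = 1"
    then have "?L s X / 2 \<le> ?c s" "?L s Z / 2 \<le> ?c s" by (simp_all only: G_def mem_Collect_eq)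
    then have "u * (?L s X / 2) + v * (?L s Z / 2) \<le> ?c s" using uv by (rule convex_bound_le)
    then show "u *\<^sub>R X + v *\<^sub>R Z \<in> G s" unfolding G_def mem_Collect_eq lin by simp
  qed
  then have conv: "convex (P_ASM \<inter> P_QTS \<inter> (\<Inter>s\<in>S_set n. G s))"
    by (intro convex_Int convex_INT convex_P_QTS) (simp_all add: P_ASM_def)
  have sub: "ASM \<inter> P_QTS \<subseteq> P_ASM \<inter> P_QTS \<inter> (\<Inter>s\<in>S_set n. G s)"
  proof
    fix X :: "real ^ 'n::{finite,linorder} ^ 'n::{finite,linorder}" assume X: "X \<in> ASM \<inter> P_QTS"
    have "X \<in> G s" if "s \<in> S_set n" for s
      unfolding G_def mem_Collect_eq by (rule QTSASM_inequality[OF assms X that])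
    moreover have "X \<in> P_ASM" using X unfolding P_ASM_def by (intro hull_inc) blast
    ultimately show "X \<in> P_ASM \<inter> P_QTS \<inter> (\<Inter>s\<in>S_set n. G s)" using X by blast
  qed
  show "(P_QTSASM :: (real ^ 'n::{finite,linorder} ^ 'n::{finite,linorder}) set) \<subseteq>
      {X \<in> P_ASM \<inter> P_QTS. \<forall>s\<in>S_set n. ?L s X / 2 \<le> ?c s}"
    unfolding rhs P_QTSASM_def using sub conv by (rule hull_minimal)
  show "{X \<in> P_ASM \<inter> P_QTS. \<forall>s\<in>S_set n. ?L s X / 2 \<le> ?c s} \<subseteq>
      (P_QTSASM :: (real ^ 'n::{finite,linorder} ^ 'n::{finite,linorder}) set)"
    unfolding rhs
  proof
    fix X :: "real ^ 'n::{finite,linorder} ^ 'n::{finite,linorder}"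
    assume X: "X \<in> P_ASM \<inter> P_QTS \<inter> (\<Inter>s\<in>S_set n. G s)"
    then have G: "X \<in> G s" if "s \<in> S_set n" for s using that by blast
    have "X \<in> P_ASM" "X \<in> P_QTS" using X by blast+
    then show "X \<in> P_QTSASM"
      by (rule QTSASM_decomposition[OF assms _ _ G[unfolded G_def mem_Collect_eq]])
  qed
qed

end
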